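(* $\mathcal{T}(W_0)=0$ for every initial condition $W_0=(w_0,\dot w_0)$ satisfying one of the following: (i) $W_0\in H^1\times L^2(\mathbb{T}^d)$ and $|Z(w_0)|=0$; (ii) $W_0\in H^1\times H^1(\mathbb{T}^d)$ and $|Z(W_0)|=0$.
   Context: Setting: $d\ge 1$ is an integer, $\mathbb{T}^d=\mathbb{R}^d/2\pi\mathbb{Z}^d$ with Lebesgue measure $|\cdot|$; all functions are real-valued. Let $\rho=2$ if $d=1$, $\rho$ be a fixed exponent $>2$ if $d=2$, and $\rho=d$ if $d\ge 3$. Fix $V\in L^\rho(\mathbb{T}^d)$. Control potentials: $V_0(x)=1$, $V_{2j-1}(x)=\sin(x_j)$, $V_{2j}(x)=\cos(x_j)$ for $j=1,\dots,d$. On $H^1\times L^2(\mathbb{T}^d)$, equipped with the norm $\|(w_1,w_2)\|^2=\int_{\mathbb{T}^d}(|\nabla w_1|^2+|w_1|^2+|w_2|^2)$, consider $A=\begin{pmatrix}0&1\\ \Delta-1&0\end{pmatrix}$ (domain $H^2\times H^1$), generating a group $(e^{tA})$ of isometries, and $B=\begin{pmatrix}0&0\\1&0\end{pmatrix}$. For a bounded operator $L$ on $H^1\times L^2$, $\exp(t(A+L))W_0$ is the unique $W\in C^0(\mathbb{R},H^1\times L^2)$ with $W(t)=e^{tA}W_0+\int_0^te^{(t-s)A}LW(s)\,ds$. The control system is $\frac{dW}{dt}=\big(A+VB+\sum_{j=0}^{2d}u_j(t)V_jB\big)W$; for piecewise constant $u:[0,T]\to\mathbb{R}^{2d+1}$,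 $W(t;u,W_0)$ is the solution with $W(0)=W_0$. A target $W_f$ is approximately reachable in time $T^+$ from $W_0$ if for every $\epsilon>0$ there exist $T_1\in[T,T+\epsilon]$ and piecewise constant $u:[0,T_1]\to\mathbb{R}^{2d+1}$ with $\|W(T_1;u,W_0)-W_f\|<\epsilon$; the system is approximately controllable in time $T^+$ from $W_0$ if every target in $H^1\times L^2$ is so; $\mathcal{T}(W_0)$ is the infimum of such $T\ge0$. For $f\in L^2(\mathbb{T}^d,\mathbb{R}^n)$, $Z(f)=f^{-1}(\{0\})$ (up to null sets); $Z(W_0)$ is the common zero set of $w_0$ and $\dot w_0$. *)

theory Defs
  imports "HOL-Analysis.Analysis"
begin

text \<open>The torus T^d is represented by the fundamental cube [0,2pi]^d, functions on
  T^d by real functions on real^'d restricted to the cube (equality a.e.).\<close>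

definition cube :: "(real^'d::finite) set" where
  "cube = cbox 0 (\<chi> i. 2 * pi)"

definition L2 :: "(real^'d::finite \<Rightarrow> real) \<Rightarrow> bool" where
  "L2 f \<longleftrightarrow> f \<in> borel_measurable (lebesgue_on cube)
     \<and> integrable (lebesgue_on cube) (\<lambda>x. (f x)^2)"

definition Lp :: "real \<Rightarrow> (real^'d::finite \<Rightarrow> real) \<Rightarrow> bool" where
  "Lp p f \<longleftrightarrow> f \<in> borel_measurable (lebesgue_on cube)
     \<and> integrable (lebesgue_on cube) (\<lambda>x. \<bar>f x\<bar> powr p)"

definition fc :: "(real^'d::finite \<Rightarrow> real) \<Rightarrow> int^'d \<Rightarrow> complex" where
  "fc f k = complex_of_real (1 / (2 * pi) ^ CARD('d)) *
     (LINT x|lebesgue_on cube. complex_of_real (f x) *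
        cis (- (\<Sum>i\<in>UNIV. real_of_int (k $ i) * x $ i)))"

definition ksq :: "int^'d::finite \<Rightarrow> real" where
  "ksq k = (\<Sum>i\<in>UNIV. (real_of_int (k $ i))^2)"

definition om :: "int^'d::finite \<Rightarrow> real" where
  "om k = sqrt (1 + ksq k)"

definition H1 :: "(real^'d::finite \<Rightarrow> real) \<Rightarrow> bool" where
  "H1 f \<longleftrightarrow> L2 f \<and> (\<lambda>k::int^'d. ksq k * (cmod (fc f k))^2) summable_on UNIV"

text \<open>\<integral> |\<nabla>w|^2 via Parseval.\<close>
definition grad_sq :: "(real^'d::finite \<Rightarrow> real) \<Rightarrow> real" where
  "grad_sq f = (2 * pi) ^ CARD('d) * (\<Sum>\<^sub>\<infinity>k::int^'d. ksq k * (cmod (fc f k))^2)"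

type_synonym 'd state = "(real^'d \<Rightarrow> real) \<times> (real^'d \<Rightarrow> real)"

definition hl_norm :: "'d::finite state \<Rightarrow> real" where
  "hl_norm W = sqrt (grad_sq (fst W) + (LINT x|lebesgue_on cube. (fst W x)^2)
                     + (LINT x|lebesgue_on cube. (snd W x)^2))"

definition hl_dist :: "'d::finite state \<Rightarrow> 'd state \<Rightarrow> real" where
  "hl_dist W1 W2 = hl_norm (\<lambda>x. fst W1 x - fst W2 x, \<lambda>x. snd W1 x - snd W2 x)"

text \<open>Control values in R^{2d+1}: (u_0, (u_{2j-1})_j, (u_{2j})_j), coefficients of
  V_0 = 1, V_{2j-1} = sin x_j, V_{2j} = cos x_j.\<close>
type_synonym 'd ctrl = "real \<times> ('d \<Rightarrow> real) \<times> ('d \<Rightarrow> real)"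

definition pot :: "(real^'d::finite \<Rightarrow> real) \<Rightarrow> 'd ctrl \<Rightarrow> real^'d \<Rightarrow> real" where
  "pot V c x = V x + fst c +
     (\<Sum>j\<in>UNIV. fst (snd c) j * sin (x $ j) + snd (snd c) j * cos (x $ j))"

definition piecewise_const :: "real \<Rightarrow> (real \<Rightarrow> 'd ctrl) \<Rightarrow> bool" where
  "piecewise_const T u \<longleftrightarrow> (\<exists>S. finite S \<and>
     (\<forall>t1\<in>{0..T}. \<forall>t2\<in>{0..T}. t1 \<le> t2 \<and> {t1..t2} \<inter> S = {} \<longrightarrow> u t1 = u t2))"

text \<open>Mild (Duhamel) solution on [0,T] of dW/dt = (A + (V + sum u_j V_j) B) W, W(0)=W0,
  continuous in H^1 x L^2; the Duhamel formula
  W(t) = e^{tA} W0 + \<integral>_0^t e^{(t-s)A} (0, P(s) w(s)) ds is written mode by mode,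
  using that e^{tA} acts on the k-th Fourier mode by the rotation with frequency om k.\<close>
definition mild_sol :: "(real^'d::finite \<Rightarrow> real) \<Rightarrow> real \<Rightarrow> (real \<Rightarrow> 'd ctrl) \<Rightarrow> 'd state
    \<Rightarrow> (real \<Rightarrow> 'd state) \<Rightarrow> bool" where
  "mild_sol V T u W0 W \<longleftrightarrow>
     (\<forall>t\<in>{0..T}. H1 (fst (W t)) \<and> L2 (snd (W t))) \<and>
     (\<forall>t\<in>{0..T}. ((\<lambda>s. hl_dist (W s) (W t)) \<longlongrightarrow> 0) (at t within {0..T})) \<and>
     (\<forall>t\<in>{0..T}. \<forall>k.
        fc (fst (W t)) k =
          complex_of_real (cos (om k * t)) * fc (fst W0) k
          + complex_of_real (sin (om k * t) / om k) * fc (snd W0) k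
          + integral {0..t} (\<lambda>s. complex_of_real (sin (om k * (t - s)) / om k) *
                fc (\<lambda>x. pot V (u s) x * fst (W s) x) k)
      \<and> fc (snd (W t)) k =
          complex_of_real (- om k * sin (om k * t)) * fc (fst W0) k
          + complex_of_real (cos (om k * t)) * fc (snd W0) k
          + integral {0..t} (\<lambda>s. complex_of_real (cos (om k * (t - s))) *
                fc (\<lambda>x. pot V (u s) x * fst (W s) x) k))"

definition approx_reachable :: "(real^'d::finite \<Rightarrow> real) \<Rightarrow> real \<Rightarrow> 'd state \<Rightarrow> 'd state \<Rightarrow> bool" where
  "approx_reachable V T W0 Wf \<longleftrightarrow> (\<forall>\<epsilon>>0. \<exists>T1\<in>{T..T+\<epsilon>}. \<exists>u::real \<Rightarrow> 'd ctrl.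
     piecewise_const T1 u \<and> (\<exists>W. mild_sol V T1 u W0 W \<and> hl_dist (W T1) Wf < \<epsilon>))"

definition approx_controllable :: "(real^'d::finite \<Rightarrow> real) \<Rightarrow> real \<Rightarrow> 'd state \<Rightarrow> bool" where
  "approx_controllable V T W0 \<longleftrightarrow>
     (\<forall>Wf. H1 (fst Wf) \<and> L2 (snd Wf) \<longrightarrow> approx_reachable V T W0 Wf)"

definition Tmin :: "(real^'d::finite \<Rightarrow> real) \<Rightarrow> 'd state \<Rightarrow> ereal" where
  "Tmin V W0 = Inf (ereal ` {T. 0 \<le> T \<and> approx_controllable V T W0})"

end

theory Submission
  imports Defs
begin

text \<open>
  The state \<open>(w, v)\<close> is encoded by the Fourier coefficients of \<open>\<surd>(1-\<Delta>) w\<close> and of \<open>v\<close>, so that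
  \<open>e\<^sup>t\<^sup>A\<close> is a rotation, and \<open>V \<in> L\<^sup>\<rho>\<close> is a bounded multiplier from \<open>H\<^sup>1\<close> to \<open>L\<^sup>2\<close> (critical Sobolev
  inequality, by splitting frequencies dyadically in terms of the level sets of the function).

  Controls of size \<open>1/\<tau>\<close> applied for time \<open>\<tau> \<rightarrow> 0\<close> act as impulses \<open>(w, v) \<mapsto> (w, v + \<phi> w)\<close>, with \<open>\<phi>\<close> in
  the span of the control potentials.  Framing a short free flow by opposite impulses of size
  \<open>\<phi>/\<surd>\<tau>\<close> produces the impulse \<open>-\<phi>\<^sup>2\<close>, and polarisation (\<open>cos\<^sup>2 + sin\<^sup>2 = 1\<close> supplies the missing sign)
  yields all products, hence all trigonometric polynomials \<open>\<phi>\<close>.  If \<open>w \<noteq> 0\<close> a.e., these are dense in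
  \<open>L\<^sup>2(w\<^sup>2 dx)\<close>, so every velocity can be reached from \<open>(w, v)\<close>.

  Constant impulses of size \<open>1/\<tau>\<close> around the free flow also give the scalings \<open>(w, v) \<mapsto> (l w, v/l)\<close>, and
  conjugating the free flow by a scaling with \<open>l \<rightarrow> 0\<close> gives the shear \<open>(w, v) \<mapsto> (w + \<theta> v, v)\<close> for
  \<open>v \<in> H\<^sup>1\<close>.  Thus \<open>(w\<^sub>0, v\<^sub>0) \<rightarrow> (w\<^sub>0, w\<^sub>f - w\<^sub>0) \<rightarrow> (w\<^sub>f, w\<^sub>f - w\<^sub>0) \<rightarrow> (w\<^sub>f, v\<^sub>f)\<close> as soon as \<open>w\<^sub>0\<close> and \<open>w\<^sub>f\<close>
  vanish almost nowhere; for \<open>w\<^sub>f\<close> this holds after adding a small constant, and in case (ii) it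
  holds for \<open>w\<^sub>0 + \<theta> v\<^sub>0\<close> for all but countably many \<open>\<theta>\<close>.
\<close>

text \<open>Reachability is approximate, so steps can only be chained if errors do not blow up:
  every control program in \<open>prog\<close> therefore has an end map that is Lipschitz in the
  initial state. The potential is merely a bounded operator from H1 to L2; the bound
  \<open>mbdd V C\<close> gives it an effect of order \<open>\<tau> * C\<close> on a flow of
  duration \<tau>, so it drops out of all limits \<tau> -> 0. The contraction condition
  \<open>\<tau> * C \<le> 1/2\<close> also limits a single impulse to sup norm 1/4, and larger
  impulses are made by repetition. One expansion of the flow from a velocity
  \<open>v + (\<kappa> / \<tau>) y\<close>, with y in H1, then serves three purposes: \<kappa> =
  sqrt \<tau> gives squares, \<kappa> = l - 1 gives scalings, \<kappa> = \<theta> gives shears. The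
  position is displaced by \<kappa> y, which must stay in H1. This is why trigonometric multipliers
  have to be shown to preserve H1, and why case (ii) asks for an initial velocity in H1.\<close>

lemma cis_sum: "finite A \<Longrightarrow> cis (sum f A) = (\<Prod>a\<in>A. cis (f a))"
  by (induction A rule: finite_induct) (auto simp: cis_mult[symmetric])

text \<open>Lebesgue measure on a Euclidean space is the image of the product of one-dimensional
  Lebesgue measures under the map from coordinates to vectors, so Fubini for finite products
  applies.\<close>

lemma integral_lborel_prod:
  fixes f :: "'a::euclidean_space \<Rightarrow> real \<Rightarrow> complex"
  assumes "\<And>b. b \<in> Basis \<Longrightarrow> integrable lborel (f b)"
  shows "(LINT x|lborel. (\<Prod>b\<in>Basis. f b (x \<bullet> b))) = (\<Prod>b\<in>Basis. LINT x|lborel. f b x)"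
proof -
  interpret product_sigma_finite "\<lambda>_::'a. lborel::real measure" by standard
  have m[measurable]: "f b \<in> borel_measurable borel" if "b \<in> Basis" for b
    using assms[OF that] by (auto dest: borel_measurable_integrable)
  have "(LINT x|lborel. (\<Prod>b\<in>Basis. f b (x \<bullet> b)))
      = (LINT g|(\<Pi>\<^sub>M b\<in>Basis. lborel). (\<Prod>b\<in>Basis. f b ((\<Sum>c\<in>Basis. g c *\<^sub>R c) \<bullet> b)))"
    by (subst lborel_eq, subst integral_distr) auto
  also have "\<dots> = (LINT g|(\<Pi>\<^sub>M b\<in>Basis. lborel). (\<Prod>b\<in>Basis. f b (g b)))"
    by (intro Bochner_Integration.integral_cong refl prod.cong) (auto simp: inner_sum_left_Basis)
  also have "\<dots> = (\<Prod>b\<in>Basis. LINT x|lborel. f b x)"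
    by (rule product_integral_prod) (use assms in auto)
  finally show ?thesis .
qed

lemma integral_cis_period:
  fixes m :: int
  shows "(LINT t|lborel. indicator {0..2*pi} t *\<^sub>R cis (of_int m * t)) = (if m = 0 then 2*pi else 0)"
proof (cases "m = 0")
  case True
  then show ?thesis by (simp add: scaleR_conv_of_real)
next
  case False
  have "(LINT t|lborel. indicator {0..2*pi} t *\<^sub>R cis (of_int m * t))
      = cis (of_int m * (2*pi)) / (\<i> * of_int m) - cis (of_int m * 0) / (\<i> * of_int m)"
  proof (rule integral_FTC_atLeastAtMost)
    fix x :: real
    assume "0 \<le> x" "x \<le> 2 * pi"
    have "((\<lambda>z. exp (\<i> * (of_int m * z)) / (\<i> * of_int m)) has_field_derivative exp (\<i> * (of_int m * of_real x)))
            (at (of_real x))"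
      using False by (auto intro!: derivative_eq_intros simp: field_simps)
    from has_vector_derivative_real_field[OF this]
    show "((\<lambda>a. cis (of_int m * a) / (\<i> * of_int m)) has_vector_derivative cis (of_int m * x))
            (at x within {0..2 * pi})"
      unfolding cis_conv_exp by simp
  qed (auto intro!: continuous_intros)
  moreover have "cis (of_int m * (2*pi)) = 1"
    using cis_multiple_2pi[of "of_int m"] by (simp add: mult.commute)
  ultimately show ?thesis using False by simp
qed

section \<open>Characters of the torus and their orthogonality\<close>

definition kdot :: "int^'d::finite \<Rightarrow> real^'d \<Rightarrow> real" where
  "kdot k x = (\<Sum>i\<in>UNIV. of_int (k $ i) * x $ i)"

definition ek :: "int^'d::finite \<Rightarrow> real^'d \<Rightarrow> complex" where
  "ek k x = cis (kdot k x)"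

abbreviation tm :: "(real^'d::finite) measure" where
  "tm \<equiv> lebesgue_on cube"

abbreviation vol :: "'d::finite itself \<Rightarrow> real" where
  "vol _ \<equiv> (2*pi) ^ CARD('d)"

lemma kdot_add: "kdot (k + l) x = kdot k x + kdot l x"
  by (simp add: kdot_def sum.distrib algebra_simps)

lemma kdot_minus: "kdot (- k) x = - kdot k x"
  by (simp add: kdot_def sum_negf)

lemma kdot_diff: "kdot (k - l) x = kdot k x - kdot l x"
  using kdot_add[of k "-l" x] by (simp add: kdot_minus)

lemma kdot_0 [simp]: "kdot 0 x = 0" by (simp add: kdot_def)

lemma kdot_axis: "kdot (axis j 1) x = x $ j"
  by (simp add: kdot_def axis_def if_distrib[of "\<lambda>y. real_of_int y * _"] cong: if_cong)

lemma ek_add: "ek (k + l) x = ek k x * ek l x"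
  by (simp add: ek_def kdot_add cis_mult)

lemma ek_minus: "ek (- k) x = cnj (ek k x)"
  by (simp add: ek_def kdot_minus cis_cnj)

lemma norm_ek [simp]: "norm (ek k x) = 1" by (simp add: ek_def)

lemma ek_0 [simp]: "ek 0 x = 1" by (simp add: ek_def)

lemma continuous_kdot: "continuous_on UNIV (kdot k)"
  unfolding kdot_def by (intro continuous_intros)

lemma continuous_ek: "continuous_on UNIV (ek k)"
  unfolding ek_def[abs_def] by (intro continuous_intros continuous_kdot)

lemma kdot_borel [measurable]: "kdot k \<in> borel_measurable borel"
  by (simp add: borel_measurable_continuous_onI continuous_kdot)

lemma ek_borel [measurable]: "ek k \<in> borel_measurable borel"
  by (simp add: borel_measurable_continuous_onI continuous_ek)

lemma cube_lmeasurable [simp]: "cube \<in> lmeasurable" "cube \<in> sets lebesgue"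
  by (auto simp: cube_def)

lemma cube_borel [simp]: "cube \<in> sets borel" by (simp add: cube_def)

lemma measurable_tmI: "f \<in> borel_measurable borel \<Longrightarrow> f \<in> borel_measurable tm"
  by (simp add: measurable_completion measurable_restrict_space1)

lemma ek_tm [measurable]: "ek k \<in> borel_measurable tm"
  by (intro measurable_tmI) simp

lemma finite_measure_tm: "finite_measure tm"
  by (simp add: finite_measure_lebesgue_on)

text \<open>The integral factorises over the coordinates, and a coordinate with nonzero frequency
  contributes a vanishing factor. The indicator of the cube is itself a product and is absorbed into
  the factors, so that the integral runs over the whole space.\<close>

lemma integral_ek:
  fixes k :: "int^'d::finite"
  shows "(LINT x|tm. ek k x) = (if k = 0 then vol TYPE('d) else 0)"
proof -
  define K :: "real^'d" where "K = (\<chi> i. of_int (k $ i))"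
  define f where "f = (\<lambda>b t. indicator {0..2*pi} t *\<^sub>R cis ((K \<bullet> b) * t))"
  have Kb: "K \<bullet> axis i 1 = of_int (k $ i)" for i
    by (simp add: K_def inner_axis)
  have "kdot k x = K \<bullet> x" for x :: "real^'d"
    by (simp add: kdot_def K_def inner_vec_def)
  then have kx: "kdot k x = (\<Sum>b\<in>Basis. (K \<bullet> b) * (x \<bullet> b))" for x :: "real^'d"
    by (simp add: euclidean_inner[of K x])
  have ind: "(indicator cube x :: real) = (\<Prod>b\<in>Basis. indicator {0..2*pi} (x \<bullet> b))" for x :: "real^'d"
  proof -
    have "x \<in> cube \<longleftrightarrow> (\<forall>b\<in>Basis. x \<bullet> b \<in> {0..2*pi})"
      by (auto simp: cube_def mem_box Basis_vec_def inner_axis)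
    then show ?thesis by (cases "x \<in> cube") (auto simp: indicator_def)
  qed
  have pf: "(\<Prod>b\<in>Basis. f b (x \<bullet> b)) = indicator cube x *\<^sub>R ek k x" for x :: "real^'d"
    by (simp add: f_def ind ek_def kx cis_sum scaleR_conv_of_real prod.distrib)
  have "(LINT x|tm. ek k x) = (LINT x|lebesgue. indicator cube x *\<^sub>R ek k x)"
    by (subst integral_restrict_space) auto
  also have "\<dots> = (LINT x|lborel. indicator cube x *\<^sub>R ek k x)"
    by (rule integral_completion) (auto intro!: borel_measurable_scaleR borel_measurable_indicator)
  also have "\<dots> = (\<Prod>b\<in>Basis. LINT t|lborel. f b t)"
    unfolding pf[symmetric]
  proof (rule integral_lborel_prod)
    fix b :: "real^'d"
    show "integrable lborel (f b)"
      unfolding f_def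
      by (rule borel_integrable_compact) (auto intro!: continuous_intros)
  qed
  also have "\<dots> = (\<Prod>i\<in>UNIV. LINT t|lborel. f (axis i 1) t)"
  proof -
    have eq: "(Basis :: (real^'d) set) = (\<lambda>i. axis i 1) ` UNIV"
      by (auto simp: Basis_vec_def)
    have "inj (\<lambda>i::'d. axis i (1::real))"
      by (auto simp: inj_on_def axis_eq_axis)
    then show ?thesis unfolding eq by (subst prod.reindex) auto
  qed
  also have "\<dots> = (\<Prod>i\<in>UNIV. if k $ i = 0 then complex_of_real (2*pi) else 0)"
    unfolding f_def Kb integral_cis_period by (intro prod.cong) auto
  also have "\<dots> = (if k = 0 then vol TYPE('d) else 0)"
  proof (cases "k = 0")
    case False
    then obtain i where "k $ i \<noteq> 0" by (auto simp: vec_eq_iff)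
    then have "(\<Prod>i\<in>UNIV. if k $ i = 0 then complex_of_real (2*pi) else 0) = 0"
      by (intro prod_zero) auto
    then show ?thesis using False by simp
  qed simp
  finally show ?thesis .
qed

section \<open>The algebra of real trigonometric polynomials\<close>

inductive trigpoly :: "(real^'d::finite \<Rightarrow> real) \<Rightarrow> bool" where
  tp_cos: "trigpoly (\<lambda>x. cos (kdot l x))"
| tp_sin: "trigpoly (\<lambda>x. sin (kdot l x))"
| tp_add: "trigpoly f \<Longrightarrow> trigpoly g \<Longrightarrow> trigpoly (\<lambda>x. f x + g x)"
| tp_scale: "trigpoly f \<Longrightarrow> trigpoly (\<lambda>x. c * f x)"

lemma tp_const: "trigpoly (\<lambda>x. c)"
  using tp_scale[OF tp_cos[of 0], of c] by simp

text \<open>The product-to-sum formulas linearise the product with a generator; together with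
  \<open>tp_mult_sin\<close> this gives closure under products by induction on one factor.\<close>

lemma tp_mult_cos: "trigpoly f \<Longrightarrow> trigpoly (\<lambda>x. cos (kdot l x) * f x)"
proof (induction rule: trigpoly.induct)
  case (tp_cos k)
  have "(\<lambda>x. cos (kdot l x) * cos (kdot k x)) = (\<lambda>x. (1/2) * cos (kdot (l - k) x) + (1/2) * cos (kdot (l + k) x))"
    by (simp add: fun_eq_iff kdot_add kdot_diff cos_add cos_diff field_simps)
  then show ?case by (simp only:) (intro trigpoly.intros)
next
  case (tp_sin k)
  have "(\<lambda>x. cos (kdot l x) * sin (kdot k x)) = (\<lambda>x. (1/2) * sin (kdot (l + k) x) + (-1/2) * sin (kdot (l - k) x))"
    by (simp add: fun_eq_iff kdot_add kdot_diff sin_add sin_diff field_simps)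
  then show ?case by (simp only:) (intro trigpoly.intros)
next
  case (tp_add f g)
  then show ?case by (auto simp: algebra_simps intro: trigpoly.intros)
next
  case (tp_scale f c)
  then show ?case using trigpoly.tp_scale[of "\<lambda>x. cos (kdot l x) * f x" c] by (simp add: mult.left_commute)
qed

lemma tp_mult_sin: "trigpoly f \<Longrightarrow> trigpoly (\<lambda>x. sin (kdot l x) * f x)"
proof (induction rule: trigpoly.induct)
  case (tp_cos k)
  have "(\<lambda>x. sin (kdot l x) * cos (kdot k x)) = (\<lambda>x. (1/2) * sin (kdot (l + k) x) + (1/2) * sin (kdot (l - k) x))"
    by (simp add: fun_eq_iff kdot_add kdot_diff sin_add sin_diff field_simps)
  then show ?case by (simp only:) (intro trigpoly.intros)
next
  case (tp_sin k)
  have "(\<lambda>x. sin (kdot l x) * sin (kdot k x)) = (\<lambda>x. (1/2) * cos (kdot (l - k) x) + (-1/2) * cos (kdot (l + k) x))"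
    by (simp add: fun_eq_iff kdot_add kdot_diff cos_add cos_diff field_simps)
  then show ?case by (simp only:) (intro trigpoly.intros)
next
  case (tp_add f g)
  then show ?case by (auto simp: algebra_simps intro: trigpoly.intros)
next
  case (tp_scale f c)
  then show ?case using trigpoly.tp_scale[of "\<lambda>x. sin (kdot l x) * f x" c] by (simp add: mult.left_commute)
qed

lemma tp_mult: "trigpoly f \<Longrightarrow> trigpoly g \<Longrightarrow> trigpoly (\<lambda>x. f x * g x)"
proof (induction rule: trigpoly.induct)
  case (tp_add f h)
  then show ?case by (auto simp: algebra_simps intro: trigpoly.intros)
next
  case (tp_scale f c)
  then show ?case using trigpoly.tp_scale[of "\<lambda>x. f x * g x" c] by (simp add: mult.assoc)
qed (auto intro: tp_mult_cos tp_mult_sin)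

lemma tp_continuous: "trigpoly f \<Longrightarrow> continuous_on UNIV f"
  by (induction rule: trigpoly.induct) (auto intro!: continuous_intros continuous_kdot)

lemma tp_bounded: "trigpoly f \<Longrightarrow> \<exists>B. \<forall>x. \<bar>f x\<bar> \<le> B"
proof (induction rule: trigpoly.induct)
  case (tp_add f g)
  then obtain B C where "\<forall>x. \<bar>f x\<bar> \<le> B" "\<forall>x. \<bar>g x\<bar> \<le> C" by blast
  then have "\<forall>x. \<bar>f x + g x\<bar> \<le> B + C" by (meson abs_triangle_ineq add_mono order_trans)
  then show ?case by blast
next
  case (tp_scale f c)
  then obtain B where "\<forall>x. \<bar>f x\<bar> \<le> B" by blast
  then have "\<forall>x. \<bar>c * f x\<bar> \<le> \<bar>c\<bar> * B" by (simp add: abs_mult mult_left_mono)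
  then show ?case by blast
qed (use abs_cos_le_one abs_sin_le_one in blast)+

lemma tp_tm [measurable]: "trigpoly f \<Longrightarrow> f \<in> borel_measurable tm"
  by (intro measurable_tmI borel_measurable_continuous_onI tp_continuous)

section \<open>Closure properties of square-integrable functions\<close>

lemma L2_meas: "L2 f \<Longrightarrow> f \<in> borel_measurable tm"
  by (simp add: L2_def)

lemma L2_sq_integrable: "L2 f \<Longrightarrow> integrable tm (\<lambda>x. (f x)\<^sup>2)"
  by (simp add: L2_def)

lemma integrable_mult_of_squares:
  fixes f g :: "'a \<Rightarrow> real"
  assumes [measurable]: "f \<in> borel_measurable M" "g \<in> borel_measurable M"
    and "integrable M (\<lambda>x. (f x)\<^sup>2)" "integrable M (\<lambda>x. (g x)\<^sup>2)"
  shows "integrable M (\<lambda>x. f x * g x)"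
proof (rule Bochner_Integration.integrable_bound)
  show "integrable M (\<lambda>x. (f x)\<^sup>2 + (g x)\<^sup>2)" using assms by simp
  have "\<bar>a * b\<bar> \<le> a\<^sup>2 + b\<^sup>2" for a b :: real
  proof -
    have "2 * (\<bar>a\<bar> * \<bar>b\<bar>) \<le> \<bar>a\<bar>\<^sup>2 + \<bar>b\<bar>\<^sup>2" using sum_squares_bound[of "\<bar>a\<bar>" "\<bar>b\<bar>"] by simp
    moreover have "0 \<le> \<bar>a\<bar> * \<bar>b\<bar>" by simp
    ultimately show ?thesis unfolding abs_mult power2_abs by linarith
  qed
  then show "AE x in M. norm (f x * g x) \<le> norm ((f x)\<^sup>2 + (g x)\<^sup>2)" by simp
qed simp

lemma integrable_sq_add:
  fixes f g :: "'a \<Rightarrow> real"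
  assumes "f \<in> borel_measurable M" "g \<in> borel_measurable M"
    and "integrable M (\<lambda>x. (f x)\<^sup>2)" "integrable M (\<lambda>x. (g x)\<^sup>2)"
  shows "integrable M (\<lambda>x. (f x + g x)\<^sup>2)"
  using assms integrable_mult_of_squares[OF assms] by (simp add: power2_sum mult.assoc)

lemma L2_mult: "L2 f \<Longrightarrow> L2 g \<Longrightarrow> integrable tm (\<lambda>x. f x * g x)"
  by (auto simp: L2_def intro: integrable_mult_of_squares)

lemma L2_add: "L2 f \<Longrightarrow> L2 g \<Longrightarrow> L2 (\<lambda>x. f x + g x)"
  by (auto simp: L2_def intro: integrable_sq_add)

lemma L2_scale: "L2 f \<Longrightarrow> L2 (\<lambda>x. c * f x)"
  by (auto simp: L2_def power_mult_distrib)

lemma L2_diff: "L2 f \<Longrightarrow> L2 g \<Longrightarrow> L2 (\<lambda>x. f x - g x)"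
  using L2_add[OF _ L2_scale, of f g "-1"] by simp

lemma L2_const: "L2 (\<lambda>x. c)"
  using finite_measure.integrable_const[OF finite_measure_tm] by (auto simp: L2_def)

lemma L2_integrable: "L2 f \<Longrightarrow> integrable tm f"
  using L2_mult[OF _ L2_const[of 1]] by simp

lemma L2_dominated:
  assumes "L2 f" "g \<in> borel_measurable tm" "\<And>x. \<bar>g x\<bar> \<le> B * \<bar>f x\<bar>"
  shows "L2 g"
proof -
  have "(g x)\<^sup>2 \<le> B\<^sup>2 * (f x)\<^sup>2" for x
    using assms(3)[of x] power_mono[of "\<bar>g x\<bar>" "B * \<bar>f x\<bar>" 2] by (simp add: power_mult_distrib)
  then have le: "AE x in tm. norm ((g x)\<^sup>2) \<le> norm (B\<^sup>2 * (f x)\<^sup>2)" by simp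
  have int: "integrable tm (\<lambda>x. B\<^sup>2 * (f x)\<^sup>2)" using assms(1) by (simp add: L2_def)
  have "integrable tm (\<lambda>x. (g x)\<^sup>2)"
    by (rule Bochner_Integration.integrable_bound[OF int _ le]) (rule borel_measurable_power[OF assms(2)])
  then show ?thesis using assms by (simp add: L2_def)
qed

lemma L2_mult_bounded:
  assumes "L2 f" "\<phi> \<in> borel_measurable tm" "\<And>x. \<bar>\<phi> x\<bar> \<le> B"
  shows "L2 (\<lambda>x. \<phi> x * f x)"
  by (rule L2_dominated[OF assms(1), of _ B])
     (use assms L2_meas[OF assms(1)] in \<open>auto simp: abs_mult intro: mult_right_mono\<close>)

lemma L2_AE_cong:
  assumes "L2 f" "g \<in> borel_measurable tm" "AE x in tm. f x = g x"
  shows "L2 g"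
proof -
  have "integrable tm (\<lambda>x. (g x)\<^sup>2) = integrable tm (\<lambda>x. (f x)\<^sup>2)"
    by (rule integrable_cong_AE) (use assms L2_meas[OF assms(1)] in auto)
  then show ?thesis using assms by (simp add: L2_def)
qed

section \<open>Density of trigonometric polynomials in weighted \<open>L\<^sup>2\<close> spaces\<close>

text \<open>Stone-Weierstrass needs a compact space whose points are separated by trigonometric
  polynomials. The cube fails, since opposite faces are identified; its image under
  \<open>torus_map\<close> does not.\<close>

definition torus :: "(complex^'d::finite) set" where
  "torus = {z. \<forall>i. cmod (z $ i) = 1}"

definition torus_map :: "real^'d::finite \<Rightarrow> complex^'d" where
  "torus_map x = (\<chi> i. cis (x $ i))"

lemma torus_map_in: "torus_map x \<in> torus"
  by (simp add: torus_def torus_map_def)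

lemma compact_torus: "compact (torus :: (complex^'d::finite) set)"
proof -
  have eq: "torus = (\<Inter>i. {z::complex^'d. cmod (z $ i) = 1})" by (auto simp: torus_def)
  have "closed (torus :: (complex^'d) set)"
    unfolding eq by (intro closed_INT ballI closed_Collect_eq continuous_intros)
  moreover have "norm z \<le> real CARD('d)" if "z \<in> torus" for z :: "complex^'d"
    using that L2_set_le_sum[of UNIV "\<lambda>i. norm (z $ i)"]
    by (simp add: torus_def norm_vec_def)
  ultimately show ?thesis by (auto simp: compact_eq_bounded_closed bounded_iff)
qed


text \<open>Stone-Weierstrass for the ring of continuous functions whose pullback under
  \<open>torus_map\<close> is a trigonometric polynomial. Real and imaginary parts of the
  coordinates pull back to cosines and sines and separate points.\<close>

lemma torus_approx:
  fixes h :: "complex^'d::finite \<Rightarrow> real"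
  assumes "continuous_on torus h" "\<epsilon> > 0"
  shows "\<exists>\<phi>. trigpoly \<phi> \<and> (\<forall>x. \<bar>h (torus_map x) - \<phi> x\<bar> < \<epsilon>)"
proof -
  let ?R = "{f::complex^'d \<Rightarrow> real. continuous_on torus f \<and> trigpoly (\<lambda>x. f (torus_map x))}"
  interpret function_ring_on ?R torus
  proof
    fix z w :: "complex^'d"
    assume "z \<in> torus" "w \<in> torus" "z \<noteq> w"
    then obtain i where "z $ i \<noteq> w $ i" by (auto simp: vec_eq_iff)
    then consider "Re (z $ i) \<noteq> Re (w $ i)" | "Im (z $ i) \<noteq> Im (w $ i)"
      using complex_eq_iff by blast
    then show "\<exists>f\<in>?R. f z \<noteq> f w"
    proof cases
      case 1
      have "trigpoly (\<lambda>x. Re (torus_map x $ i))"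
        using tp_cos[of "axis i 1"] unfolding kdot_axis by (simp add: torus_map_def)
      moreover have "continuous_on torus (\<lambda>z. Re (z $ i))" by (intro continuous_intros)
      ultimately show ?thesis using 1 by (intro bexI[of _ "\<lambda>z. Re (z $ i)"] CollectI conjI)
    next
      case 2
      have "trigpoly (\<lambda>x. Im (torus_map x $ i))"
        using tp_sin[of "axis i 1"] unfolding kdot_axis by (simp add: torus_map_def)
      moreover have "continuous_on torus (\<lambda>z. Im (z $ i))" by (intro continuous_intros)
      ultimately show ?thesis using 2 by (intro bexI[of _ "\<lambda>z. Im (z $ i)"] CollectI conjI)
    qed
  qed (auto intro: compact_torus continuous_intros tp_add tp_mult tp_const)
  obtain g where "g \<in> ?R" "\<forall>x\<in>torus. \<bar>h x - g x\<bar> < \<epsilon>"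
    using Stone_Weierstrass_basic[OF assms] by (elim bexE)
  then show ?thesis using torus_map_in by (intro exI[of _ "\<lambda>x. g (torus_map x)"]) blast
qed

text \<open>A cutoff that vanishes on the image of the faces of the cube and tends to 1 elsewhere as
  m grows. It repairs functions on the cube whose values do not match across opposite faces.\<close>

definition bump :: "real \<Rightarrow> complex^'d::finite \<Rightarrow> real" where
  "bump m z = (\<Prod>i\<in>UNIV. min 1 (m * (1 - Re (z $ i))))"

lemma bump_range: "z \<in> torus \<Longrightarrow> m \<ge> 0 \<Longrightarrow> 0 \<le> bump m z \<and> bump m z \<le> 1"
proof -
  assume z: "z \<in> torus" and m: "m \<ge> 0"
  have "Re (z $ i) \<le> 1" for i
    using z complex_Re_le_cmod[of "z $ i"] by (simp add: torus_def)
  then show ?thesis using m unfolding bump_def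
    by (auto intro!: prod_nonneg prod_le_1)
qed

lemma Re_eq_1_torus: "cmod z = 1 \<Longrightarrow> z \<in> \<real>\<^sub>\<ge>\<^sub>0 \<Longrightarrow> z = 1"
  by (metis cmod_eq_Re complex_eq_iff complex_nonneg_Reals_iff abs_of_nonneg one_complex.simps)

lemma bump_continuous: "continuous_on S (bump m)"
  unfolding bump_def by (intro continuous_intros)

text \<open>Away from the cut of \<open>Arg2pi\<close> all ingredients are continuous; on the cut
  the bump tends to 0 while g stays bounded.\<close>

lemma continuous_on_torus_bump:
  fixes g :: "real^'d::finite \<Rightarrow> real"
  assumes g: "continuous_on UNIV g" and gB: "\<And>x. \<bar>g x\<bar> \<le> B" and m: "m \<ge> 0"
  shows "continuous_on torus (\<lambda>z. g (\<chi> i. Arg2pi (z $ i)) * bump m z)"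
  unfolding continuous_on_def
proof
  fix z :: "complex^'d" assume z: "z \<in> torus"
  let ?h = "\<lambda>z. g (\<chi> i. Arg2pi (z $ i)) * bump m z"
  show "(?h \<longlongrightarrow> ?h z) (at z within torus)"
  proof (cases "\<exists>i. z $ i = 1")
    case True
    then obtain i where "z $ i = 1" by blast
    then have b0: "bump m z = 0" unfolding bump_def by (intro prod_zero bexI[of _ i]) auto
    have "(bump m \<longlongrightarrow> 0) (at z within torus)"
      using bump_continuous[of torus m] z b0 unfolding continuous_on_def by metis
    then have "((\<lambda>w. B * bump m w) \<longlongrightarrow> 0) (at z within torus)"
      by (auto intro: tendsto_eq_intros)
    moreover have "\<forall>\<^sub>F w in at z within torus. norm (?h w) \<le> B * bump m w"
      unfolding eventually_at_topological
      by (rule exI[of _ UNIV]) (use bump_range m gB in \<open>auto simp: abs_mult intro!: mult_mono intro: order_trans[OF abs_ge_zero]\<close>)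
    ultimately show ?thesis using b0 by (auto intro: Lim_null_comparison)
  next
    case False
    have "((\<lambda>w. \<chi> i. Arg2pi (w $ i)) \<longlongrightarrow> (\<chi> i. Arg2pi (z $ i))) (at z within torus)"
    proof (intro tendsto_vec_lambda)
      fix i
      have "z $ i \<notin> \<real>\<^sub>\<ge>\<^sub>0" using False Re_eq_1_torus z by (auto simp: torus_def)
      then have "isCont Arg2pi (z $ i)" by (rule continuous_at_Arg2pi)
      then show "((\<lambda>w. Arg2pi (w $ i)) \<longlongrightarrow> Arg2pi (z $ i)) (at z within torus)"
        by (rule isCont_tendsto_compose) (intro tendsto_intros)
    qed
    moreover have "isCont g (\<chi> i. Arg2pi (z $ i))"
      using g by (simp add: continuous_on_eq_continuous_at)
    ultimately have "((\<lambda>w. g (\<chi> i. Arg2pi (w $ i))) \<longlongrightarrow> g (\<chi> i. Arg2pi (z $ i))) (at z within torus)"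
      by (rule isCont_tendsto_compose[rotated])
    moreover have "(bump m \<longlongrightarrow> bump m z) (at z within torus)"
      using bump_continuous[of torus m] z unfolding continuous_on_def by metis
    ultimately show ?thesis by (rule tendsto_mult)
  qed
qed

text \<open>On the cube \<open>Arg2pi\<close> undoes \<open>torus_map\<close> except where a
  coordinate equals 2 pi, and there both sides vanish with the bump.\<close>

lemma bump_cube:
  assumes x: "x \<in> cube"
  shows "g (\<chi> i. Arg2pi (torus_map x $ i)) * bump m (torus_map x) = g x * bump m (torus_map x)"
proof (cases "\<exists>i. cos (x $ i) = 1")
  case True
  then obtain i where "cos (x $ i) = 1" by blast
  then have "bump m (torus_map x) = 0"
    unfolding bump_def by (intro prod_zero bexI[of _ i]) (auto simp: torus_map_def)
  then show ?thesis by simp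
next
  case False
  have "Arg2pi (cis (x $ i)) = x $ i" for i
  proof -
    have "x $ i \<noteq> 2*pi" using False cos_two_pi by metis
    moreover have "0 \<le> x $ i" "x $ i \<le> 2*pi"
      using x by (auto simp: cube_def mem_box_cart)
    ultimately have "0 \<le> x $ i" "x $ i \<le> 2*pi" "x $ i \<noteq> 2*pi" by auto
    then show ?thesis
      using Arg2pi_unique[of 1 "x $ i" "cis (x $ i)"] by (simp add: cis_conv_exp)
  qed
  then show ?thesis by (simp add: torus_map_def)
qed

lemma bump_tendsto:
  assumes "\<forall>i. cos (x $ i) \<noteq> 1"
  shows "(\<lambda>n. bump (real n) (torus_map x)) \<longlonglongrightarrow> 1"
proof -
  have "\<forall>\<^sub>F n in sequentially. \<forall>i. 1 \<le> real n * (1 - cos (x $ i))"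
  proof (intro eventually_all_finite)
    fix i
    have p: "1 - cos (x $ i) > 0" using assms cos_le_one[of "x $ i"] by (smt (verit))
    have "\<forall>\<^sub>F n in sequentially. 1 / (1 - cos (x $ i)) \<le> real n"
      using filterlim_real_sequentially unfolding filterlim_at_top by blast
    then show "\<forall>\<^sub>F n in sequentially. 1 \<le> real n * (1 - cos (x $ i))"
      by eventually_elim (use p in \<open>simp add: field_simps\<close>)
  qed
  then have "\<forall>\<^sub>F n in sequentially. bump (real n) (torus_map x) = 1"
    by eventually_elim (auto simp: bump_def torus_map_def min_def intro!: prod.neutral)
  then show ?thesis by (rule tendsto_eventually)
qed

lemma AE_cube_interior: "AE x in (tm :: (real^'d::finite) measure). \<forall>i. cos (x $ i) \<noteq> 1"
proof -
  have null: "box 0 (\<chi> i. 2*pi) \<in> sets lebesgue" "negligible (cube - box 0 (\<chi> i. 2*pi) :: (real^'d) set)"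
    unfolding cube_def using negligible_frontier_interval[of "0::real^'d" "\<chi> i. 2*pi"] by auto
  have "AE x in lebesgue. x \<notin> (cube - box 0 (\<chi> i. 2*pi) :: (real^'d) set)"
    using null(2) by (intro AE_not_in) (simp add: negligible_iff_null_sets)
  then have "AE x in lebesgue. x \<in> cube \<longrightarrow> (\<forall>i. cos ((x::real^'d) $ i) \<noteq> 1)"
  proof eventually_elim
    case (elim x)
    show ?case
    proof (intro impI allI)
      fix i assume "x \<in> cube"
      then have "0 < x $ i" "x $ i < 2*pi" using elim by (auto simp: mem_box_cart)
      moreover have "0 < sin (x $ i / 2)" using calculation by (intro sin_gt_zero) auto
      moreover have "cos (x $ i) = 1 - 2 * (sin (x $ i / 2))\<^sup>2"
        using cos_double_sin[of "x $ i / 2"] by simp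
      ultimately show "cos (x $ i) \<noteq> 1" by auto
    qed
  qed
  then show ?thesis by (subst AE_restrict_space_iff) auto
qed

text \<open>Closure under limits is what makes this predicate usable: it passes from continuous
  functions to bounded measurable and then to all functions in the weighted space.\<close>

definition wapprox :: "(real^'d::finite \<Rightarrow> real) \<Rightarrow> (real^'d \<Rightarrow> real) \<Rightarrow> bool" where
  "wapprox q g \<longleftrightarrow> g \<in> borel_measurable tm \<and> integrable tm (\<lambda>x. (g x)\<^sup>2 * q x)
     \<and> (\<forall>\<epsilon>>0. \<exists>\<phi>. trigpoly \<phi> \<and> (LINT x|tm. (g x - \<phi> x)\<^sup>2 * q x) < \<epsilon>)"

lemma wsq_integrable_diff:
  fixes q :: "real^'d::finite \<Rightarrow> real"
  assumes [measurable]: "f \<in> borel_measurable tm" "g \<in> borel_measurable tm" "q \<in> borel_measurable tm"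
    and q: "\<And>x. q x \<ge> 0"
    and "integrable tm (\<lambda>x. (f x)\<^sup>2 * q x)" "integrable tm (\<lambda>x. (g x)\<^sup>2 * q x)"
  shows "integrable tm (\<lambda>x. (f x - g x)\<^sup>2 * q x)"
proof (rule Bochner_Integration.integrable_bound)
  show "integrable tm (\<lambda>x. 2 * ((f x)\<^sup>2 * q x) + 2 * ((g x)\<^sup>2 * q x))" using assms by simp
  have *: "(a - b)\<^sup>2 \<le> 2 * a\<^sup>2 + 2 * b\<^sup>2" for a b :: real
    using zero_le_power2[of "a + b"] by (simp add: power2_sum power2_diff)
  have "(f x - g x)\<^sup>2 * q x \<le> 2 * ((f x)\<^sup>2 * q x) + 2 * ((g x)\<^sup>2 * q x)" for x
    using mult_right_mono[OF * q] by (simp add: algebra_simps)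
  then show "AE x in tm. norm ((f x - g x)\<^sup>2 * q x) \<le> norm (2 * ((f x)\<^sup>2 * q x) + 2 * ((g x)\<^sup>2 * q x))"
    using q by (intro AE_I2) (simp add: abs_of_nonneg)
qed simp

lemma wsq_integrable_bounded:
  fixes q :: "real^'d::finite \<Rightarrow> real"
  assumes [measurable]: "f \<in> borel_measurable tm" and fB: "\<And>x. \<bar>f x\<bar> \<le> B"
    and q: "\<And>x. q x \<ge> 0" "integrable tm q"
  shows "integrable tm (\<lambda>x. (f x)\<^sup>2 * q x)"
proof (rule Bochner_Integration.integrable_bound)
  show "integrable tm (\<lambda>x. B\<^sup>2 * q x)" using q by simp
  have [measurable]: "q \<in> borel_measurable tm" using q by auto
  show "(\<lambda>x. (f x)\<^sup>2 * q x) \<in> borel_measurable tm" by simp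
  have "(f x)\<^sup>2 \<le> B\<^sup>2" for x using power_mono[OF fB[of x] abs_ge_zero, of 2] by simp
  then show "AE x in tm. norm ((f x)\<^sup>2 * q x) \<le> norm (B\<^sup>2 * q x)"
    using q by (intro AE_I2) (simp add: abs_mult mult_right_mono)
qed

text \<open>Dominated convergence in the weighted space brings some \<open>g n\<close> close to f,
  and that \<open>g n\<close> is then replaced by a trigonometric polynomial. The two errors
  \<epsilon>/4 pay for the factor 2 in the quadratic triangle inequality.\<close>

lemma wapprox_limit:
  fixes q :: "real^'d::finite \<Rightarrow> real"
  assumes q: "\<And>x. q x \<ge> 0" "integrable tm q"
    and g: "\<And>n::nat. wapprox q (g n)"
    and f: "f \<in> borel_measurable tm" "integrable tm (\<lambda>x. (f x)\<^sup>2 * q x)"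
    and lim: "AE x in tm. (\<lambda>n. g n x) \<longlonglongrightarrow> f x"
    and dom: "integrable tm (\<lambda>x. (w x)\<^sup>2 * q x)" "\<And>n. AE x in tm. \<bar>f x - g n x\<bar> \<le> \<bar>w x\<bar>"
  shows "wapprox q f"
  unfolding wapprox_def
proof (intro conjI allI impI f)
  fix \<epsilon> :: real assume \<epsilon>: "\<epsilon> > 0"
  have [measurable]: "f \<in> borel_measurable tm" "q \<in> borel_measurable tm" "g n \<in> borel_measurable tm" for n
    using f q g by (auto simp: wapprox_def)
  have "(\<lambda>n. LINT x|tm. (f x - g n x)\<^sup>2 * q x) \<longlonglongrightarrow> integral\<^sup>L (tm :: (real^'d) measure) (\<lambda>x. 0::real)"
  proof (rule integral_dominated_convergence)
    show "integrable tm (\<lambda>x. (w x)\<^sup>2 * q x)" by fact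
    show "AE x in tm. (\<lambda>n. (f x - g n x)\<^sup>2 * q x) \<longlonglongrightarrow> 0"
      using lim
    proof eventually_elim
      case (elim x)
      have "(\<lambda>n. (f x - g n x)\<^sup>2 * q x) \<longlonglongrightarrow> (f x - f x)\<^sup>2 * q x"
        by (intro tendsto_intros elim)
      then show ?case by simp
    qed
    show "AE x in tm. norm ((f x - g n x)\<^sup>2 * q x) \<le> (w x)\<^sup>2 * q x" for n
      using dom(2)[of n]
    proof eventually_elim
      case (elim x)
      then have "(f x - g n x)\<^sup>2 \<le> (w x)\<^sup>2" by (simp add: abs_le_square_iff)
      then show ?case using q by (simp add: abs_of_nonneg mult_right_mono)
    qed
  qed simp_all
  then have "\<forall>\<^sub>F n in sequentially. (LINT x|tm. (f x - g n x)\<^sup>2 * q x) < \<epsilon> / 4"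
    by (rule order_tendstoD) (use \<epsilon> in simp)
  then obtain n where n: "(LINT x|tm. (f x - g n x)\<^sup>2 * q x) < \<epsilon> / 4"
    by (meson eventually_sequentially order_refl)
  obtain \<phi> where \<phi>: "trigpoly \<phi>" "(LINT x|tm. (g n x - \<phi> x)\<^sup>2 * q x) < \<epsilon> / 4"
    using g[of n] \<epsilon> unfolding wapprox_def by (meson zero_less_divide_iff zero_less_numeral)
  obtain B where B: "\<And>x. \<bar>\<phi> x\<bar> \<le> B" using tp_bounded[OF \<phi>(1)] by blast
  have [measurable]: "\<phi> \<in> borel_measurable tm" by (rule tp_tm) fact
  have ig: "integrable tm (\<lambda>x. (g n x)\<^sup>2 * q x)" using g[of n] by (simp add: wapprox_def)
  have i\<phi>: "integrable tm (\<lambda>x. (\<phi> x)\<^sup>2 * q x)"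
    by (rule wsq_integrable_bounded[OF _ B q]) simp
  have i1: "integrable tm (\<lambda>x. (f x - g n x)\<^sup>2 * q x)"
    and i2: "integrable tm (\<lambda>x. (g n x - \<phi> x)\<^sup>2 * q x)"
    and i3: "integrable tm (\<lambda>x. (f x - \<phi> x)\<^sup>2 * q x)"
    by (rule wsq_integrable_diff; (use q f ig i\<phi> in simp))+
  have *: "(a - c)\<^sup>2 \<le> 2 * (a - b)\<^sup>2 + 2 * (b - c)\<^sup>2" for a b c :: real
    using zero_le_power2[of "(a - b) - (b - c)"] by (simp add: power2_eq_square algebra_simps)
  have "(LINT x|tm. (f x - \<phi> x)\<^sup>2 * q x)
      \<le> (LINT x|tm. 2 * ((f x - g n x)\<^sup>2 * q x) + 2 * ((g n x - \<phi> x)\<^sup>2 * q x))"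
  proof (rule integral_mono[OF i3])
    show "integrable tm (\<lambda>x. 2 * ((f x - g n x)\<^sup>2 * q x) + 2 * ((g n x - \<phi> x)\<^sup>2 * q x))"
      using i1 i2 by simp
    show "(f x - \<phi> x)\<^sup>2 * q x \<le> 2 * ((f x - g n x)\<^sup>2 * q x) + 2 * ((g n x - \<phi> x)\<^sup>2 * q x)" for x
      using mult_right_mono[OF *[of "f x" "\<phi> x" "g n x"] q(1)[of x]] by (simp add: algebra_simps)
  qed
  also have "\<dots> = 2 * (LINT x|tm. (f x - g n x)\<^sup>2 * q x) + 2 * (LINT x|tm. (g n x - \<phi> x)\<^sup>2 * q x)"
    using i1 i2 by simp
  also have "\<dots> < \<epsilon>" using n \<phi> by simp
  finally show "\<exists>\<phi>. trigpoly \<phi> \<and> (LINT x|tm. (f x - \<phi> x)\<^sup>2 * q x) < \<epsilon>" using \<phi>(1) by blast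
qed

text \<open>Since g may be discontinuous on the torus, it is first multiplied by a bump. The product
  factors through the torus and is approximated uniformly; the bumps tend to 1 almost everywhere on
  the cube.\<close>

lemma wapprox_continuous_bounded:
  fixes g q :: "real^'d::finite \<Rightarrow> real"
  assumes q: "\<And>x. q x \<ge> 0" "integrable tm q"
    and g: "continuous_on UNIV g" and gB: "\<And>x. \<bar>g x\<bar> \<le> B"
  shows "wapprox q g"
proof -
  have [measurable]: "g \<in> borel_measurable tm" "q \<in> borel_measurable tm"
    using q g by (auto intro!: measurable_tmI borel_measurable_continuous_onI)
  have B0: "B \<ge> 0" using gB[of 0] by linarith
  have cb: "continuous_on UNIV (\<lambda>x::real^'d. bump m (torus_map x))" for m
    unfolding bump_def torus_map_def by (simp) (intro continuous_intros)
  have bb: "0 \<le> bump (real n) (torus_map x) \<and> bump (real n) (torus_map x) \<le> 1" for n and x :: "real^'d"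
    by (intro bump_range torus_map_in) simp
  have "wapprox q (\<lambda>x. g x * bump (real n) (torus_map x))" for n
    unfolding wapprox_def
  proof (intro conjI allI impI)
    show m[measurable]: "(\<lambda>x. g x * bump (real n) (torus_map x)) \<in> borel_measurable tm"
      by (intro measurable_tmI borel_measurable_continuous_onI continuous_on_mult g cb)
    have le: "\<bar>g x * bump (real n) (torus_map x)\<bar> \<le> B" for x
      using mult_mono[OF gB[of x], of "bump (real n) (torus_map x)" 1] bb B0 by (simp add: abs_mult)
    show "integrable tm (\<lambda>x. (g x * bump (real n) (torus_map x))\<^sup>2 * q x)"
      by (rule wsq_integrable_bounded[OF _ le q]) simp
    fix \<epsilon> :: real assume \<epsilon>: "\<epsilon> > 0"
    define I where "I = (LINT x|tm. q x)"
    have I: "I \<ge> 0" unfolding I_def using q by simp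
    \<comment> \<open>A uniform error \<delta> costs \<open>\<delta>\<^sup>2 * I\<close> in the
      weighted norm; adding 1 keeps the quotient meaningful for a weight of mass 0.\<close>
    define \<delta> where "\<delta> = sqrt (\<epsilon> / (I + 1))"
    have \<delta>: "\<delta> > 0" "\<delta>\<^sup>2 * I < \<epsilon>" unfolding \<delta>_def using \<epsilon> I by (auto simp: field_simps)
    obtain \<phi> where \<phi>: "trigpoly \<phi>"
        "\<And>x. \<bar>g (\<chi> i. Arg2pi (torus_map x $ i)) * bump (real n) (torus_map x) - \<phi> x\<bar> < \<delta>"
      using torus_approx[OF continuous_on_torus_bump[OF g gB, of "real n"] \<delta>(1)] by auto
    have [measurable]: "\<phi> \<in> borel_measurable tm" by (rule tp_tm) fact
    have d: "\<bar>g x * bump (real n) (torus_map x) - \<phi> x\<bar> < \<delta>" if "x \<in> cube" for x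
      using \<phi>(2)[of x] bump_cube[OF that, of g "real n"] by simp
    have "(LINT x|tm. (g x * bump (real n) (torus_map x) - \<phi> x)\<^sup>2 * q x) \<le> (LINT x|tm. \<delta>\<^sup>2 * q x)"
    proof (rule integral_mono)
      obtain C where C: "\<And>x. \<bar>\<phi> x\<bar> \<le> C" using tp_bounded[OF \<phi>(1)] by blast
      show "integrable tm (\<lambda>x. (g x * bump (real n) (torus_map x) - \<phi> x)\<^sup>2 * q x)"
        by (rule wsq_integrable_bounded[OF _ order_trans[OF abs_triangle_ineq4 add_mono[OF le C]] q]) simp
      show "integrable tm (\<lambda>x. \<delta>\<^sup>2 * q x)" using q by simp
      fix x :: "real^'d" assume "x \<in> space tm"
      then have "x \<in> cube" by simp
      then have "(g x * bump (real n) (torus_map x) - \<phi> x)\<^sup>2 \<le> \<delta>\<^sup>2"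
        using d[of x] \<delta> by (simp add: abs_le_square_iff[symmetric])
      then show "(g x * bump (real n) (torus_map x) - \<phi> x)\<^sup>2 * q x \<le> \<delta>\<^sup>2 * q x"
        using q by (simp add: mult_right_mono)
    qed
    also have "\<dots> < \<epsilon>" using \<delta> by (simp add: I_def)
    finally show "\<exists>\<phi>. trigpoly \<phi> \<and> (LINT x|tm. (g x * bump (real n) (torus_map x) - \<phi> x)\<^sup>2 * q x) < \<epsilon>"
      using \<phi>(1) by blast
  qed
  moreover have "AE x in tm. (\<lambda>n. g x * bump (real n) (torus_map x)) \<longlonglongrightarrow> g x"
    using AE_cube_interior
  proof eventually_elim
    case (elim x)
    show ?case using tendsto_mult[OF tendsto_const bump_tendsto[OF elim], of "g x"] by simp
  qed
  moreover have "\<bar>g x - g x * bump (real n) (torus_map x)\<bar> \<le> \<bar>B\<bar>" for n x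
  proof -
    have "\<bar>g x - g x * bump (real n) (torus_map x)\<bar> = \<bar>g x\<bar> * (1 - bump (real n) (torus_map x))"
      using bb[of n x] by (simp add: abs_mult[symmetric] abs_of_nonneg right_diff_distrib flip: abs_mult_pos)
         (metis abs_mult abs_of_nonneg diff_ge_0_iff_ge mult.right_neutral right_diff_distrib')
    also have "\<dots> \<le> B * 1" using gB[of x] bb[of n x] B0 by (intro mult_mono) auto
    finally show ?thesis by simp
  qed
  moreover have "integrable tm (\<lambda>x. (g x)\<^sup>2 * q x)" by (rule wsq_integrable_bounded[OF _ gB q]) simp
  moreover have "integrable tm (\<lambda>x. B\<^sup>2 * q x)" using q by simp
  ultimately show ?thesis
    by (intro wapprox_limit[OF q, of "\<lambda>n x. g x * bump (real n) (torus_map x)" g "\<lambda>x. B"]) auto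
qed

definition clamp_abs :: "real \<Rightarrow> real \<Rightarrow> real" where
  "clamp_abs B y = max (-B) (min B y)"

lemma clamp_abs_le: "B \<ge> 0 \<Longrightarrow> \<bar>clamp_abs B y\<bar> \<le> B" by (auto simp: clamp_abs_def)
lemma clamp_abs_id: "\<bar>y\<bar> \<le> B \<Longrightarrow> clamp_abs B y = y" by (auto simp: clamp_abs_def)
lemma clamp_abs_diff: "B \<ge> 0 \<Longrightarrow> \<bar>y - clamp_abs B y\<bar> \<le> \<bar>y\<bar>" by (auto simp: clamp_abs_def)
lemma clamp_abs_borel [measurable]: "clamp_abs B \<in> borel_measurable borel"
  unfolding clamp_abs_def by measurable
lemma clamp_abs_cont: "continuous_on S (clamp_abs B)"
  unfolding clamp_abs_def by (intro continuous_intros)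

text \<open>A measurable function is an almost everywhere limit of continuous ones. Clamping these
  to [-B, B] makes them bounded and leaves the limit unchanged.\<close>

lemma wapprox_bounded:
  fixes f q :: "real^'d::finite \<Rightarrow> real"
  assumes q: "\<And>x. q x \<ge> 0" "integrable tm q"
    and f[measurable]: "f \<in> borel_measurable tm" and fB: "\<And>x. \<bar>f x\<bar> \<le> B"
  shows "wapprox q f"
proof -
  have B0: "B \<ge> 0" using fB[of 0] by linarith
  have "f measurable_on cube" using f by (simp add: measurable_on_iff_borel_measurable)
  then obtain N g where N: "negligible N" and g: "\<And>n. continuous_on UNIV (g n)"
    and lim: "\<And>x. x \<notin> N \<Longrightarrow> (\<lambda>n. g n x) \<longlonglongrightarrow> (if x \<in> cube then f x else 0)"
    unfolding measurable_on_def by blast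
  define h where "h n x = clamp_abs B (g n x)" for n x
  have "wapprox q (h n)" for n
  proof (rule wapprox_continuous_bounded[OF q])
    show "continuous_on UNIV (h n)" unfolding h_def
      by (rule continuous_on_compose2[OF clamp_abs_cont g]) auto
    show "\<bar>h n x\<bar> \<le> B" for x unfolding h_def by (rule clamp_abs_le[OF B0])
  qed
  moreover have "AE x in tm. (\<lambda>n. h n x) \<longlonglongrightarrow> f x"
  proof -
    have "AE x in lebesgue. x \<notin> N" using N by (intro AE_not_in) (simp add: negligible_iff_null_sets)
    then have "AE x in lebesgue. x \<in> cube \<longrightarrow> (\<lambda>n. h n x) \<longlonglongrightarrow> f x"
    proof eventually_elim
      case (elim x)
      show ?case
      proof
        assume "x \<in> cube"
        then have "(\<lambda>n. g n x) \<longlonglongrightarrow> f x" using lim[OF elim] by simp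
        then have "(\<lambda>n. h n x) \<longlonglongrightarrow> clamp_abs B (f x)"
          unfolding h_def using clamp_abs_cont[of UNIV B]
          by (auto intro: isCont_tendsto_compose simp: continuous_on_eq_continuous_at)
        then show "(\<lambda>n. h n x) \<longlonglongrightarrow> f x" using fB by (simp add: clamp_abs_id)
      qed
    qed
    then show ?thesis by (subst AE_restrict_space_iff) auto
  qed
  moreover have "\<bar>f x - h n x\<bar> \<le> \<bar>2 * B\<bar>" for n x
    using fB[of x] clamp_abs_le[OF B0, of "g n x"] unfolding h_def by linarith
  moreover have "integrable tm (\<lambda>x. (f x)\<^sup>2 * q x)" by (rule wsq_integrable_bounded[OF _ fB q]) simp
  ultimately show ?thesis
    using q by (intro wapprox_limit[OF q, of h f "\<lambda>x. 2 * B"]) auto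
qed

text \<open>The function is truncated at height n; the truncation error is dominated by f itself,
  whose square is integrable against the weight.\<close>

theorem weighted_trig_density:
  fixes f q :: "real^'d::finite \<Rightarrow> real"
  assumes q: "\<And>x. q x \<ge> 0" "integrable tm q"
    and f: "f \<in> borel_measurable tm" "integrable tm (\<lambda>x. (f x)\<^sup>2 * q x)"
    and "\<epsilon> > 0"
  shows "\<exists>\<phi>. trigpoly \<phi> \<and> (LINT x|tm. (f x - \<phi> x)\<^sup>2 * q x) < \<epsilon>"
proof -
  note [measurable] = f(1)
  have "wapprox q f"
  proof (rule wapprox_limit[OF q _ f, of "\<lambda>n x. clamp_abs (real n) (f x)" f])
    show "wapprox q (\<lambda>x. clamp_abs (real n) (f x))" for n
      by (rule wapprox_bounded[OF q _ clamp_abs_le]) simp_all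
    have "(\<lambda>n. clamp_abs (real n) (f x)) \<longlonglongrightarrow> f x" for x
    proof (rule tendsto_eventually)
      have "\<forall>\<^sub>F n in sequentially. \<bar>f x\<bar> \<le> real n"
        using filterlim_real_sequentially unfolding filterlim_at_top by blast
      then show "\<forall>\<^sub>F n in sequentially. clamp_abs (real n) (f x) = f x"
        by eventually_elim (rule clamp_abs_id)
    qed
    then show "AE x in tm. (\<lambda>n. clamp_abs (real n) (f x)) \<longlonglongrightarrow> f x" by simp
    show "AE x in tm. \<bar>f x - clamp_abs (real n) (f x)\<bar> \<le> \<bar>f x\<bar>" for n
      by (simp add: clamp_abs_diff)
  qed (rule f)
  then show ?thesis using assms(5) by (simp add: wapprox_def)
qed

section \<open>Square-summable hermitian sequences\<close>

text \<open>Hermitian symmetry singles out the Fourier coefficients of real functions, so the type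
  is a model of real L2 (see \<open>riesz_fischer\<close>). As a type with a Banach space structure
  it carries vector-valued integrals and the contraction principle.\<close>

typedef (overloaded) ('d::finite) hs =
  "{c :: int^'d \<Rightarrow> complex. (\<forall>k. c (- k) = cnj (c k)) \<and> (\<lambda>k. (cmod (c k))\<^sup>2) summable_on UNIV}"
  morphisms hc Abs_hs
  by (rule exI[of _ "\<lambda>_. 0"]) simp

setup_lifting type_definition_hs

lemma hc_minus_index: "hc a (- k) = cnj (hc a k)"
  using hc[of a] by simp

lemma hc_summable: "(\<lambda>k. (cmod (hc a k))\<^sup>2) summable_on UNIV"
  using hc[of a] by simp

lemma hs_eqI: "(\<And>k. hc a k = hc b k) \<Longrightarrow> a = b"
  using hc_inject by blast

lemma summable_sq_add:
  fixes f g :: "'a \<Rightarrow> complex"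
  assumes "(\<lambda>k. (cmod (f k))\<^sup>2) summable_on A" "(\<lambda>k. (cmod (g k))\<^sup>2) summable_on A"
  shows "(\<lambda>k. (cmod (f k + g k))\<^sup>2) summable_on A"
proof (rule summable_on_comparison_test)
  show "(\<lambda>k. 2 * (cmod (f k))\<^sup>2 + 2 * (cmod (g k))\<^sup>2) summable_on A"
    using assms by (intro summable_on_add summable_on_cmult_right)
  fix k
  have "(cmod (f k + g k))\<^sup>2 \<le> (cmod (f k) + cmod (g k))\<^sup>2"
    by (intro power_mono norm_triangle_ineq) simp
  also have "\<dots> \<le> 2 * (cmod (f k))\<^sup>2 + 2 * (cmod (g k))\<^sup>2"
    using sum_squares_bound[of "cmod (f k)" "cmod (g k)"] by (simp add: power2_sum)
  finally show "(cmod (f k + g k))\<^sup>2 \<le> 2 * (cmod (f k))\<^sup>2 + 2 * (cmod (g k))\<^sup>2" .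
qed simp

lemma summable_sq_scale:
  fixes f :: "'a \<Rightarrow> complex"
  assumes "(\<lambda>k. (cmod (f k))\<^sup>2) summable_on A"
  shows "(\<lambda>k. (cmod (c *\<^sub>R f k))\<^sup>2) summable_on A"
  using summable_on_cmult_right[OF assms, of "c\<^sup>2"] by (simp add: power_mult_distrib)

lemma summable_re_mult:
  fixes f g :: "'a \<Rightarrow> complex"
  assumes "(\<lambda>k. (cmod (f k))\<^sup>2) summable_on A" "(\<lambda>k. (cmod (g k))\<^sup>2) summable_on A"
  shows "(\<lambda>k. Re (f k * cnj (g k))) summable_on A"
proof (rule abs_summable_summable, rule summable_on_comparison_test)
  show "(\<lambda>k. (cmod (f k))\<^sup>2 + (cmod (g k))\<^sup>2) summable_on A"
    using assms by (intro summable_on_add)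
  fix k
  have "norm (Re (f k * cnj (g k))) \<le> cmod (f k) * cmod (g k)"
    using abs_Re_le_cmod[of "f k * cnj (g k)"] by (simp add: norm_mult)
  also have "\<dots> \<le> (cmod (f k))\<^sup>2 + (cmod (g k))\<^sup>2"
    using sum_squares_bound[of "cmod (f k)" "cmod (g k)"]
      mult_nonneg_nonneg[OF norm_ge_zero norm_ge_zero, of "f k" "g k"] by linarith
  finally show "norm (Re (f k * cnj (g k))) \<le> (cmod (f k))\<^sup>2 + (cmod (g k))\<^sup>2" .
qed simp

instantiation hs :: (finite) real_vector
begin

lift_definition zero_hs :: "'a hs" is "\<lambda>_. 0" by simp
lift_definition plus_hs :: "'a hs \<Rightarrow> 'a hs \<Rightarrow> 'a hs" is "\<lambda>a b k. a k + b k"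
  by (auto intro: summable_sq_add)
lift_definition scaleR_hs :: "real \<Rightarrow> 'a hs \<Rightarrow> 'a hs" is "\<lambda>c a k. c *\<^sub>R a k"
  by (auto intro: summable_sq_scale simp del: norm_scaleR)
lift_definition uminus_hs :: "'a hs \<Rightarrow> 'a hs" is "\<lambda>a k. - a k"
  by auto
definition minus_hs :: "'a hs \<Rightarrow> 'a hs \<Rightarrow> 'a hs" where
  "minus_hs a b = a + (- b)"

instance
proof
  fix a b c :: "'a hs" and r s :: real
  show "a + b + c = a + (b + c)" by transfer (simp add: fun_eq_iff)
  show "a + b = b + a" by transfer (simp add: fun_eq_iff)
  show "0 + a = a" by transfer (simp add: fun_eq_iff)
  show "- a + a = 0" by transfer (simp add: fun_eq_iff)
  show "a - b = a + - b" by (rule minus_hs_def)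
  show "r *\<^sub>R (a + b) = r *\<^sub>R a + r *\<^sub>R b" by transfer (simp add: fun_eq_iff scaleR_add_right)
  show "(r + s) *\<^sub>R a = r *\<^sub>R a + s *\<^sub>R a" by transfer (simp add: fun_eq_iff scaleR_add_left)
  show "r *\<^sub>R s *\<^sub>R a = (r * s) *\<^sub>R a" by transfer (simp add: fun_eq_iff)
  show "1 *\<^sub>R a = a" by transfer (simp add: fun_eq_iff)
qed

end

instantiation hs :: (finite) real_inner
begin

definition inner_hs :: "'a hs \<Rightarrow> 'a hs \<Rightarrow> real" where
  "inner_hs a b = (\<Sum>\<^sub>\<infinity>k. Re (hc a k * cnj (hc b k)))"
definition norm_hs :: "'a hs \<Rightarrow> real" where
  "norm_hs a = sqrt (inner a a)"
definition sgn_hs :: "'a hs \<Rightarrow> 'a hs" where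
  "sgn_hs a = a /\<^sub>R norm a"
definition dist_hs :: "'a hs \<Rightarrow> 'a hs \<Rightarrow> real" where
  "dist_hs a b = norm (a - b)"
definition uniformity_hs :: "('a hs \<times> 'a hs) filter" where
  "uniformity_hs = (INF e\<in>{0 <..}. principal {(x, y). dist x y < e})"
definition open_hs :: "'a hs set \<Rightarrow> bool" where
  "open_hs U \<longleftrightarrow> (\<forall>x\<in>U. eventually (\<lambda>(x', y). x' = x \<longrightarrow> y \<in> U) uniformity)"

lemma inner_hs_summable: "(\<lambda>k. Re (hc a k * cnj (hc b k))) summable_on UNIV"
  by (intro summable_re_mult hc_summable)

instance
proof
  fix a b c :: "'a hs" and r s :: real
  show "dist a b = norm (a - b)" by (rule dist_hs_def)
  show "sgn a = a /\<^sub>R norm a" by (rule sgn_hs_def)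
  show "uniformity = (INF e\<in>{0 <..}. principal {(x, y::'a hs). dist x y < e})" by (rule uniformity_hs_def)
  show "open U \<longleftrightarrow> (\<forall>x\<in>U. eventually (\<lambda>(x', y). x' = x \<longrightarrow> y \<in> U) uniformity)" for U :: "'a hs set"
    by (rule open_hs_def)
  show "inner a b = inner b a" unfolding inner_hs_def by (simp add: mult.commute)
  have "inner (a + b) c = (\<Sum>\<^sub>\<infinity>k. Re (hc a k * cnj (hc c k)) + Re (hc b k * cnj (hc c k)))"
    unfolding inner_hs_def by (simp add: plus_hs.rep_eq algebra_simps)
  also have "\<dots> = inner a c + inner b c"
    unfolding inner_hs_def by (intro infsum_add inner_hs_summable)
  finally show "inner (a + b) c = inner a c + inner b c" .
  have "inner (r *\<^sub>R a) b = (\<Sum>\<^sub>\<infinity>k. r * Re (hc a k * cnj (hc b k)))"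
    unfolding inner_hs_def by (simp add: scaleR_hs.rep_eq algebra_simps)
  also have "\<dots> = r * inner a b"
    unfolding inner_hs_def by (rule infsum_cmult_right) (rule inner_hs_summable)
  finally show "inner (r *\<^sub>R a) b = r * inner a b" .
  have sq: "Re (z * cnj z) = (cmod z)\<^sup>2" for z by (simp add: complex_norm_square[symmetric])
  have i: "inner a a = (\<Sum>\<^sub>\<infinity>k. (cmod (hc a k))\<^sup>2)"
    unfolding inner_hs_def sq ..
  show "0 \<le> inner a a" unfolding i by (intro infsum_nonneg) simp
  show "(inner a a = 0) = (a = 0)"
  proof
    assume "inner a a = 0"
    then have "(cmod (hc a k))\<^sup>2 = 0" for k
      unfolding i by (intro nonneg_infsum_le_0D[of _ UNIV k] hc_summable) auto
    then show "a = 0" by (intro hs_eqI) (simp add: zero_hs.rep_eq)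
  next
    assume "a = 0"
    then show "inner a a = 0" unfolding i by (simp add: zero_hs.rep_eq)
  qed
  show "norm a = sqrt (inner a a)" by (rule norm_hs_def)
qed

end

lemma hc_0 [simp]: "hc 0 k = 0" by (simp add: zero_hs.rep_eq)
lemma hc_add [simp]: "hc (a + b) k = hc a k + hc b k" by (simp add: plus_hs.rep_eq)
lemma hc_uminus [simp]: "hc (- a) k = - hc a k" by (simp add: uminus_hs.rep_eq)
lemma hc_diff [simp]: "hc (a - b) k = hc a k - hc b k"
  unfolding minus_hs_def hc_add hc_uminus by simp
lemma hc_scaleR [simp]: "hc (r *\<^sub>R a) k = r *\<^sub>R hc a k" by (simp add: scaleR_hs.rep_eq)

lemma norm_hs_sq: "(norm a)\<^sup>2 = (\<Sum>\<^sub>\<infinity>k. (cmod (hc a k))\<^sup>2)"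
  by (simp add: power2_norm_eq_inner inner_hs_def complex_norm_square[symmetric])

lemma sum_le_norm_hs: "finite F \<Longrightarrow> (\<Sum>k\<in>F. (cmod (hc a k))\<^sup>2) \<le> (norm a)\<^sup>2"
  unfolding norm_hs_sq by (intro finite_sum_le_infsum hc_summable) auto

lemma norm_hc_le: "cmod (hc a k) \<le> norm a"
  using sum_le_norm_hs[of "{k}" a] by (simp add: power2_le_iff_abs_le)

lemma norm_hs_leI:
  assumes "\<And>F. finite F \<Longrightarrow> (\<Sum>k\<in>F. (cmod (hc a k))\<^sup>2) \<le> B\<^sup>2" "0 \<le> B"
  shows "norm a \<le> B"
proof -
  have "(norm a)\<^sup>2 \<le> B\<^sup>2"
    unfolding norm_hs_sq by (rule infsum_le_finite_sums[OF hc_summable]) (use assms in auto)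
  then show ?thesis using assms(2) by (simp add: power2_le_iff_abs_le)
qed

lemma bounded_linear_hc: "bounded_linear (\<lambda>a. hc a k)"
  by (rule bounded_linear_intro[of _ 1]) (auto simp: norm_hc_le)

lemma hsI:
  assumes "\<And>k. c (- k) = cnj (c k)" "\<And>F. finite F \<Longrightarrow> (\<Sum>k\<in>F. (cmod (c k))\<^sup>2) \<le> B"
  shows "hc (Abs_hs c) = c"
proof (rule Abs_hs_inverse, intro CollectI conjI allI assms(1))
  show "(\<lambda>k. (cmod (c k))\<^sup>2) summable_on UNIV"
    by (rule nonneg_bdd_above_summable_on) (use assms(2) in \<open>auto intro!: bdd_aboveI[of _ B]\<close>)
qed

text \<open>Limits exist coefficientwise, and the Cauchy estimate passes to the limit in each finite
  partial sum, uniformly in the finite index set.\<close>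

instance hs :: (finite) complete_space
proof
  fix X :: "nat \<Rightarrow> 'a hs" assume X: "Cauchy X"
  have "\<exists>l. (\<lambda>n. hc (X n) k) \<longlonglongrightarrow> l" for k
    using bounded_linear.Cauchy[OF bounded_linear_hc X] Cauchy_convergent_iff convergent_def by blast
  then obtain c where c: "\<And>k. (\<lambda>n. hc (X n) k) \<longlonglongrightarrow> c k" by metis
  have key: "\<exists>N. \<forall>n\<ge>N. \<forall>F. finite F \<longrightarrow> (\<Sum>k\<in>F. (cmod (hc (X n) k - c k))\<^sup>2) \<le> e\<^sup>2" if e0: "e > 0" for e
  proof -
    obtain N where "\<forall>m\<ge>N. \<forall>n\<ge>N. norm (X m - X n) < e"
      using X e0 unfolding Cauchy_def dist_norm by blast
    then have N: "\<And>m n. m \<ge> N \<Longrightarrow> n \<ge> N \<Longrightarrow> norm (X n - X m) < e" by blast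
    have "(\<Sum>k\<in>F. (cmod (hc (X n) k - c k))\<^sup>2) \<le> e\<^sup>2" if "n \<ge> N" "finite F" for n F
    proof (rule tendsto_upperbound)
      show "(\<lambda>m. \<Sum>k\<in>F. (cmod (hc (X n) k - hc (X m) k))\<^sup>2) \<longlonglongrightarrow> (\<Sum>k\<in>F. (cmod (hc (X n) k - c k))\<^sup>2)"
        by (intro tendsto_intros c)
      show "\<forall>\<^sub>F m in sequentially. (\<Sum>k\<in>F. (cmod (hc (X n) k - hc (X m) k))\<^sup>2) \<le> e\<^sup>2"
        unfolding eventually_sequentially
      proof (intro exI[of _ N] allI impI)
        fix m assume "m \<ge> N"
        have "(\<Sum>k\<in>F. (cmod (hc (X n) k - hc (X m) k))\<^sup>2) \<le> (norm (X n - X m))\<^sup>2"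
          using sum_le_norm_hs[OF \<open>finite F\<close>, of "X n - X m"] by simp
        also have "\<dots> \<le> e\<^sup>2" using N[OF \<open>m \<ge> N\<close> \<open>n \<ge> N\<close>] by (intro power_mono) auto
        finally show "(\<Sum>k\<in>F. (cmod (hc (X n) k - hc (X m) k))\<^sup>2) \<le> e\<^sup>2" .
      qed
    qed simp
    then show ?thesis by blast
  qed
  have cc: "c (- k) = cnj (c k)" for k
  proof (rule LIMSEQ_unique[OF c])
    show "(\<lambda>n. hc (X n) (- k)) \<longlonglongrightarrow> cnj (c k)"
      unfolding hc_minus_index by (intro tendsto_intros c)
  qed
  obtain N where N: "\<And>F. finite F \<Longrightarrow> (\<Sum>k\<in>F. (cmod (hc (X N) k - c k))\<^sup>2) \<le> 1\<^sup>2"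
    using key[of 1] by auto
  have hd: "hc (Abs_hs (\<lambda>k. hc (X N) k - c k)) = (\<lambda>k. hc (X N) k - c k)"
    by (rule hsI[of _ "1\<^sup>2"]) (use N in \<open>auto simp: hc_minus_index cc\<close>)
  define L where "L = X N - Abs_hs (\<lambda>k. hc (X N) k - c k)"
  have L: "hc L k = c k" for k unfolding L_def by (simp add: hd)
  have "X \<longlonglongrightarrow> L"
    unfolding LIMSEQ_iff
  proof (intro allI impI)
    fix e :: real assume e: "e > 0"
    obtain N where N: "\<And>n F. n \<ge> N \<Longrightarrow> finite F \<Longrightarrow> (\<Sum>k\<in>F. (cmod (hc (X n) k - c k))\<^sup>2) \<le> (e/2)\<^sup>2"
      using key[of "e/2"] e by auto
    have "norm (X n - L) \<le> e / 2" if "n \<ge> N" for n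
      by (rule norm_hs_leI) (use N[OF that] L e in auto)
    then show "\<exists>N. \<forall>n\<ge>N. norm (X n - L) < e" using e by (intro exI[of _ N]) force
  qed
  then show "convergent X" by (auto simp: convergent_def)
qed

instance hs :: (finite) banach ..

section \<open>Parseval and Riesz-Fischer\<close>

abbreviation nsq :: "(real^'d::finite \<Rightarrow> real) \<Rightarrow> real" where
  "nsq f \<equiv> (LINT x|tm. (f x)\<^sup>2)"

lemma fc_eq: "fc (f :: real^'d::finite \<Rightarrow> real) k = (1 / vol TYPE('d)) * (LINT x|tm. f x * ek (- k) x)"
  unfolding fc_def ek_def kdot_minus unfolding kdot_def by simp

lemma integrable_ek: "integrable tm f \<Longrightarrow> integrable tm (\<lambda>x. complex_of_real (f x) * ek k x)"
  by (rule Bochner_Integration.integrable_bound[of tm f]) (auto simp: norm_mult)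

lemma fc_add: "integrable tm f \<Longrightarrow> integrable tm g \<Longrightarrow> fc (\<lambda>x. f x + g x) k = fc f k + fc g k"
  by (simp add: fc_eq distrib_right distrib_left integrable_ek)

lemma fc_scale: "fc (\<lambda>x. c * f x) k = c * fc f k"
  by (simp add: fc_eq mult.assoc)

lemma fc_minus_index: "fc f (- k) = cnj (fc f k)"
proof -
  have "cnj (LINT x|tm. f x * ek (- k) x) = (LINT x|tm. f x * ek k x)"
    by (subst Bochner_Integration.integral_cnj[symmetric]) (simp add: ek_minus)
  then show ?thesis by (simp add: fc_eq)
qed

lemma fc_cong_AE:
  assumes "AE x in tm. f x = g x" "f \<in> borel_measurable tm" "g \<in> borel_measurable tm"
  shows "fc f k = fc g k"
proof -
  have "(LINT x|tm. f x * ek (- k) x) = (LINT x|tm. g x * ek (- k) x)"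
    using assms by (intro integral_cong_AE) auto
  then show ?thesis by (simp add: fc_eq)
qed

lemma vol_pos: "vol TYPE('d::finite) > 0" by simp

lemma integral_trig_sq:
  fixes d :: "int^'d::finite \<Rightarrow> complex"
  assumes "finite F"
  shows "(LINT x|tm. (cmod (\<Sum>k\<in>F. d k * ek k x))\<^sup>2) = vol TYPE('d) * (\<Sum>k\<in>F. (cmod (d k))\<^sup>2)"
proof -
  have ie: "integrable tm (ek k :: real^'d \<Rightarrow> complex)" for k
    using integrable_ek[OF L2_integrable[OF L2_const[of 1]], of k] by simp
  have "complex_of_real (LINT x|tm. (cmod (\<Sum>k\<in>F. d k * ek k x))\<^sup>2)
     = (LINT x|tm. (\<Sum>k\<in>F. \<Sum>l\<in>F. d k * cnj (d l) * ek (k - l) x))"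
    unfolding integral_complex_of_real[symmetric]
  proof (rule Bochner_Integration.integral_cong[OF refl])
    fix x :: "real^'d"
    have "complex_of_real ((cmod (\<Sum>k\<in>F. d k * ek k x))\<^sup>2)
        = (\<Sum>k\<in>F. d k * ek k x) * cnj (\<Sum>k\<in>F. d k * ek k x)"
      by (rule complex_norm_square)
    also have "\<dots> = (\<Sum>k\<in>F. \<Sum>l\<in>F. d k * cnj (d l) * ek (k - l) x)"
      by (simp add: sum_product diff_conv_add_uminus[of "_ :: int^'d"] ek_add ek_minus mult_ac del: add_uminus_conv_diff)
    finally show "complex_of_real ((cmod (\<Sum>k\<in>F. d k * ek k x))\<^sup>2) = (\<Sum>k\<in>F. \<Sum>l\<in>F. d k * cnj (d l) * ek (k - l) x)" .
  qed
  also have "\<dots> = (\<Sum>k\<in>F. \<Sum>l\<in>F. d k * cnj (d l) * (if k - l = 0 then vol TYPE('d) else 0))"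
    by (simp add: Bochner_Integration.integral_sum ie integral_ek del: of_real_power)
  also have "\<dots> = (\<Sum>k\<in>F. d k * cnj (d k) * vol TYPE('d))"
    using assms by (simp add: if_distrib cong: if_cong)
  also have "\<dots> = complex_of_real (vol TYPE('d) * (\<Sum>k\<in>F. (cmod (d k))\<^sup>2))"
    by (simp add: sum_distrib_left sum_distrib_right complex_norm_square[symmetric] mult.commute del: of_real_power)
  finally show ?thesis by (rule of_real_eq_iff[THEN iffD1])
qed

text \<open>Completing the square in the coefficients d: their distance to the Fourier coefficients
  is isolated as a nonnegative last term. Choosing d as the Fourier coefficients yields Bessel's
  inequality.\<close>

lemma trig_approx_identity:
  fixes f :: "real^'d::finite \<Rightarrow> real"
  assumes f: "L2 f" and F: "finite F"
  shows "(LINT x|tm. (cmod (f x - (\<Sum>k\<in>F. d k * ek k x)))\<^sup>2)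
     = nsq f - vol TYPE('d) * (\<Sum>k\<in>F. (cmod (fc f k))\<^sup>2) + vol TYPE('d) * (\<Sum>k\<in>F. (cmod (d k - fc f k))\<^sup>2)"
proof -
  let ?T = "\<lambda>x. \<Sum>k\<in>F. d k * ek k x"
  let ?v = "vol TYPE('d)"
  have expand: "(cmod (complex_of_real a - z))\<^sup>2 = a\<^sup>2 - 2 * Re (a * cnj z) + (cmod z)\<^sup>2" for a z
    unfolding cmod_power2 by (simp add: power2_diff algebra_simps)
  have i1: "integrable tm (\<lambda>x. (f x)\<^sup>2)" by (rule L2_sq_integrable[OF f])
  have ifc: "integrable tm (\<lambda>x. f x * cnj (?T x))"
    by (simp add: sum_distrib_left ek_minus[symmetric] mult.left_commute integrable_ek[OF L2_integrable[OF f]])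
  have "cmod (?T x) \<le> (\<Sum>k\<in>F. cmod (d k))" for x
    by (rule order_trans[OF norm_sum]) (simp add: norm_mult)
  then have "norm ((cmod (?T x))\<^sup>2) \<le> norm ((\<Sum>k\<in>F. cmod (d k))\<^sup>2)" for x
    by (simp add: power_mono sum_nonneg)
  then have i3: "integrable tm (\<lambda>x. (cmod (?T x))\<^sup>2)"
    by (intro Bochner_Integration.integrable_bound[OF finite_measure.integrable_const[OF finite_measure_tm], of _ "(\<Sum>k\<in>F. cmod (d k))\<^sup>2"])
       auto
  have "(LINT x|tm. f x * cnj (?T x)) = (\<Sum>k\<in>F. cnj (d k) * (LINT x|tm. f x * ek (- k) x))"
    by (simp add: sum_distrib_left ek_minus[symmetric] mult.left_commute integrable_ek[OF L2_integrable[OF f]])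
  also have "\<dots> = ?v * (\<Sum>k\<in>F. cnj (d k) * fc f k)"
    by (simp add: fc_eq sum_distrib_left mult_ac)
  finally have "(LINT x|tm. Re (f x * cnj (?T x))) = ?v * (\<Sum>k\<in>F. Re (cnj (d k) * fc f k))"
    using integral_Re[OF ifc] by (simp del: complex_cnj_mult)
  then have "(LINT x|tm. (cmod (f x - ?T x))\<^sup>2)
      = nsq f - 2 * (?v * (\<Sum>k\<in>F. Re (cnj (d k) * fc f k))) + ?v * (\<Sum>k\<in>F. (cmod (d k))\<^sup>2)"
    unfolding expand using i1 i3 integrable_Re[OF ifc] integral_trig_sq[OF F, of d] by simp
  also have "\<dots> = nsq f - ?v * (\<Sum>k\<in>F. (cmod (fc f k))\<^sup>2) + ?v * (\<Sum>k\<in>F. (cmod (d k - fc f k))\<^sup>2)"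
  proof -
    have "(cmod (d k - fc f k))\<^sup>2 = (cmod (fc f k))\<^sup>2 - 2 * Re (cnj (d k) * fc f k) + (cmod (d k))\<^sup>2" for k
      unfolding cmod_power2 by (simp add: power2_diff algebra_simps)
    then have "(\<Sum>k\<in>F. (cmod (d k - fc f k))\<^sup>2) = (\<Sum>k\<in>F. (cmod (fc f k))\<^sup>2)
        - 2 * (\<Sum>k\<in>F. Re (cnj (d k) * fc f k)) + (\<Sum>k\<in>F. (cmod (d k))\<^sup>2)"
      by (simp only: sum.distrib sum_subtractf sum_distrib_left)
    then show ?thesis by (simp only:) (simp only: algebra_simps)
  qed
  finally show ?thesis .
qed

lemma bessel:
  assumes "L2 (f :: real^'d::finite \<Rightarrow> real)" "finite F"
  shows "vol TYPE('d) * (\<Sum>k\<in>F. (cmod (fc f k))\<^sup>2) \<le> nsq f"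
proof -
  have "0 \<le> (LINT x|tm. (cmod (f x - (\<Sum>k\<in>F. fc f k * ek k x)))\<^sup>2)" by (rule Bochner_Integration.integral_nonneg) simp
  then show ?thesis unfolding trig_approx_identity[OF assms] by simp
qed

definition ctrig :: "(real^'d::finite \<Rightarrow> complex) \<Rightarrow> bool" where
  "ctrig g \<longleftrightarrow> (\<exists>F d. finite F \<and> (\<forall>x. g x = (\<Sum>k\<in>F. d k * ek k x)))"

lemma ctrig_add:
  assumes "ctrig f" "ctrig g" shows "ctrig (\<lambda>x. f x + g x)"
proof -
  obtain F d G e where F: "finite F" "\<And>x. f x = (\<Sum>k\<in>F. d k * ek k x)"
    and G: "finite G" "\<And>x. g x = (\<Sum>k\<in>G. e k * ek k x)"
    using assms unfolding ctrig_def by blast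
  let ?d = "\<lambda>k. (if k \<in> F then d k else 0) + (if k \<in> G then e k else 0)"
  have "f x + g x = (\<Sum>k\<in>F\<union>G. ?d k * ek k x)" for x
  proof -
    have "f x = (\<Sum>k\<in>F\<union>G. (if k \<in> F then d k else 0) * ek k x)"
      unfolding F using F G by (intro sum.mono_neutral_cong_left) auto
    moreover have "g x = (\<Sum>k\<in>F\<union>G. (if k \<in> G then e k else 0) * ek k x)"
      unfolding G using F G by (intro sum.mono_neutral_cong_left) auto
    ultimately show ?thesis by (simp add: distrib_right sum.distrib)
  qed
  then show ?thesis unfolding ctrig_def using F(1) G(1) by (intro exI[of _ "F \<union> G"] exI[of _ ?d]) auto
qed

lemma ctrig_scale:
  assumes "ctrig f" shows "ctrig (\<lambda>x. c * f x)"
proof -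
  obtain F d where F: "finite F" "\<And>x. f x = (\<Sum>k\<in>F. d k * ek k x)"
    using assms unfolding ctrig_def by blast
  then show ?thesis unfolding ctrig_def
    by (intro exI[of _ F] exI[of _ "\<lambda>k. c * d k"]) (auto simp: sum_distrib_left mult.assoc)
qed

lemma ctrig_ek: "ctrig (ek k)"
  unfolding ctrig_def by (intro exI[of _ "{k}"] exI[of _ "\<lambda>_. 1"]) simp

lemma cos_kdot: "complex_of_real (cos (kdot l x)) = (1/2) * ek l x + (1/2) * ek (- l) x"
  by (simp add: ek_def kdot_minus complex_eq_iff)

lemma sin_kdot: "complex_of_real (sin (kdot l x)) = (-\<i>/2) * ek l x + (\<i>/2) * ek (- l) x"
  by (simp add: ek_def kdot_minus complex_eq_iff)

lemma trigpoly_ctrig: "trigpoly f \<Longrightarrow> ctrig (\<lambda>x. complex_of_real (f x))"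
proof (induction rule: trigpoly.induct)
  case (tp_cos l)
  then show ?case unfolding cos_kdot by (intro ctrig_add ctrig_scale ctrig_ek)
next
  case (tp_sin l)
  then show ?case unfolding sin_kdot by (intro ctrig_add ctrig_scale ctrig_ek)
qed (auto intro: ctrig_add ctrig_scale)

text \<open>Bessel gives one inequality. For the other, a trigonometric polynomial within squared
  distance e of f (density with weight 1) shows that the defect is at most e.\<close>

lemma parseval:
  fixes f :: "real^'d::finite \<Rightarrow> real"
  assumes f: "L2 f"
  shows "(\<lambda>k. (cmod (fc f k))\<^sup>2) summable_on UNIV"
    and "nsq f = vol TYPE('d) * (\<Sum>\<^sub>\<infinity>k. (cmod (fc f k))\<^sup>2)"
proof -
  let ?v = "vol TYPE('d)"
  show s: "(\<lambda>k. (cmod (fc f k))\<^sup>2) summable_on UNIV"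
  proof (rule nonneg_bdd_above_summable_on)
    show "bdd_above (sum (\<lambda>k. (cmod (fc f k))\<^sup>2) ` {F. F \<subseteq> UNIV \<and> finite F})"
      by (rule bdd_aboveI[of _ "nsq f / ?v"])
         (use bessel[OF f] vol_pos in \<open>auto simp: pos_le_divide_eq mult.commute\<close>)
  qed simp
  have "(\<Sum>\<^sub>\<infinity>k. (cmod (fc f k))\<^sup>2) \<le> nsq f / ?v"
    by (rule infsum_le_finite_sums[OF s])
       (use bessel[OF f] vol_pos in \<open>auto simp: pos_le_divide_eq mult.commute\<close>)
  then have le: "?v * (\<Sum>\<^sub>\<infinity>k. (cmod (fc f k))\<^sup>2) \<le> nsq f"
    using vol_pos by (simp add: pos_le_divide_eq mult.commute)
  have "nsq f \<le> ?v * (\<Sum>\<^sub>\<infinity>k. (cmod (fc f k))\<^sup>2)"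
  proof (rule field_le_epsilon)
    fix e :: real assume "e > 0"
    then obtain \<phi> where \<phi>: "trigpoly \<phi>" "(LINT x|tm. (f x - \<phi> x)\<^sup>2 * 1) < e"
      using weighted_trig_density[of "\<lambda>_. 1" f e] f L2_integrable[OF L2_const[of 1]] by (auto simp: L2_def)
    obtain F d where F: "finite F" "\<And>x. complex_of_real (\<phi> x) = (\<Sum>k\<in>F. d k * ek k x)"
      using trigpoly_ctrig[OF \<phi>(1)] unfolding ctrig_def by blast
    have "(cmod (f x - (\<Sum>k\<in>F. d k * ek k x)))\<^sup>2 = (f x - \<phi> x)\<^sup>2" for x
      unfolding F(2)[symmetric] of_real_diff[symmetric] norm_of_real by simp
    then have "nsq f - ?v * (\<Sum>k\<in>F. (cmod (fc f k))\<^sup>2) + ?v * (\<Sum>k\<in>F. (cmod (d k - fc f k))\<^sup>2) < e"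
      using trig_approx_identity[OF f F(1), of d] \<phi>(2) by simp
    moreover have "0 \<le> ?v * (\<Sum>k\<in>F. (cmod (d k - fc f k))\<^sup>2)" by (intro mult_nonneg_nonneg sum_nonneg) auto
    moreover have "?v * (\<Sum>k\<in>F. (cmod (fc f k))\<^sup>2) \<le> ?v * (\<Sum>\<^sub>\<infinity>k. (cmod (fc f k))\<^sup>2)"
      by (intro mult_left_mono finite_sum_le_infsum s F(1)) auto
    ultimately show "nsq f \<le> ?v * (\<Sum>\<^sub>\<infinity>k. (cmod (fc f k))\<^sup>2) + e" by linarith
  qed
  with le show "nsq f = ?v * (\<Sum>\<^sub>\<infinity>k. (cmod (fc f k))\<^sup>2)" by simp
qed

definition FC :: "(real^'d::finite \<Rightarrow> real) \<Rightarrow> 'd hs" where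
  "FC f = Abs_hs (fc f)"

lemma hc_FC: "L2 f \<Longrightarrow> hc (FC f) = fc f"
  unfolding FC_def by (rule Abs_hs_inverse) (simp add: fc_minus_index parseval)

lemma norm_FC: "L2 (f :: real^'d::finite \<Rightarrow> real) \<Longrightarrow> vol TYPE('d) * (norm (FC f))\<^sup>2 = nsq f"
  by (simp add: norm_hs_sq hc_FC parseval)

lemma FC_add: "L2 f \<Longrightarrow> L2 g \<Longrightarrow> FC (\<lambda>x. f x + g x) = FC f + FC g"
  by (intro hs_eqI) (simp add: hc_FC L2_add fc_add L2_integrable)

lemma FC_scale: "L2 f \<Longrightarrow> FC (\<lambda>x. c * f x) = c *\<^sub>R FC f"
  by (intro hs_eqI) (simp add: hc_FC L2_scale fc_scale scaleR_conv_of_real)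

lemma FC_diff: "L2 f \<Longrightarrow> L2 g \<Longrightarrow> FC (\<lambda>x. f x - g x) = FC f - FC g"
  using FC_add[OF _ L2_scale, of f g "-1"] FC_scale[of g "-1"] by simp

lemma FC_cong_AE:
  assumes "AE x in tm. f x = g x" "L2 f" "L2 g"
  shows "FC f = FC g"
  by (intro hs_eqI) (simp add: hc_FC assms fc_cong_AE L2_meas)

lemma nsq_eq_0: "L2 f \<Longrightarrow> nsq f = 0 \<Longrightarrow> AE x in tm. f x = 0"
  using integral_nonneg_eq_0_iff_AE[of tm "\<lambda>x. (f x)\<^sup>2"] L2_sq_integrable[of f] by simp

lemma FC_eq_imp_AE:
  assumes "L2 f" "L2 g" "FC f = FC g"
  shows "AE x in tm. f x = g x"
proof -
  have "nsq (\<lambda>x. f x - g x) = 0"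
    using norm_FC[OF L2_diff[OF assms(1,2)]] FC_diff[OF assms(1,2)] assms(3) by simp
  from nsq_eq_0[OF L2_diff[OF assms(1,2)] this] show ?thesis by simp
qed

text \<open>Young's inequality with a free parameter \<delta>, integrated over a space of finite
  measure. It turns an L2-Cauchy sequence into an L1-Cauchy one, from which an almost everywhere
  convergent subsequence is extracted.\<close>

lemma L1_le_L2:
  fixes f :: "real^'d::finite \<Rightarrow> real"
  assumes "L2 f" "\<delta> > 0"
  shows "(LINT x|tm. \<bar>f x\<bar>) \<le> nsq f / (2 * \<delta>) + \<delta> / 2 * measure tm (space (tm :: (real^'d) measure))"
proof -
  interpret finite_measure "tm :: (real^'d) measure" by (rule finite_measure_tm)
  have "\<bar>a\<bar> \<le> a\<^sup>2 / (2 * \<delta>) + \<delta> / 2" for a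
    using sum_squares_bound[of "\<bar>a\<bar>" \<delta>] assms(2) by (simp add: field_simps power2_eq_square)
  then have "(LINT x|tm. \<bar>f x\<bar>) \<le> (LINT x|tm. (f x)\<^sup>2 / (2 * \<delta>) + \<delta> / 2)"
    by (intro integral_mono) (auto simp: L2_integrable assms L2_sq_integrable)
  also have "\<dots> = nsq f / (2 * \<delta>) + \<delta> / 2 * measure tm (space (tm :: (real^'d) measure))"
    by (subst Bochner_Integration.integral_add) (auto simp: L2_sq_integrable assms)
  finally show ?thesis .
qed

text \<open>Fatou's lemma delivering integrability of the limit together with the bound. It serves
  the completeness of L2 and the removal of truncations in \<open>sobolev_mult\<close>.\<close>

lemma integrable_fatou:
  fixes g :: "nat \<Rightarrow> 'a \<Rightarrow> real"
  assumes [measurable]: "\<And>n. integrable N (g n)" "f \<in> borel_measurable N"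
    and nn: "\<And>n x. g n x \<ge> 0" "\<And>x. f x \<ge> 0"
    and lim: "AE x in N. (\<lambda>n. g n x) \<longlonglongrightarrow> f x" and C: "\<And>n. integral\<^sup>L N (g n) \<le> C"
  shows "integrable N f \<and> integral\<^sup>L N f \<le> C"
proof -
  have [measurable]: "g n \<in> borel_measurable N" for n using assms(1)[of n] by auto
  have "0 \<le> integral\<^sup>L N (g 0)" using nn by simp
  with C[of 0] have C0: "0 \<le> C" by linarith
  have "(\<integral>\<^sup>+x. ennreal (f x) \<partial>N) \<le> (\<integral>\<^sup>+x. liminf (\<lambda>n. ennreal (g n x)) \<partial>N)"
  proof (rule nn_integral_mono_AE)
    show "AE x in N. ennreal (f x) \<le> liminf (\<lambda>n. ennreal (g n x))"
      using lim
    proof eventually_elim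
      case (elim x)
      then have "(\<lambda>n. ennreal (g n x)) \<longlonglongrightarrow> ennreal (f x)" by (rule tendsto_ennrealI)
      from lim_imp_Liminf[OF trivial_limit_sequentially this] show ?case by (simp only: order_refl)
    qed
  qed
  also have "\<dots> \<le> liminf (\<lambda>n. \<integral>\<^sup>+x. ennreal (g n x) \<partial>N)"
    by (rule nn_integral_liminf) measurable
  also have "\<dots> \<le> ennreal C"
  proof (rule Liminf_le)
    show "\<forall>\<^sub>F n in sequentially. (\<integral>\<^sup>+x. ennreal (g n x) \<partial>N) \<le> ennreal C"
      using nn_integral_eq_integral[OF assms(1)] nn C by (auto intro!: always_eventually ennreal_leI)
  qed simp
  finally have le: "(\<integral>\<^sup>+x. ennreal (f x) \<partial>N) \<le> ennreal C" .
  have i: "integrable N f"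
    by (rule integrableI_bounded) (use le nn in \<open>auto intro: le_less_trans\<close>)
  moreover have "integral\<^sup>L N f \<le> C"
    using le C0 nn nn_integral_eq_integral[OF i] by simp
  ultimately show ?thesis by blast
qed

text \<open>An a.e. subsequential limit of an \<open>L\<^sup>2\<close>-Cauchy sequence is its \<open>L\<^sup>2\<close>-limit, by Fatou.\<close>

lemma L2_complete:
  fixes X :: "nat \<Rightarrow> real^'d::finite \<Rightarrow> real"
  assumes X: "\<And>n. L2 (X n)"
    and C: "\<And>e. e > 0 \<Longrightarrow> \<exists>N. \<forall>m\<ge>N. \<forall>n\<ge>N. nsq (\<lambda>x. X m x - X n x) < e"
  shows "\<exists>f. L2 f \<and> (\<forall>e>0. \<exists>n0. \<forall>n\<ge>n0. nsq (\<lambda>x. f x - X n x) \<le> e)"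
proof -
  have [measurable]: "X n \<in> borel_measurable tm" for n by (rule L2_meas[OF X])
  let ?m = "measure tm (space (tm :: (real^'d) measure))"
  have C1: "\<exists>N. \<forall>i\<ge>N. \<forall>j\<ge>N. (LINT x|tm. norm (X i x - X j x)) < e" if e0: "e > 0" for e
  proof -
    \<comment> \<open>In \<open>L1_le_L2\<close> a squared distance below
      \<open>\<delta> * e\<close> contributes less than e/2, and this \<delta> keeps the second term
      below e/2 as well.\<close>
    define \<delta> where "\<delta> = e / (?m + 1)"
    have m: "?m \<ge> 0" by simp
    have \<delta>: "\<delta> > 0" unfolding \<delta>_def using e0 m by (intro divide_pos_pos) linarith+
    have "?m + 1 \<noteq> 0" using m by linarith
    then have "\<delta> * (?m + 1) = e" unfolding \<delta>_def by (metis nonzero_eq_divide_eq)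
    then have \<delta>2: "\<delta> * ?m \<le> e" using \<delta> by (simp only: distrib_left)
    note \<delta> = \<delta> \<delta>2
    obtain N where N: "\<And>i j. i \<ge> N \<Longrightarrow> j \<ge> N \<Longrightarrow> nsq (\<lambda>x. X i x - X j x) < \<delta> * e"
      using C[of "\<delta> * e"] \<delta> e0 by (metis mult_pos_pos)
    have "(LINT x|tm. norm (X i x - X j x)) < e" if "i \<ge> N" "j \<ge> N" for i j
    proof -
      have "(LINT x|tm. \<bar>X i x - X j x\<bar>) \<le> nsq (\<lambda>x. X i x - X j x) / (2 * \<delta>) + \<delta> / 2 * ?m"
        by (rule L1_le_L2[OF L2_diff[OF X X] \<delta>(1)])
      also have "nsq (\<lambda>x. X i x - X j x) / (2 * \<delta>) < e / 2"
        using N[OF that] \<delta>(1) by (simp add: field_simps)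
      finally show ?thesis using \<delta>(2) by simp
    qed
    then show ?thesis by blast
  qed
  obtain r where r: "strict_mono r" "AE x in tm. Cauchy (\<lambda>i. X (r i) x)"
    using cauchy_L1_AE_cauchy_subseq[of tm X, OF L2_integrable[OF X] C1] by blast
  define f where "f x = lim (\<lambda>i. X (r i) x)" for x
  have fm[measurable]: "f \<in> borel_measurable tm" unfolding f_def by measurable
  have lim: "AE x in tm. (\<lambda>i. X (r i) x) \<longlonglongrightarrow> f x"
    using r(2)
  proof eventually_elim
    case (elim x)
    then show ?case unfolding f_def by (simp add: Cauchy_convergent_iff convergent_LIMSEQ_iff)
  qed
  have key: "integrable tm (\<lambda>x. (f x - X n x)\<^sup>2) \<and> nsq (\<lambda>x. f x - X n x) \<le> e"
    if N: "\<And>m. m \<ge> N \<Longrightarrow> nsq (\<lambda>x. X m x - X n x) \<le> e" for n N e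
  proof (rule integrable_fatou[of tm "\<lambda>i x. (X (r (i + N)) x - X n x)\<^sup>2"])
    show "integrable tm (\<lambda>x. (X (r (i + N)) x - X n x)\<^sup>2)" for i
      by (rule L2_sq_integrable[OF L2_diff[OF X X]])
    show "nsq (\<lambda>x. X (r (i + N)) x - X n x) \<le> e" for i
      using seq_suble[OF r(1), of "i + N"] by (intro N) simp
    show "AE x in tm. (\<lambda>i. (X (r (i + N)) x - X n x)\<^sup>2) \<longlonglongrightarrow> (f x - X n x)\<^sup>2"
      using lim by eventually_elim (intro tendsto_intros LIMSEQ_ignore_initial_segment)
  qed auto
  have lt: "\<exists>n0. \<forall>n\<ge>n0. integrable tm (\<lambda>x. (f x - X n x)\<^sup>2) \<and> nsq (\<lambda>x. f x - X n x) \<le> e" if e0: "e > 0" for e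
  proof -
    obtain N where "\<And>m n. m \<ge> N \<Longrightarrow> n \<ge> N \<Longrightarrow> nsq (\<lambda>x. X m x - X n x) < e"
      using C[OF e0] by blast
    then show ?thesis using key by (intro exI[of _ N] allI impI) (meson less_imp_le)
  qed
  obtain n0 where "integrable tm (\<lambda>x. (f x - X n0 x)\<^sup>2)" using lt[of 1] by auto
  then have "L2 (\<lambda>x. f x - X n0 x)" by (simp add: L2_def)
  from L2_add[OF this X[of n0]] have "L2 f" by simp
  with lt show ?thesis by blast
qed

section \<open>Frequency balls and partial Fourier sums\<close>

definition kball :: "nat \<Rightarrow> (int^'d::finite) set" where
  "kball n = {k. ksq k \<le> (real n)\<^sup>2}"

lemma ksq_component: "(real_of_int (k $ i))\<^sup>2 \<le> ksq k"
  unfolding ksq_def by (rule member_le_sum) auto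

lemma ksq_nonneg: "0 \<le> ksq k" by (simp add: ksq_def sum_nonneg)

lemma kball_subset_box: "kball n \<subseteq> {k::int^'d::finite. \<forall>i. k $ i \<in> {- int n .. int n}}"
proof
  fix k :: "int^'d" assume "k \<in> kball n"
  have "\<bar>k $ i\<bar> \<le> int n" for i
  proof -
    have "(real_of_int (k $ i))\<^sup>2 \<le> (real n)\<^sup>2"
      using \<open>k \<in> kball n\<close> ksq_component[of k i] by (simp add: kball_def)
    then have "\<bar>real_of_int (k $ i)\<bar> \<le> real n" by (simp add: abs_le_square_iff[symmetric])
    then show ?thesis by linarith
  qed
  then show "k \<in> {k. \<forall>i. k $ i \<in> {- int n .. int n}}" by (auto simp: abs_le_iff minus_le_iff)
qed

lemma card_int_box:
  "finite {k::int^'d::finite. \<forall>i. k $ i \<in> {- int n .. int n}}"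
  "card {k::int^'d::finite. \<forall>i. k $ i \<in> {- int n .. int n}} = (2 * n + 1) ^ CARD('d)"
proof -
  have b: "bij_betw vec_lambda (UNIV \<rightarrow>\<^sub>E {- int n .. int n}) {k::int^'d::finite. \<forall>i. k $ i \<in> {- int n .. int n}}"
    by (rule bij_betw_byWitness[where f' = vec_nth]) (auto simp: PiE_def Pi_def)
  have "finite ((UNIV :: 'd set) \<rightarrow>\<^sub>E {- int n .. int n})" by (intro finite_PiE) auto
  then show "finite {k::int^'d::finite. \<forall>i. k $ i \<in> {- int n .. int n}}"
    using bij_betw_finite[OF b] by simp
  show "card {k::int^'d::finite. \<forall>i. k $ i \<in> {- int n .. int n}} = (2 * n + 1) ^ CARD('d)"
    using bij_betw_same_card[OF b] by (simp add: card_PiE nat_plus_as_int)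
qed

lemma finite_kball [simp]: "finite (kball n)"
  by (rule finite_subset[OF kball_subset_box card_int_box(1)])

lemma ksq_minus [simp]: "ksq (- k) = ksq k" by (simp add: ksq_def)

lemma kball_mono: "m \<le> n \<Longrightarrow> kball m \<subseteq> kball n"
  by (auto simp: kball_def intro: order_trans power_mono)

lemma kball_exhaust: "finite F \<Longrightarrow> \<exists>n. F \<subseteq> kball n"
proof (induction F rule: finite_induct)
  case (insert k F)
  then obtain n where n: "F \<subseteq> kball n" by blast
  obtain m :: nat where m: "ksq k \<le> real m" using real_arch_simple by blast
  have "real m \<le> (real m)\<^sup>2" by (cases m) (auto simp: power2_eq_square)
  with m have "ksq k \<le> (real m)\<^sup>2" by linarith
  then have "k \<in> kball m" by (simp add: kball_def)
  then show ?case using n kball_mono[of n "max m n"] kball_mono[of m "max m n"]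
    by (intro exI[of _ "max m n"]) auto
qed auto

definition psum :: "nat \<Rightarrow> 'd hs \<Rightarrow> real^'d::finite \<Rightarrow> real" where
  "psum n a x = (\<Sum>k\<in>kball n. Re (hc a k * ek k x))"

text \<open>The ball is symmetric under k -> -k and the coefficients are hermitian, so the complex
  sum equals its conjugate; taking real parts in \<open>psum\<close> loses nothing.\<close>

lemma of_real_psum: "complex_of_real (psum n a x) = (\<Sum>k\<in>kball n. hc a k * ek k x)"
  for a :: "'b::finite hs"
proof -
  let ?s = "\<Sum>k\<in>kball n. hc a k * ek k x"
  have "uminus ` kball n = (kball n :: (int^'b) set)"
  proof
    show "uminus ` kball n \<subseteq> (kball n :: (int^'b) set)" by (auto simp: kball_def)
    show "(kball n :: (int^'b) set) \<subseteq> uminus ` kball n"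
      by (auto simp: kball_def image_iff intro!: exI[of _ "- _"] bexI[of _ "- _"])
  qed
  then have "?s = (\<Sum>k\<in>kball n. hc a (- k) * ek (- k) x)"
    using sum.reindex[of uminus "kball n" "\<lambda>k. hc a k * ek k x"] by (simp add: inj_on_def)
  also have "\<dots> = cnj ?s" by (simp add: hc_minus_index ek_minus)
  finally have "Im ?s = 0" by (metis Reals_cnj_iff complex_is_Real_iff)
  then show ?thesis by (simp add: psum_def complex_eq_iff)
qed

lemma psum_bounded: "\<bar>psum n a x\<bar> \<le> (\<Sum>k\<in>kball n. cmod (hc a k))"
  unfolding psum_def
  by (rule order_trans[OF sum_abs], rule sum_mono) (metis abs_Re_le_cmod norm_ek mult.right_neutral norm_mult)

lemma psum_meas [measurable]: "psum n a \<in> borel_measurable tm"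
  unfolding psum_def by measurable

lemma L2_psum: "L2 (psum n a)"
  by (rule L2_dominated[OF L2_const[of 1] psum_meas]) (use psum_bounded in auto)

lemma fc_psum: "fc (psum n a) k = (if k \<in> kball n then hc a k else 0)"
  for a :: "'d::finite hs"
proof -
  have ie: "integrable tm (ek k :: real^'d \<Rightarrow> complex)" for k
    using integrable_ek[OF L2_integrable[OF L2_const[of 1]], of k] by simp
  have "(LINT x|tm. complex_of_real (psum n a x) * ek (- k) x) = (LINT x|tm. (\<Sum>l\<in>kball n. hc a l * ek (l - k) x))"
    unfolding of_real_psum by (simp add: sum_distrib_right mult.assoc ek_add[symmetric])
  also have "\<dots> = (\<Sum>l\<in>kball n. hc a l * (if l - k = 0 then vol TYPE('d) else 0))"
    by (simp add: Bochner_Integration.integral_sum ie integral_ek)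
  also have "\<dots> = vol TYPE('d) * (if k \<in> kball n then hc a k else 0)"
    by (simp add: if_distrib cong: if_cong)
  finally show ?thesis by (simp add: fc_eq)
qed

lemma finite_sum_near_norm:
  assumes "\<delta> > 0"
  shows "\<exists>F. finite F \<and> (norm a)\<^sup>2 - \<delta> < (\<Sum>k\<in>F. (cmod (hc a k))\<^sup>2)"
proof (rule ccontr)
  assume "\<not> ?thesis"
  then have "(norm a)\<^sup>2 \<le> (norm a)\<^sup>2 - \<delta>"
    using infsum_le_finite_sums[OF hc_summable[of a], of "(norm a)\<^sup>2 - \<delta>"] norm_hs_sq[of a] by force
  then show False using assms by simp
qed

lemma psum_converges: "(\<lambda>n. FC (psum n a)) \<longlonglongrightarrow> a"
  unfolding LIMSEQ_iff
proof (intro allI impI)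
  fix e :: real assume e: "e > 0"
  have "(e/2)\<^sup>2 > 0" using e by simp
  from finite_sum_near_norm[OF this, of a]
  obtain F where F: "finite F" "(norm a)\<^sup>2 - (e/2)\<^sup>2 < (\<Sum>k\<in>F. (cmod (hc a k))\<^sup>2)" by blast
  obtain N where N: "F \<subseteq> kball N" using kball_exhaust[OF F(1)] by blast
  have "norm (FC (psum n a) - a) \<le> e / 2" if n: "n \<ge> N" for n
  proof (rule norm_hs_leI)
    fix G :: "(int^'a) set" assume G: "finite G"
    have "(\<Sum>k\<in>G. (cmod (hc (FC (psum n a) - a) k))\<^sup>2) = (\<Sum>k\<in>G - kball n. (cmod (hc a k))\<^sup>2)"
      using G by (intro sum.mono_neutral_cong_right) (auto simp: hc_FC L2_psum fc_psum)
    also have "\<dots> \<le> (norm a)\<^sup>2 - (\<Sum>k\<in>F. (cmod (hc a k))\<^sup>2)"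
    proof -
      have "F \<inter> (G - kball n) = {}" using N kball_mono[OF n] by blast
      then have "(\<Sum>k\<in>F. (cmod (hc a k))\<^sup>2) + (\<Sum>k\<in>G - kball n. (cmod (hc a k))\<^sup>2) = (\<Sum>k\<in>F \<union> (G - kball n). (cmod (hc a k))\<^sup>2)"
        using F G by (simp add: sum.union_disjoint)
      also have "\<dots> \<le> (norm a)\<^sup>2" using F G by (intro sum_le_norm_hs) auto
      finally show ?thesis by simp
    qed
    also have "\<dots> \<le> (e/2)\<^sup>2" using F by simp
    finally show "(\<Sum>k\<in>G. (cmod (hc (FC (psum n a) - a) k))\<^sup>2) \<le> (e/2)\<^sup>2" .
  qed (use e in simp)
  then show "\<exists>N. \<forall>n\<ge>N. norm (FC (psum n a) - a) < e" using e by (intro exI[of _ N]) force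
qed

text \<open>By Parseval the partial sums are Cauchy in L2, since their coefficient sequences
  converge. The L2 limit has the limit coefficients.\<close>

theorem riesz_fischer:
  fixes a :: "'d::finite hs"
  shows "\<exists>f. L2 f \<and> FC f = a"
proof -
  let ?v = "vol TYPE('d)"
  have d: "nsq (\<lambda>x. psum m a x - psum n a x) = ?v * (norm (FC (psum m a) - FC (psum n a)))\<^sup>2" for m n
    by (simp add: norm_FC[symmetric] L2_diff L2_psum FC_diff)
  have "\<exists>f. L2 f \<and> (\<forall>e>0. \<exists>n0. \<forall>n\<ge>n0. nsq (\<lambda>x. f x - psum n a x) \<le> e)"
  proof (rule L2_complete[OF L2_psum])
    fix e :: real assume e: "e > 0"
    have "Cauchy (\<lambda>n. FC (psum n a))" using psum_converges[of a] by (rule LIMSEQ_imp_Cauchy)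
    then obtain N where N: "\<And>m n. m \<ge> N \<Longrightarrow> n \<ge> N \<Longrightarrow> norm (FC (psum m a) - FC (psum n a)) < sqrt (e / ?v)"
      using e vol_pos unfolding Cauchy_def dist_norm by (metis divide_pos_pos real_sqrt_gt_zero)
    have "nsq (\<lambda>x. psum m a x - psum n a x) < e" if "m \<ge> N" "n \<ge> N" for m n
    proof -
      have "(norm (FC (psum m a) - FC (psum n a)))\<^sup>2 < (sqrt (e / ?v))\<^sup>2"
        using N[OF that] by (intro power_strict_mono) auto
      also have "\<dots> = e / ?v" using e by (intro real_sqrt_pow2) simp
      finally show ?thesis unfolding d using vol_pos by (simp add: pos_less_divide_eq mult.commute)
    qed
    then show "\<exists>N. \<forall>m\<ge>N. \<forall>n\<ge>N. nsq (\<lambda>x. psum m a x - psum n a x) < e" by blast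
  qed
  then obtain f where f: "L2 f" "\<And>e. e > 0 \<Longrightarrow> \<exists>n0. \<forall>n\<ge>n0. nsq (\<lambda>x. f x - psum n a x) \<le> e" by blast
  have "(\<lambda>n. FC (psum n a)) \<longlonglongrightarrow> FC f"
    unfolding LIMSEQ_iff
  proof (intro allI impI)
    fix e :: real assume e: "e > 0"
    obtain n0 where n0: "\<And>n. n \<ge> n0 \<Longrightarrow> nsq (\<lambda>x. f x - psum n a x) \<le> ?v * (e/2)\<^sup>2"
      using f(2)[of "?v * (e/2)\<^sup>2"] e vol_pos by (auto simp del: power_divide)
    have "norm (FC (psum n a) - FC f) \<le> e / 2" if "n \<ge> n0" for n
    proof -
      have "?v * (norm (FC f - FC (psum n a)))\<^sup>2 \<le> ?v * (e/2)\<^sup>2"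
        using n0[OF that] norm_FC[OF L2_diff[OF f(1) L2_psum], of n a] by (simp add: FC_diff f(1) L2_psum)
      then have "(norm (FC f - FC (psum n a)))\<^sup>2 \<le> (e/2)\<^sup>2"
        using mult_le_cancel_left_pos[OF vol_pos[where 'd='d]] by blast
      then show ?thesis using e by (simp add: norm_minus_commute power2_le_iff_abs_le)
    qed
    then show "\<exists>N. \<forall>n\<ge>N. norm (FC (psum n a) - FC f) < e" using e by (intro exI[of _ n0]) force
  qed
  with psum_converges[of a] have "FC f = a" by (rule LIMSEQ_unique[rotated])
  with f(1) show ?thesis by blast
qed

text \<open>The representative is arbitrary on null sets, which is why linearity of
  \<open>fn\<close> holds only almost everywhere.\<close>

definition fn :: "'d::finite hs \<Rightarrow> real^'d \<Rightarrow> real" where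
  "fn a = (SOME f. L2 f \<and> FC f = a)"

lemma L2_fn [simp]: "L2 (fn a)" and FC_fn [simp]: "FC (fn a) = a"
  using someI_ex[OF riesz_fischer[of a]] by (auto simp: fn_def)

lemma fn_meas [measurable]: "fn a \<in> borel_measurable tm" by (rule L2_meas) simp

lemma fc_fn [simp]: "fc (fn a) = hc a" using hc_FC[of "fn a"] by simp

lemma fn_FC: "L2 f \<Longrightarrow> AE x in tm. fn (FC f) x = f x"
  by (rule FC_eq_imp_AE) auto

lemma fn_add: "AE x in tm. fn (a + b) x = fn a x + fn b x"
  by (rule FC_eq_imp_AE) (auto simp: FC_add L2_add)

lemma fn_scale: "AE x in tm. fn (r *\<^sub>R a) x = r * fn a x"
  by (rule FC_eq_imp_AE) (auto simp: FC_scale L2_scale)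

lemma nsq_fn: "nsq (fn a) = vol TYPE('d) * (norm a)\<^sup>2" for a :: "'d::finite hs"
  using norm_FC[of "fn a"] by simp

section \<open>Fourier multipliers depending on the frequency\<close>

lemma om_ge_1: "om k \<ge> 1" by (simp add: om_def ksq_nonneg)
lemma om_pos: "om k > 0" using om_ge_1[of k] by linarith
lemma om_minus [simp]: "om (- k) = om k" by (simp add: om_def)
lemma om_sq: "(om k)\<^sup>2 = 1 + ksq k" using ksq_nonneg[of k] by (simp add: om_def)

text \<open>\<open>dg g\<close> is the operator \<open>g(\<surd>(1-\<Delta>))\<close>; it is only meaningful for \<open>g\<close> bounded on \<open>[1,\<infinity>)\<close>.\<close>

definition dg :: "(real \<Rightarrow> real) \<Rightarrow> 'd::finite hs \<Rightarrow> 'd hs" where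
  "dg g a = Abs_hs (\<lambda>k. g (om k) *\<^sub>R hc a k)"

definition bd :: "(real \<Rightarrow> real) \<Rightarrow> real \<Rightarrow> bool" where
  "bd g B \<longleftrightarrow> (\<forall>x\<ge>1. \<bar>g x\<bar> \<le> B)"

lemma bd_nonneg: "bd g B \<Longrightarrow> B \<ge> 0" unfolding bd_def by (meson abs_ge_zero order_refl order_trans)

lemma bd_om: "bd g B \<Longrightarrow> \<bar>g (om k)\<bar> \<le> B" using om_ge_1[of k] by (simp add: bd_def)

lemma sum_dg_le:
  fixes a :: "'a::finite hs"
  assumes "bd g B"
  shows "(\<Sum>k\<in>F. (cmod (g (om k) *\<^sub>R hc a k))\<^sup>2) \<le> B\<^sup>2 * (\<Sum>k\<in>F. (cmod (hc a k))\<^sup>2)"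
  unfolding sum_distrib_left
proof (rule sum_mono)
  fix k :: "int^'a"
  have "(g (om k))\<^sup>2 \<le> B\<^sup>2" using power_mono[OF bd_om[OF assms, of k] abs_ge_zero, of 2] by simp
  then show "(cmod (g (om k) *\<^sub>R hc a k))\<^sup>2 \<le> B\<^sup>2 * (cmod (hc a k))\<^sup>2"
    by (simp add: power_mult_distrib mult_right_mono)
qed

lemma hc_dg: assumes "bd g B" shows "hc (dg g a) k = g (om k) *\<^sub>R hc a k"
proof -
  have "hc (dg g a) = (\<lambda>k. g (om k) *\<^sub>R hc a k)" unfolding dg_def
  proof (rule hsI)
    fix F :: "(int^'a) set" assume F: "finite F"
    show "(\<Sum>k\<in>F. (cmod (g (om k) *\<^sub>R hc a k))\<^sup>2) \<le> B\<^sup>2 * (norm a)\<^sup>2"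
      by (rule order_trans[OF sum_dg_le[OF assms]]) (intro mult_left_mono sum_le_norm_hs F, simp)
  qed (simp add: hc_minus_index)
  then show ?thesis by simp
qed

lemma norm_dg: assumes "bd g B" shows "norm (dg g a) \<le> B * norm a"
proof (rule norm_hs_leI)
  fix F :: "(int^'a) set" assume F: "finite F"
  show "(\<Sum>k\<in>F. (cmod (hc (dg g a) k))\<^sup>2) \<le> (B * norm a)\<^sup>2"
    unfolding hc_dg[OF assms] power_mult_distrib
    by (rule order_trans[OF sum_dg_le[OF assms]]) (intro mult_left_mono sum_le_norm_hs F, simp)
qed (use bd_nonneg[OF assms] in simp)

lemma dg_add: "bd g B \<Longrightarrow> dg g (a + b) = dg g a + dg g b"
  by (rule hs_eqI) (simp add: hc_dg scaleR_add_right)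
lemma dg_scale: "bd g B \<Longrightarrow> dg g (r *\<^sub>R a) = r *\<^sub>R dg g a"
  by (rule hs_eqI) (simp add: hc_dg)
lemma bounded_linear_dg: "bd g B \<Longrightarrow> bounded_linear (dg g)"
  by (rule bounded_linear_intro[of _ B]) (auto simp: dg_add dg_scale mult.commute norm_dg)
lemma bd_mult: "bd g B \<Longrightarrow> bd h C \<Longrightarrow> bd (\<lambda>x. g x * h x) (B * C)"
  unfolding bd_def by (auto simp: abs_mult intro!: mult_mono intro: order_trans[OF abs_ge_zero])
lemma bd_add: "bd g B \<Longrightarrow> bd h C \<Longrightarrow> bd (\<lambda>x. g x + h x) (B + C)"
  unfolding bd_def by (meson abs_triangle_ineq add_mono order_trans)
lemma bd_minus: "bd g B \<Longrightarrow> bd (\<lambda>x. - g x) B" by (simp add: bd_def)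
lemma dg_dg: assumes "bd g B" "bd h C" shows "dg g (dg h a) = dg (\<lambda>x. g x * h x) a"
  by (rule hs_eqI) (simp add: hc_dg[OF assms(1)] hc_dg[OF assms(2)] hc_dg[OF bd_mult[OF assms]])
lemma dg_plus: assumes "bd g B" "bd h C" shows "dg (\<lambda>x. g x + h x) a = dg g a + dg h a"
  by (rule hs_eqI) (simp add: hc_dg[OF assms(1)] hc_dg[OF assms(2)] hc_dg[OF bd_add[OF assms]] scaleR_add_left)
lemma dg_uminus: assumes "bd g B" shows "dg (\<lambda>x. - g x) a = - dg g a"
  by (rule hs_eqI) (simp add: hc_dg[OF assms(1)] hc_dg[OF bd_minus[OF assms]])
lemma dg_minus: assumes "bd g B" "bd h C" shows "dg (\<lambda>x. g x - h x) a = dg g a - dg h a"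
  using dg_plus[OF assms(1) bd_minus[OF assms(2)], of a] dg_uminus[OF assms(2), of a] by simp
lemma bd_const: "bd (\<lambda>x. c) \<bar>c\<bar>" by (simp add: bd_def)
lemma dg_const: "dg (\<lambda>x. c) a = c *\<^sub>R a"
  by (rule hs_eqI) (simp add: hc_dg[OF bd_const])

text \<open>Finitely many modes K carry all but \<delta> of the squared norm of a. On K the
  multipliers converge pointwise; on the remaining modes the uniform bound B suffices.\<close>

lemma dg_tendsto_0:
  fixes a :: "'a::finite hs"
  assumes bd: "\<And>t. bd (g t) B" and lim: "\<And>x. x \<ge> 1 \<Longrightarrow> ((\<lambda>t. g t x) \<longlongrightarrow> 0) F"
  shows "((\<lambda>t. dg (g t) a) \<longlongrightarrow> 0) F"
proof (rule tendstoI, simp add: dist_norm)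
  fix e :: real assume e: "e > 0"
  have B: "B \<ge> 0" by (rule bd_nonneg[OF bd])
  \<comment> \<open>Chosen so that the modes outside K contribute at most
    \<open>B\<^sup>2 * \<delta> \<le> e\<^sup>2 / 4\<close>; the 1 covers the case B = 0.\<close>
  define \<delta> where "\<delta> = e\<^sup>2 / (4 * (B\<^sup>2 + 1))"
  have B1: "B\<^sup>2 + 1 > 0" by (simp add: add_nonneg_pos)
  have \<delta>0: "\<delta> > 0" unfolding \<delta>_def using e B1 by (intro divide_pos_pos) auto
  have "4 * (B\<^sup>2 + 1) * \<delta> = e\<^sup>2" unfolding \<delta>_def using B1 by (simp del: distrib_left_numeral)
  then have "B\<^sup>2 * \<delta> \<le> e\<^sup>2 / 4" using \<delta>0 by (simp add: algebra_simps)
  note \<delta> = \<delta>0 this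
  from finite_sum_near_norm[OF \<delta>0, of a]
  obtain K where K: "finite K" "(norm a)\<^sup>2 - \<delta> < (\<Sum>k\<in>K. (cmod (hc a k))\<^sup>2)" by blast
  let ?s = "\<lambda>t. \<Sum>k\<in>K. (cmod (g t (om k) *\<^sub>R hc a k))\<^sup>2"
  have "(?s \<longlongrightarrow> (\<Sum>k\<in>K. (cmod (0 *\<^sub>R hc a k))\<^sup>2)) F"
    by (intro tendsto_intros lim om_ge_1)
  then have "(?s \<longlongrightarrow> 0) F" by simp
  then have "\<forall>\<^sub>F t in F. ?s t < e\<^sup>2 / 4" by (rule order_tendstoD) (use e in simp)
  then show "\<forall>\<^sub>F t in F. norm (dg (g t) a) < e"
  proof eventually_elim
    case (elim t)
    have "norm (dg (g t) a) \<le> sqrt (e\<^sup>2 / 2)"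
    proof (rule norm_hs_leI)
      fix G :: "(int^'a) set" assume G: "finite G"
      have "(\<Sum>k\<in>G. (cmod (hc (dg (g t) a) k))\<^sup>2) \<le> (\<Sum>k\<in>K \<union> (G - K). (cmod (g t (om k) *\<^sub>R hc a k))\<^sup>2)"
        unfolding hc_dg[OF bd] using G K by (intro sum_mono2) auto
      also have "\<dots> = ?s t + (\<Sum>k\<in>G - K. (cmod (g t (om k) *\<^sub>R hc a k))\<^sup>2)"
        using G K by (intro sum.union_disjoint) auto
      also have "(\<Sum>k\<in>G - K. (cmod (g t (om k) *\<^sub>R hc a k))\<^sup>2) \<le> B\<^sup>2 * (\<Sum>k\<in>G - K. (cmod (hc a k))\<^sup>2)"
        by (rule sum_dg_le[OF bd])
      also have "(\<Sum>k\<in>G - K. (cmod (hc a k))\<^sup>2) \<le> \<delta>"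
      proof -
        have "(\<Sum>k\<in>K. (cmod (hc a k))\<^sup>2) + (\<Sum>k\<in>G - K. (cmod (hc a k))\<^sup>2) = (\<Sum>k\<in>K \<union> (G - K). (cmod (hc a k))\<^sup>2)"
          using K G by (intro sum.union_disjoint[symmetric]) auto
        also have "\<dots> \<le> (norm a)\<^sup>2" using K G by (intro sum_le_norm_hs) auto
        finally show ?thesis using K(2) by linarith
      qed
      finally have "(\<Sum>k\<in>G. (cmod (hc (dg (g t) a) k))\<^sup>2) \<le> ?s t + B\<^sup>2 * \<delta>"
        by (simp add: mult_left_mono)
      also have "\<dots> \<le> e\<^sup>2 / 2" using elim \<delta>(2) by linarith
      finally show "(\<Sum>k\<in>G. (cmod (hc (dg (g t) a) k))\<^sup>2) \<le> (sqrt (e\<^sup>2 / 2))\<^sup>2" by simp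
    qed simp
    also have "sqrt (e\<^sup>2 / 2) < e" using e by (intro real_less_lsqrt) (auto simp: power2_eq_square)
    finally show ?case .
  qed
qed

text \<open>The operator \<open>(1 - \<Delta>)\<close> to the power -1/2. Its range is H1
  (\<open>H1_imp_J_preimage\<close>, \<open>H1_of_J\<close>), so membership in H1 is expressed as
  being of the form \<open>J b\<close>.\<close>

definition J :: "'d::finite hs \<Rightarrow> 'd hs" where "J = dg (\<lambda>x. 1 / x)"

lemma bd_inverse: "bd (\<lambda>x. 1 / x) 1" by (simp add: bd_def)

lemma hc_J: "hc (J a) k = hc a k /\<^sub>R om k"
  unfolding J_def hc_dg[OF bd_inverse] by (simp add: inverse_eq_divide)

lemma norm_J: "norm (J a) \<le> norm a" unfolding J_def using norm_dg[OF bd_inverse, of a] by simp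

lemma bounded_linear_J: "bounded_linear J" unfolding J_def by (rule bounded_linear_dg[OF bd_inverse])

lemmas J_add = linear_add[OF bounded_linear.linear[OF bounded_linear_J]]
  and J_diff = linear_diff[OF bounded_linear.linear[OF bounded_linear_J]]
  and J_scale = linear_cmul[OF bounded_linear.linear[OF bounded_linear_J]]

lemma J_0 [simp]: "J 0 = 0" by (rule linear_0[OF bounded_linear.linear[OF bounded_linear_J]])

section \<open>Multiplication operators from \<open>H\<^sup>1\<close> to \<open>L\<^sup>2\<close>\<close>

text \<open>An element \<open>a\<close> of the sequence space encodes the \<open>H\<^sup>1\<close> function \<open>fn (J a)\<close>, whose
  \<open>H\<^sup>1\<close> norm is the norm of \<open>a\<close> up to a constant.\<close>

definition mbdd :: "(real^'d::finite \<Rightarrow> real) \<Rightarrow> real \<Rightarrow> bool" where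
  "mbdd Q C \<longleftrightarrow> Q \<in> borel_measurable tm \<and>
     (\<forall>a. L2 (\<lambda>x. Q x * fn (J a) x) \<and> norm (FC (\<lambda>x. Q x * fn (J a) x)) \<le> C * norm a)"

definition K :: "(real^'d::finite \<Rightarrow> real) \<Rightarrow> 'd hs \<Rightarrow> 'd hs" where
  "K Q a = FC (\<lambda>x. Q x * fn (J a) x)"

lemma mbdd_L2: "mbdd Q C \<Longrightarrow> L2 (\<lambda>x. Q x * fn (J a) x)" by (simp add: mbdd_def)
lemma norm_K: "mbdd Q C \<Longrightarrow> norm (K Q a) \<le> C * norm a" by (simp add: mbdd_def K_def)

lemma K_add: assumes "mbdd Q C" shows "K Q (a + b) = K Q a + K Q b"
proof -
  have "AE x in tm. Q x * fn (J (a + b)) x = Q x * fn (J a) x + Q x * fn (J b) x"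
    using fn_add[of "J a" "J b"] by eventually_elim (simp add: J_add distrib_left)
  then have "K Q (a + b) = FC (\<lambda>x. Q x * fn (J a) x + Q x * fn (J b) x)"
    unfolding K_def by (rule FC_cong_AE) (auto intro: L2_add mbdd_L2[OF assms])
  also have "\<dots> = K Q a + K Q b" unfolding K_def by (rule FC_add) (rule mbdd_L2[OF assms])+
  finally show ?thesis .
qed

lemma K_scale: assumes "mbdd Q C" shows "K Q (r *\<^sub>R a) = r *\<^sub>R K Q a"
proof -
  have "AE x in tm. Q x * fn (J (r *\<^sub>R a)) x = r * (Q x * fn (J a) x)"
    using fn_scale[of r "J a"] by eventually_elim (simp add: J_scale mult.left_commute)
  then have "K Q (r *\<^sub>R a) = FC (\<lambda>x. r * (Q x * fn (J a) x))"
    unfolding K_def by (rule FC_cong_AE) (auto intro: L2_scale mbdd_L2[OF assms])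
  also have "\<dots> = r *\<^sub>R K Q a" unfolding K_def by (rule FC_scale) (rule mbdd_L2[OF assms])
  finally show ?thesis .
qed

lemma bounded_linear_K: "mbdd Q C \<Longrightarrow> bounded_linear (K Q)"
  by (rule bounded_linear_intro[of _ C]) (auto simp: K_add K_scale mult.commute norm_K)

section \<open>Multiplication by bounded functions on L2\<close>

definition M :: "(real^'d::finite \<Rightarrow> real) \<Rightarrow> 'd hs \<Rightarrow> 'd hs" where
  "M \<phi> a = FC (\<lambda>x. \<phi> x * fn a x)"

lemma L2_M:
  assumes "\<phi> \<in> borel_measurable tm" "\<And>x. \<bar>\<phi> x\<bar> \<le> B"
  shows "L2 (\<lambda>x. \<phi> x * fn a x)"
  by (rule L2_mult_bounded[OF L2_fn assms])

lemma norm_M: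
  fixes \<phi> :: "real^'d::finite \<Rightarrow> real"
  assumes \<phi>: "\<phi> \<in> borel_measurable tm" "\<And>x. \<bar>\<phi> x\<bar> \<le> B"
  shows "norm (M \<phi> a) \<le> B * norm a"
proof -
  have B: "B \<ge> 0" using assms(2)[of 0] by linarith
  have "(\<phi> x * fn a x)\<^sup>2 \<le> B\<^sup>2 * (fn a x)\<^sup>2" for x
    using power_mono[OF \<phi>(2) abs_ge_zero, of x 2] by (simp add: power_mult_distrib mult_right_mono)
  then have "nsq (\<lambda>x. \<phi> x * fn a x) \<le> (LINT x|tm. B\<^sup>2 * (fn a x)\<^sup>2)"
    by (intro integral_mono L2_sq_integrable L2_M[OF \<phi>] integrable_mult_right) auto
  also have "\<dots> = vol TYPE('d) * (B * norm a)\<^sup>2" by (simp add: nsq_fn power_mult_distrib)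
  finally have "vol TYPE('d) * (norm (M \<phi> a))\<^sup>2 \<le> vol TYPE('d) * (B * norm a)\<^sup>2"
    unfolding M_def norm_FC[OF L2_M[OF \<phi>]] .
  then have "(norm (M \<phi> a))\<^sup>2 \<le> (B * norm a)\<^sup>2"
    using mult_le_cancel_left_pos[OF vol_pos[where 'd='d]] by blast
  then show ?thesis by (rule power2_le_imp_le) (use B in simp)
qed

lemma K_eq_M: "K \<phi> a = M \<phi> (J a)" by (simp add: K_def M_def)

lemma mbdd_bounded:
  assumes "\<phi> \<in> borel_measurable tm" "\<And>x. \<bar>\<phi> x\<bar> \<le> B"
  shows "mbdd \<phi> B"
  unfolding mbdd_def
proof (intro conjI allI assms(1) L2_M[OF assms])
  fix a
  have B: "B \<ge> 0" using assms(2)[of 0] by linarith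
  show "norm (FC (\<lambda>x. \<phi> x * fn (J a) x)) \<le> B * norm a"
    using norm_M[OF assms, of "J a"] mult_left_mono[OF norm_J[of a] B] by (simp add: M_def)
qed

lemma
  assumes "mbdd P C" "mbdd Q D"
  shows mbdd_add: "mbdd (\<lambda>x. P x + Q x) (C + D)" and K_plus: "K (\<lambda>x. P x + Q x) a = K P a + K Q a"
proof -
  have L: "L2 (\<lambda>x. (P x + Q x) * fn (J a) x)" for a
    unfolding distrib_right by (intro L2_add mbdd_L2[OF assms(1)] mbdd_L2[OF assms(2)])
  have eq: "K (\<lambda>x. P x + Q x) a = K P a + K Q a" for a
    unfolding K_def distrib_right by (intro FC_add mbdd_L2[OF assms(1)] mbdd_L2[OF assms(2)])
  then show "K (\<lambda>x. P x + Q x) a = K P a + K Q a" .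
  show "mbdd (\<lambda>x. P x + Q x) (C + D)"
    unfolding mbdd_def K_def[symmetric] eq
  proof (intro conjI allI L)
    show "(\<lambda>x. P x + Q x) \<in> borel_measurable tm" using assms unfolding mbdd_def by (auto intro: borel_measurable_add)
    show "norm (K P a + K Q a) \<le> (C + D) * norm a" for a
      using norm_triangle_ineq[of "K P a" "K Q a"] norm_K[OF assms(1), of a] norm_K[OF assms(2), of a]
      by (simp add: distrib_right)
  qed
qed

text \<open>Homogeneity extends the estimate from the unit ball. The zero element cannot be
  normalised and is treated separately, its representative vanishing only almost everywhere.\<close>

lemma mbdd_of_unit_ball:
  fixes Q :: "real^'d::finite \<Rightarrow> real"
  assumes Q: "Q \<in> borel_measurable tm"
    and *: "\<And>a. norm a \<le> 1 \<Longrightarrow> L2 (\<lambda>x. Q x * fn (J a) x) \<and> nsq (\<lambda>x. Q x * fn (J a) x) \<le> C"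
  shows "\<exists>D. mbdd Q D"
proof -
  define D where "D = sqrt (C / vol TYPE('d))"
  have D: "norm (K Q a) \<le> D" if "norm a \<le> 1" for a
  proof -
    have "vol TYPE('d) * (norm (K Q a))\<^sup>2 \<le> C"
      using *[OF that] norm_FC[of "\<lambda>x. Q x * fn (J a) x"] unfolding K_def by linarith
    then have "(norm (K Q a))\<^sup>2 \<le> C / vol TYPE('d)"
      using pos_le_divide_eq[OF vol_pos[where 'd='d]] by (simp only: mult.commute)
    then show ?thesis unfolding D_def by (rule real_le_rsqrt)
  qed
  have "L2 (\<lambda>x. Q x * fn (J a) x) \<and> norm (K Q a) \<le> D * norm a" for a
  proof (cases "a = 0")
    case True
    have "AE x in tm. fn (J a) x = 0"
      using fn_scale[of 0 "J a"] True by simp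
    then have ae: "AE x in tm. Q x * fn (J a) x = 0" by eventually_elim simp
    have l0: "L2 (\<lambda>x. 0)" by (rule L2_const)
    have l: "L2 (\<lambda>x. Q x * fn (J a) x)"
      by (rule L2_AE_cong[OF l0]) (use Q ae in auto)
    moreover have "K Q a = FC (\<lambda>x. 0)" unfolding K_def by (rule FC_cong_AE[OF ae l l0])
    moreover have "FC (\<lambda>x::real^'d. 0) = 0" using FC_scale[OF l0, of 0] by simp
    ultimately show ?thesis using True by simp
  next
    case False
    define b where "b = a /\<^sub>R norm a"
    have b: "norm b \<le> 1" "a = norm a *\<^sub>R b" using False by (auto simp: b_def)
    have "AE x in tm. fn (J a) x = norm a * fn (J b) x"
      using fn_scale[of "norm a" "J b"] b(2) J_scale[of "norm a" b] by simp
    then have ae: "AE x in tm. norm a * (Q x * fn (J b) x) = Q x * fn (J a) x"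
      by eventually_elim simp
    have lb: "L2 (\<lambda>x. norm a * (Q x * fn (J b) x))" using *[OF b(1)] by (intro L2_scale) simp
    have l: "L2 (\<lambda>x. Q x * fn (J a) x)" by (rule L2_AE_cong[OF lb _ ae]) (use Q in simp)
    moreover have "K Q a = norm a *\<^sub>R K Q b"
      unfolding K_def using FC_cong_AE[OF ae lb l] FC_scale[of "\<lambda>x. Q x * fn (J b) x" "norm a"] *[OF b(1)] by simp
    then have "norm (K Q a) \<le> D * norm a" using mult_left_mono[OF D[OF b(1)] norm_ge_zero[of a]] by (simp add: mult.commute)
    ultimately show ?thesis by blast
  qed
  then show ?thesis using Q by (auto simp: mbdd_def K_def)
qed

section \<open>A critical Sobolev estimate\<close>

text \<open>By Cauchy-Schwarz this bounds the squared sup norm of the frequencies up to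
  \<open>2 ^ j\<close> of an H1 function from the unit ball (\<open>psum_J_le\<close>).\<close>

definition Esum :: "'d::finite itself \<Rightarrow> nat \<Rightarrow> real" where
  "Esum _ j = (\<Sum>k\<in>(kball (2 ^ j) :: (int^'d) set). 1 / (om k)\<^sup>2)"

lemma card_kball_le:
  assumes "n \<ge> 1"
  shows "card (kball n :: (int^'d::finite) set) \<le> (3 * n) ^ CARD('d)"
proof -
  have "card (kball n :: (int^'d) set) \<le> card {k::int^'d. \<forall>i. k $ i \<in> {- int n .. int n}}"
    by (rule card_mono[OF card_int_box(1) kball_subset_box])
  also have "\<dots> = (2 * n + 1) ^ CARD('d)" by (rule card_int_box(2))
  also have "\<dots> \<le> (3 * n) ^ CARD('d)" using assms by (intro power_mono) auto
  finally show ?thesis .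
qed

text \<open>In the shell between the radii \<open>2 ^ j\<close> and \<open>2 ^ Suc j\<close> each
  term is at most \<open>1 / 4 ^ j\<close>, and the shell has at most
  \<open>(3 * 2 ^ Suc j) ^ d\<close> points in dimension d.\<close>

lemma Esum_Suc:
  "Esum TYPE('d::finite) (Suc j) \<le> Esum TYPE('d) j + 6 ^ CARD('d) * (2 ^ CARD('d) / 4) ^ j"
proof -
  let ?A = "kball (2 ^ j) :: (int^'d) set" and ?B = "kball (2 ^ Suc j) :: (int^'d) set"
  have sub: "?A \<subseteq> ?B" by (rule kball_mono) simp
  have "Esum TYPE('d) (Suc j) = Esum TYPE('d) j + (\<Sum>k\<in>?B - ?A. 1 / (om k)\<^sup>2)"
    unfolding Esum_def using sum.subset_diff[OF sub finite_kball, of "\<lambda>k. 1 / (om k)\<^sup>2"] by simp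
  also have "(\<Sum>k\<in>?B - ?A. 1 / (om k)\<^sup>2) \<le> (\<Sum>k\<in>?B - ?A. 1 / 4 ^ j)"
  proof (rule sum_mono)
    fix k assume "k \<in> ?B - ?A"
    then have "((2::real) ^ j)\<^sup>2 \<le> ksq k" by (simp add: kball_def)
    moreover have "((2::real) ^ j)\<^sup>2 = 4 ^ j" by (simp add: power2_eq_square power_mult_distrib[symmetric])
    ultimately show "1 / (om k)\<^sup>2 \<le> 1 / 4 ^ j" unfolding om_sq by (intro divide_left_mono) (auto simp: add_pos_nonneg ksq_nonneg intro!: mult_pos_pos)
  qed
  also have "\<dots> = card (?B - ?A) * (1 / 4 ^ j)" by simp
  also have "real (card (?B - ?A)) \<le> real ((3 * 2 ^ Suc j) ^ CARD('d))"
    by (rule of_nat_mono, rule order_trans[OF card_mono[of ?B "?B - ?A"] card_kball_le]) auto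
  also have "real ((3 * 2 ^ Suc j) ^ CARD('d)) * (1 / 4 ^ j) = 6 ^ CARD('d) * (2 ^ CARD('d) / 4) ^ j"
    by (simp add: power_mult_distrib power_divide power_mult[symmetric] mult.commute[of j] del: power_mult_distrib[symmetric])
  finally show ?thesis by (simp add: divide_right_mono)
qed

text \<open>From j to j + 1 the bound \<open>D * q ^ j\<close> grows by
  \<open>D * (q - 1) * q ^ j\<close>, and D is chosen so large that this covers the new
  shell.\<close>

lemma Esum_bound:
  assumes q: "q > 1" "2 ^ CARD('d) \<le> 4 * q"
  shows "\<exists>D>0. \<forall>j. Esum TYPE('d::finite) j \<le> D * q ^ j"
proof -
  define D where "D = \<bar>Esum TYPE('d) 0\<bar> + 6 ^ CARD('d) / (q - 1) + 1"
  have D: "D > 0" unfolding D_def using q by (intro add_nonneg_pos add_nonneg_nonneg) auto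
  have D1: "6 ^ CARD('d) \<le> D * (q - 1)"
  proof -
    have "6 ^ CARD('d) = 6 ^ CARD('d) / (q - 1) * (q - 1)" using q by simp
    also have "\<dots> \<le> D * (q - 1)" unfolding D_def using q by (intro mult_right_mono) auto
    finally show ?thesis .
  qed
  have "Esum TYPE('d) j \<le> D * q ^ j" for j
  proof (induction j)
    case 0
    have "0 \<le> 6 ^ CARD('d) / (q - 1)" using q by simp
    then show ?case unfolding D_def by simp
  next
    case (Suc j)
    have "Esum TYPE('d) (Suc j) \<le> D * q ^ j + 6 ^ CARD('d) * (2 ^ CARD('d) / 4) ^ j"
      using Esum_Suc[of j, where 'd='d] Suc by linarith
    also have "6 ^ CARD('d) * (2 ^ CARD('d) / 4) ^ j \<le> D * (q - 1) * q ^ j"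
      using D1 q D by (intro mult_mono power_mono) auto
    finally show ?case by (simp add: algebra_simps)
  qed
  then show ?thesis using D by blast
qed

lemma Esum_bound_1:
  assumes "CARD('d::finite) = 1"
  shows "\<exists>D>0. \<forall>j. Esum TYPE('d) j \<le> D"
proof -
  define D where "D = \<bar>Esum TYPE('d) 0\<bar> + 12 + 1"
  \<comment> \<open>The induction must retain the tail of the geometric series: the increments
    \<open>6 * (1/2) ^ i\<close> with i at least j sum up to \<open>12 * (1/2) ^ j\<close>.\<close>
  have "Esum TYPE('d) j \<le> D - 12 * (1/2) ^ j" for j
  proof (induction j)
    case (Suc j)
    have "Esum TYPE('d) (Suc j) \<le> Esum TYPE('d) j + 6 * (1/2) ^ j"
      using Esum_Suc[of j, where 'd='d] assms by simp
    with Suc show ?case by simp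
  qed (simp add: D_def)
  moreover have "D - 12 * (1/2) ^ j \<le> D" for j by simp
  ultimately have "\<forall>j. Esum TYPE('d) j \<le> D" by (meson order_trans)
  then show ?thesis unfolding D_def by (intro exI[of _ D]) (auto simp: D_def)
qed

lemma psum_J_le:
  fixes a :: "'d::finite hs"
  assumes "norm a \<le> 1"
  shows "(psum (2 ^ j) (J a) x)\<^sup>2 \<le> Esum TYPE('d) j"
proof -
  have "\<bar>psum (2 ^ j) (J a) x\<bar> \<le> (\<Sum>k\<in>kball (2 ^ j). cmod (hc a k) * (1 / om k))"
    using psum_bounded[of "2 ^ j" "J a" x] by (simp add: hc_J abs_of_pos[OF om_pos] divide_inverse mult.commute)
  then have "(psum (2 ^ j) (J a) x)\<^sup>2 \<le> (\<Sum>k\<in>kball (2 ^ j). cmod (hc a k) * (1 / om k))\<^sup>2"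
    by (metis abs_ge_zero power2_abs power_mono)
  also have "\<dots> \<le> (\<Sum>k\<in>kball (2 ^ j). (cmod (hc a k))\<^sup>2) * (\<Sum>k\<in>(kball (2 ^ j) :: (int^'d) set). (1 / om k)\<^sup>2)"
    by (rule Cauchy_Schwarz_ineq_sum)
  also have "\<dots> \<le> 1 * (\<Sum>k\<in>(kball (2 ^ j) :: (int^'d) set). (1 / om k)\<^sup>2)"
  proof (intro mult_right_mono sum_nonneg)
    have "(\<Sum>k\<in>kball (2 ^ j). (cmod (hc a k))\<^sup>2) \<le> (norm a)\<^sup>2" by (rule sum_le_norm_hs) simp
    also have "\<dots> \<le> 1" using assms by (simp add: power_le_one)
    finally show "(\<Sum>k\<in>kball (2 ^ j). (cmod (hc a k))\<^sup>2) \<le> 1" .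
  qed simp
  finally show ?thesis by (simp add: Esum_def power_divide)
qed

text \<open>The powers below s form an initial segment, and a geometric sum with ratio 4 is at most
  4/3 of its last term.\<close>

lemma geometric_below:
  fixes s :: real
  assumes "s \<ge> 0"
  shows "(\<Sum>j<n. if (4::real) ^ j < s then (4::real) ^ j else 0) \<le> 4/3 * s"
proof -
  have *: "(\<Sum>j<n. (4::real) ^ j) \<le> 4 ^ n / 3" for n
    by (induction n) auto
  show ?thesis
  proof (induction n)
    case (Suc n)
    show ?case
    proof (cases "4 ^ n < s")
      case True
      have "(\<Sum>j<Suc n. if (4::real) ^ j < s then (4::real) ^ j else 0) \<le> (\<Sum>j<Suc n. (4::real) ^ j)"
        by (intro sum_mono) auto
      also have "\<dots> \<le> 4 ^ Suc n / 3" by (rule *)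
      also have "\<dots> \<le> 4/3 * s" using True by simp
      finally show ?thesis .
    qed (use Suc in simp)
  qed (use assms in simp)
qed

text \<open>The mode k occurs in the tails with \<open>4 ^ j < ksq k\<close>, hence with total
  weight at most \<open>4/3 * ksq k\<close>, which the factor \<open>1 / om k\<close> in
  \<open>J\<close> absorbs. Controlling the whole sum, rather than each tail, is what makes the
  critical exponent accessible.\<close>

lemma tail_sum:
  fixes a :: "'d::finite hs"
  shows "(\<Sum>j<n. 4 ^ j * (norm (J a - FC (psum (2 ^ j) (J a))))\<^sup>2) \<le> 4/3 * (norm a)\<^sup>2"
proof -
  define c where "c j k = (if (4::real) ^ j < ksq k then (4::real) ^ j else 0)" for j and k :: "int^'d"
  define T where "T j = J a - FC (psum (2 ^ j) (J a))" for j
  have sq4: "((2::real) ^ j)\<^sup>2 = 4 ^ j" for j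
    by (simp add: power2_eq_square power_mult_distrib[symmetric])
  have T: "4 ^ j * (cmod (hc (T j) k))\<^sup>2 = c j k * (cmod (hc (J a) k))\<^sup>2" for j k
    unfolding T_def c_def by (simp add: hc_FC L2_psum fc_psum kball_def sq4)
  have hs: "((\<lambda>k. \<Sum>j<n. c j k * (cmod (hc (J a) k))\<^sup>2) has_sum (\<Sum>j<n. 4 ^ j * (norm (T j))\<^sup>2)) UNIV" for n
  proof (induction n)
    case (Suc n)
    have "((\<lambda>k. 4 ^ n * (cmod (hc (T n) k))\<^sup>2) has_sum (4 ^ n * (norm (T n))\<^sup>2)) UNIV"
      unfolding norm_hs_sq by (intro has_sum_cmult_right has_sum_infsum hc_summable)
    with Suc show ?case unfolding T by (simp add: has_sum_add)
  qed simp
  have "((\<lambda>k. 4/3 * (cmod (hc a k))\<^sup>2) has_sum (4/3 * (norm a)\<^sup>2)) UNIV"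
    unfolding norm_hs_sq by (intro has_sum_cmult_right has_sum_infsum hc_summable)
  from hs[of n] this have "(\<Sum>j<n. 4 ^ j * (norm (T j))\<^sup>2) \<le> 4/3 * (norm a)\<^sup>2"
  proof (rule has_sum_mono)
    fix k :: "int^'d"
    have J: "(om k)\<^sup>2 * (cmod (hc (J a) k))\<^sup>2 = (cmod (hc a k))\<^sup>2"
      using om_pos[of k] by (simp add: hc_J power_mult_distrib field_simps)
    have "(\<Sum>j<n. c j k) \<le> 4/3 * (om k)\<^sup>2"
      using geometric_below[OF ksq_nonneg[of k], of n] unfolding c_def om_sq by simp
    then have "(\<Sum>j<n. c j k) * (cmod (hc (J a) k))\<^sup>2 \<le> 4/3 * (om k)\<^sup>2 * (cmod (hc (J a) k))\<^sup>2"
      by (rule mult_right_mono) simp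
    then show "(\<Sum>j<n. c j k * (cmod (hc (J a) k))\<^sup>2) \<le> 4/3 * (cmod (hc a k))\<^sup>2"
      unfolding sum_distrib_right[symmetric] J[symmetric] by (simp only: mult.assoc)
  qed
  then show ?thesis unfolding T_def .
qed

text \<open>Both factors are powers of the larger of the two right-hand terms, and the exponents
  2/\<rho> and 2/p add up to 1.\<close>

lemma powr_split:
  fixes v h \<rho> p :: real
  assumes "\<rho> > 0" "p > 0" "2 / \<rho> + 2 / p = 1" "h \<ge> 0"
  shows "(v * h)\<^sup>2 \<le> \<bar>v\<bar> powr \<rho> + h powr p"
proof (cases "v = 0 \<or> h = 0")
  case True
  then show ?thesis by auto
next
  case False
  then have pos: "\<bar>v\<bar> > 0" "h > 0" using assms by auto
  define u w m where "u = \<bar>v\<bar> powr \<rho>" and "w = h powr p" and "m = max u w"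
  have uw: "u > 0" "w > 0" "m > 0" using pos by (auto simp: u_def w_def m_def less_max_iff_disj)
  have v: "\<bar>v\<bar>\<^sup>2 = u powr (2 / \<rho>)" unfolding u_def using pos assms by (simp add: powr_powr)
  have h: "h\<^sup>2 = w powr (2 / p)" unfolding w_def using pos assms by (simp add: powr_powr)
  have "(v * h)\<^sup>2 = u powr (2 / \<rho>) * w powr (2 / p)"
    using v h by (simp add: power_mult_distrib)
  also have "\<dots> \<le> m powr (2 / \<rho>) * m powr (2 / p)"
    using uw assms by (intro mult_mono powr_mono2) (auto simp: m_def)
  also have "\<dots> = m" using assms uw by (simp add: powr_add[symmetric])
  also have "m \<le> u + w" using uw by (auto simp: m_def)
  finally show ?thesis by (simp add: u_def w_def)
qed

lemma tm_integrable_bounded: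
  assumes "g \<in> borel_measurable tm" "\<And>x. \<bar>g x\<bar> \<le> (B::real)"
  shows "integrable tm g"
  by (rule Bochner_Integration.integrable_bound[OF finite_measure.integrable_const[OF finite_measure_tm, of B]])
     (use assms order_trans[OF assms(2) abs_ge_self] in auto)

text \<open>The embedding of H1 into Lp, with p the Hoelder partner of \<rho>, is proved by levels.
  At height \<open>L j\<close> the frequencies up to \<open>2 ^ j\<close> account for at most half
  of the value, so by Chebyshev the set where f exceeds \<open>L j\<close> is charged to the tail
  beyond \<open>2 ^ j\<close>. Summing over the levels leads to \<open>tail_sum\<close>.\<close>

lemma sobolev_mult:
  fixes V :: "real^'d::finite \<Rightarrow> real"
  assumes \<rho>: "\<rho> > 2" "real CARD('d) \<le> \<rho>" and V: "Lp \<rho> V"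
  shows "\<exists>D. mbdd V D"
proof -
  let ?v = "vol TYPE('d)"
  have Vm[measurable]: "V \<in> borel_measurable tm" and Vi: "integrable tm (\<lambda>x. \<bar>V x\<bar> powr \<rho>)"
    using V by (auto simp: Lp_def)
  \<comment> \<open>The sup norm of the frequencies up to \<open>2 ^ j\<close> grows at most like
    \<open>b ^ j\<close>; \<rho> > 2 ensures b > 1, also in dimension two. The exponent p is 2
    \<rho> / (\<rho> - 2), and \<open>b powr p = 4 * b\<^sup>2\<close> makes the p-th powers of the
    levels, divided by their squares, grow exactly like the weights \<open>4 ^ j\<close> of
    \<open>tail_sum\<close>.\<close>
  define \<theta> where "\<theta> = (\<rho> - 2) / 2"
  define b where "b = 2 powr \<theta>"
  define p where "p = 2 + 2 / \<theta>"
  have \<theta>: "\<theta> > 0" using \<rho> by (simp add: \<theta>_def)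
  have b: "b > 1" unfolding b_def using \<theta> by simp
  have p2: "p > 2" unfolding p_def using \<theta> by simp
  have hoelder: "2 / \<rho> + 2 / p = 1" unfolding p_def \<theta>_def using \<rho> by (simp add: field_simps)
  have bp: "b powr p = 4 * b\<^sup>2"
  proof -
    have "\<theta> * p = 2 * \<theta> + 2" unfolding p_def using \<theta> by (simp add: field_simps)
    then have "b powr p = 2 powr (2 * \<theta> + 2)" unfolding b_def powr_powr by simp
    also have "\<dots> = 2 powr (2 * \<theta>) * 4" by (simp add: powr_add)
    also have "2 powr (2 * \<theta>) = b\<^sup>2" unfolding b_def by (simp add: powr_realpow[symmetric] powr_powr mult.commute)
    finally show ?thesis by simp
  qed
  have "(2::real) ^ CARD('d) \<le> 4 * b\<^sup>2"
  proof -
    have "(2::real) ^ CARD('d) = 2 powr real CARD('d)" by (simp add: powr_realpow)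
    also have "\<dots> \<le> 2 powr \<rho>" using \<rho> by (intro powr_mono) auto
    also have "\<rho> = 2 * \<theta> + 2" by (simp add: \<theta>_def field_simps)
    also have "2 powr (2 * \<theta> + 2) = 4 * b\<^sup>2" unfolding b_def by (simp add: powr_add powr_realpow[symmetric] powr_powr mult.commute)
    finally show ?thesis .
  qed
  moreover have "b\<^sup>2 > 1" using b by (simp add: one_less_power)
  ultimately obtain D2 where D2: "D2 > 0" "\<And>j. Esum TYPE('d) j \<le> D2 * (b\<^sup>2) ^ j"
    using Esum_bound[of "b\<^sup>2", where 'd='d] by blast
  define D where "D = sqrt D2"
  have D: "D > 0" "D\<^sup>2 = D2" using D2 by (auto simp: D_def)
  \<comment> \<open>Twice the bound for the low frequencies, so that a value above the level leaves
    at least half of it to the tail.\<close>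
  define L where "L j = 2 * D * b ^ j" for j :: nat
  have L: "L j > 0" for j using D b by (simp add: L_def)
  have Lp: "(L (Suc j)) powr p / (L j)\<^sup>2 = (2 * D) powr p / (2 * D)\<^sup>2 * (4 * b\<^sup>2) * 4 ^ j" for j
  proof -
    have bn: "(b ^ n) powr p = (4 * b\<^sup>2) ^ n" for n
      using b by (induction n) (auto simp: powr_mult bp)
    have "(L (Suc j)) powr p = (2 * D) powr p * (4 * b\<^sup>2) ^ Suc j"
      unfolding L_def bn[symmetric] by (rule powr_mult)
    then show ?thesis using b D unfolding L_def
      by (simp add: power_mult_distrib power_mult[symmetric] mult.commute[of j])
  qed
  define W where "W = (2 * D) powr p / (2 * D)\<^sup>2 * (4 * b\<^sup>2)"
  define m where "m = measure tm (space (tm :: (real^'d) measure))"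
  define C1 where "C1 = (L 0) powr p * m + 4 * W * ?v * (4/3)"
  define C where "C = (LINT x|tm. \<bar>V x\<bar> powr \<rho>) + C1"
  have W: "W \<ge> 0" unfolding W_def by simp
  show ?thesis
  proof (rule mbdd_of_unit_ball[OF Vm, of C])
    fix a :: "'d hs" assume a: "norm a \<le> 1"
    define f where "f = fn (J a)"
    have f[measurable]: "f \<in> borel_measurable tm" unfolding f_def by (rule fn_meas)
    have fL: "L2 f" by (simp add: f_def)
    define I where "I j = (LINT x|tm. (if L j < \<bar>f x\<bar> then 1 else (0 :: real)))" for j
    have ii: "integrable tm (\<lambda>x. if L j < \<bar>f x\<bar> then 1 else (0 :: real))" for j
      by (rule tm_integrable_bounded[of _ 1]) auto
    have I: "I j \<le> 4 / (L j)\<^sup>2 * (?v * (norm (J a - FC (psum (2 ^ j) (J a))))\<^sup>2)" for j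
    proof -
      let ?g = "psum (2 ^ j) (J a)"
      have gl: "\<bar>?g x\<bar> \<le> L j / 2" for x
      proof -
        have "(?g x)\<^sup>2 \<le> D2 * (b\<^sup>2) ^ j" using psum_J_le[OF a] D2(2) order_trans by blast
        also have "\<dots> = (L j / 2)\<^sup>2" unfolding L_def D(2)[symmetric]
          by (simp add: power_mult_distrib power_mult[symmetric] mult.commute[of j])
        finally show ?thesis using L[of j] by (simp add: power2_le_iff_abs_le)
      qed
      have "I j \<le> (LINT x|tm. 4 / (L j)\<^sup>2 * (f x - ?g x)\<^sup>2)"
        unfolding I_def
      proof (rule integral_mono[OF ii])
        show "integrable tm (\<lambda>x. 4 / (L j)\<^sup>2 * (f x - ?g x)\<^sup>2)"
          by (intro integrable_mult_right L2_sq_integrable L2_diff fL L2_psum)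
        fix x
        show "(if L j < \<bar>f x\<bar> then 1 else 0) \<le> 4 / (L j)\<^sup>2 * (f x - ?g x)\<^sup>2"
        proof (cases "L j < \<bar>f x\<bar>")
          case True
          then have "L j / 2 \<le> \<bar>f x - ?g x\<bar>" using gl[of x] by linarith
          then have "(L j / 2)\<^sup>2 \<le> (f x - ?g x)\<^sup>2" using L[of j] by (metis abs_le_square_iff abs_of_pos half_gt_zero power2_abs)
          then have "1 \<le> 4 / (L j)\<^sup>2 * (f x - ?g x)\<^sup>2" using L[of j] by (simp add: field_simps power_divide)
          then show ?thesis using True by simp
        qed simp
      qed
      also have "\<dots> = 4 / (L j)\<^sup>2 * nsq (\<lambda>x. f x - ?g x)" by simp
      also have "nsq (\<lambda>x. f x - ?g x) = ?v * (norm (J a - FC ?g))\<^sup>2"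
        using norm_FC[OF L2_diff[OF fL L2_psum], of "2 ^ j" "J a"] FC_diff[OF fL L2_psum, of "2 ^ j" "J a"]
        by (simp add: f_def)
      finally show ?thesis .
    qed
    \<comment> \<open>Truncation guarantees integrability before any bound on f is known. The p-th
      power of the truncated function is then bounded by a sum over the levels exceeded, and Fatou
      removes the truncation at the end.\<close>
    define h where "h n x = min \<bar>f x\<bar> (L n)" for n x
    have h0: "0 \<le> h n x" for n x using L[of n] by (simp add: h_def)
    have [measurable]: "h n \<in> borel_measurable tm" for n unfolding h_def by measurable
    have hp: "h n x powr p \<le> (L 0) powr p + (\<Sum>j<n. (L (Suc j)) powr p * (if L j < \<bar>f x\<bar> then 1 else 0))" for n x
    proof (induction n)
      case 0
      show ?case using h0[of 0 x] p2 by (auto intro!: powr_mono2 simp: h_def)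
    next
      case (Suc n)
      show ?case
      proof (cases "L n < \<bar>f x\<bar>")
        case True
        have "h (Suc n) x powr p \<le> (L (Suc n)) powr p" using h0[of "Suc n" x] p2 by (intro powr_mono2) (auto simp: h_def)
        moreover have "0 \<le> (\<Sum>j<n. (L (Suc j)) powr p * (if L j < \<bar>f x\<bar> then 1 else 0))" by (intro sum_nonneg) simp
        moreover have "0 \<le> (L 0) powr p" by simp
        ultimately show ?thesis
          by (simp only: sum.lessThan_Suc True if_True mult_1_right)
      next
        case False
        have "L n \<le> L (Suc n)" using b D by (simp add: L_def)
        then have "h (Suc n) x = h n x" using False by (simp add: h_def)
        with Suc False show ?thesis by simp
      qed
    qed
    have hb: "h n x powr p \<le> L n powr p" for n x using h0[of n x] p2 by (intro powr_mono2) (auto simp: h_def)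
    have hpi: "integrable tm (\<lambda>x. h n x powr p)" for n
      by (rule tm_integrable_bounded[of _ "L n powr p"]) (use hb in auto)
    have hI: "(LINT x|tm. h n x powr p) \<le> C1" for n
    proof -
      have "(LINT x|tm. h n x powr p) \<le> (LINT x|tm. (L 0) powr p + (\<Sum>j<n. (L (Suc j)) powr p * (if L j < \<bar>f x\<bar> then 1 else 0)))"
        by (rule integral_mono[OF hpi _ hp])
           (intro Bochner_Integration.integrable_add Bochner_Integration.integrable_sum integrable_mult_right ii
              finite_measure.integrable_const[OF finite_measure_tm])
      also have "\<dots> = (L 0) powr p * m + (\<Sum>j<n. (L (Suc j)) powr p * I j)"
        unfolding I_def m_def
        by (subst Bochner_Integration.integral_add, intro finite_measure.integrable_const[OF finite_measure_tm],
            intro Bochner_Integration.integrable_sum integrable_mult_right ii)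
           (simp add: Bochner_Integration.integral_sum ii mult.commute)
      also have "(\<Sum>j<n. (L (Suc j)) powr p * I j)
          \<le> (\<Sum>j<n. 4 * W * ?v * (4 ^ j * (norm (J a - FC (psum (2 ^ j) (J a))))\<^sup>2))"
      proof (rule sum_mono)
        fix j
        have "(L (Suc j)) powr p * I j \<le> (L (Suc j)) powr p * (4 / (L j)\<^sup>2 * (?v * (norm (J a - FC (psum (2 ^ j) (J a))))\<^sup>2))"
          by (intro mult_left_mono I) simp
        also have "\<dots> = 4 * ((L (Suc j)) powr p / (L j)\<^sup>2) * ?v * (norm (J a - FC (psum (2 ^ j) (J a))))\<^sup>2"
          by (simp only: times_divide_eq_right times_divide_eq_left mult_ac)
        also have "\<dots> = 4 * W * ?v * (4 ^ j * (norm (J a - FC (psum (2 ^ j) (J a))))\<^sup>2)"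
          unfolding Lp W_def by (simp only: mult_ac)
        finally show "(L (Suc j)) powr p * I j \<le> 4 * W * ?v * (4 ^ j * (norm (J a - FC (psum (2 ^ j) (J a))))\<^sup>2)" .
      qed
      also have "\<dots> \<le> 4 * W * ?v * (4/3 * (norm a)\<^sup>2)"
        unfolding sum_distrib_left[symmetric] using W by (intro mult_left_mono tail_sum) auto
      also have "\<dots> \<le> 4 * W * ?v * (4/3)"
        using W a by (intro mult_left_mono) (auto simp: power_le_one)
      finally show ?thesis unfolding C1_def by simp
    qed
    have split: "(V x * h n x)\<^sup>2 \<le> \<bar>V x\<bar> powr \<rho> + h n x powr p" for n x
      by (rule powr_split[OF _ _ hoelder h0]) (use \<rho> p2 in auto)
    have i1: "integrable tm (\<lambda>x. (V x * h n x)\<^sup>2)" for n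
      by (rule Bochner_Integration.integrable_bound[OF Bochner_Integration.integrable_add[OF Vi hpi[of n]]])
         (use split[of _ n] in auto)
    have i2: "(LINT x|tm. (V x * h n x)\<^sup>2) \<le> C" for n
    proof -
      have "(LINT x|tm. (V x * h n x)\<^sup>2) \<le> (LINT x|tm. \<bar>V x\<bar> powr \<rho> + h n x powr p)"
        by (rule integral_mono[OF i1 _ split]) (intro Bochner_Integration.integrable_add Vi hpi)
      also have "\<dots> = (LINT x|tm. \<bar>V x\<bar> powr \<rho>) + (LINT x|tm. h n x powr p)"
        by (intro Bochner_Integration.integral_add Vi hpi)
      also have "\<dots> \<le> C" unfolding C_def using hI[of n] by simp
      finally show ?thesis .
    qed
    have "integrable tm (\<lambda>x. (V x * f x)\<^sup>2) \<and> (LINT x|tm. (V x * f x)\<^sup>2) \<le> C"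
    proof (rule integrable_fatou[OF i1])
      have "(\<lambda>n. (V x * h n x)\<^sup>2) \<longlonglongrightarrow> (V x * f x)\<^sup>2" for x
      proof (rule tendsto_eventually)
        obtain n0 where n0: "\<bar>f x\<bar> / (2 * D) < b ^ n0" using real_arch_pow[OF b] by blast
        have "\<bar>f x\<bar> \<le> L n" if "n \<ge> n0" for n
        proof -
          have "\<bar>f x\<bar> / (2 * D) \<le> b ^ n" using n0 power_increasing[OF that less_imp_le[OF b]] by linarith
          then show ?thesis using D(1) unfolding L_def by (simp add: field_simps)
        qed
        then have "\<forall>\<^sub>F n in sequentially. \<bar>f x\<bar> \<le> L n" unfolding eventually_sequentially by blast
        then show "\<forall>\<^sub>F n in sequentially. (V x * h n x)\<^sup>2 = (V x * f x)\<^sup>2"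
          by eventually_elim (simp add: h_def min_def power_mult_distrib)
      qed
      then show "AE x in tm. (\<lambda>n. (V x * h n x)\<^sup>2) \<longlonglongrightarrow> (V x * f x)\<^sup>2" by simp
    qed (use i2 in auto)
    then show "L2 (\<lambda>x. V x * fn (J a) x) \<and> nsq (\<lambda>x. V x * fn (J a) x) \<le> C"
      unfolding f_def by (simp add: L2_def)
  qed
qed

text \<open>In dimension one the partial sums of \<open>J a\<close> are bounded by a common B. The
  excess e of the absolute value of f over B is dominated by every tail, hence vanishes: f is
  bounded, and a square-integrable potential suffices.\<close>

lemma sobolev_mult_1:
  fixes V :: "real^'d::finite \<Rightarrow> real"
  assumes d: "CARD('d) = 1" and V: "Lp 2 V"
  shows "\<exists>D. mbdd V D"
proof -
  have Vm[measurable]: "V \<in> borel_measurable tm" and Vi: "integrable tm (\<lambda>x. (V x)\<^sup>2)"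
    using V by (auto simp: Lp_def)
  obtain D2 where D2: "D2 > 0" "\<And>j. Esum TYPE('d) j \<le> D2" using Esum_bound_1[OF d] by blast
  define B where "B = sqrt D2"
  have B: "B > 0" "B\<^sup>2 = D2" using D2 by (auto simp: B_def)
  show ?thesis
  proof (rule mbdd_of_unit_ball[OF Vm, of "B\<^sup>2 * (LINT x|tm. (V x)\<^sup>2)"])
    fix a :: "'d hs" assume a: "norm a \<le> 1"
    define f where "f = fn (J a)"
    have f[measurable]: "f \<in> borel_measurable tm" unfolding f_def by (rule fn_meas)
    have fL: "L2 f" by (simp add: f_def)
    define e where "e x = max 0 (\<bar>f x\<bar> - B)" for x
    have em[measurable]: "e \<in> borel_measurable tm" unfolding e_def by measurable
    have eL: "L2 e" by (rule L2_dominated[OF fL em, of 1]) (use B in \<open>auto simp: e_def\<close>)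
    have le: "nsq e \<le> vol TYPE('d) * (norm (J a - FC (psum (2 ^ j) (J a))))\<^sup>2" for j
    proof -
      let ?g = "psum (2 ^ j) (J a)"
      have gl: "\<bar>?g x\<bar> \<le> B" for x
      proof -
        have "(?g x)\<^sup>2 \<le> B\<^sup>2" using order_trans[OF psum_J_le[OF a] D2(2)] B(2) by simp
        then show ?thesis by (rule power2_le_iff_abs_le[THEN iffD1, rotated]) (use B in simp)
      qed
      have "nsq e \<le> nsq (\<lambda>x. f x - ?g x)"
      proof (rule integral_mono)
        fix x
        have "\<bar>e x\<bar> \<le> \<bar>f x - ?g x\<bar>" using gl[of x] unfolding e_def by linarith
        then show "(e x)\<^sup>2 \<le> (f x - ?g x)\<^sup>2" by (simp add: abs_le_square_iff)
      qed (intro L2_sq_integrable L2_diff fL L2_psum eL)+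
      also have "\<dots> = vol TYPE('d) * (norm (J a - FC ?g))\<^sup>2"
        using norm_FC[OF L2_diff[OF fL L2_psum], of "2 ^ j" "J a"] FC_diff[OF fL L2_psum, of "2 ^ j" "J a"]
        by (simp add: f_def)
      finally show ?thesis .
    qed
    have "filterlim (\<lambda>j::nat. (2::nat) ^ j) at_top sequentially"
      by (rule filterlim_subseq) (simp add: strict_mono_def)
    then have "(\<lambda>j. FC (psum (2 ^ j) (J a))) \<longlonglongrightarrow> J a"
      by (rule filterlim_compose[OF psum_converges])
    then have "(\<lambda>j. vol TYPE('d) * (norm (J a - FC (psum (2 ^ j) (J a))))\<^sup>2) \<longlonglongrightarrow> vol TYPE('d) * (norm (J a - J a))\<^sup>2"
      by (intro tendsto_intros)
    then have "nsq e \<le> vol TYPE('d) * (norm (J a - J a))\<^sup>2"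
      by (rule LIMSEQ_le_const) (use le in auto)
    moreover have "0 \<le> nsq e" by (rule Bochner_Integration.integral_nonneg) simp
    ultimately have "nsq e = 0" by simp
    from nsq_eq_0[OF eL this] have fB: "AE x in tm. \<bar>f x\<bar> \<le> B" by eventually_elim (simp add: e_def)
    then have ae: "AE x in tm. (V x * f x)\<^sup>2 \<le> B\<^sup>2 * (V x)\<^sup>2"
    proof eventually_elim
      case (elim x)
      then have "(f x)\<^sup>2 \<le> B\<^sup>2" using B(1) by (simp add: power2_le_iff_abs_le)
      then have "(V x)\<^sup>2 * (f x)\<^sup>2 \<le> (V x)\<^sup>2 * B\<^sup>2" by (rule mult_left_mono) simp
      then show ?case by (simp only: power_mult_distrib mult.commute)
    qed
    have i0: "integrable tm (\<lambda>x. B\<^sup>2 * (V x)\<^sup>2)" using Vi by simp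
    have i: "integrable tm (\<lambda>x. (V x * f x)\<^sup>2)"
      by (rule Bochner_Integration.integrable_bound[OF i0]) (use ae in auto)
    have "(LINT x|tm. (V x * f x)\<^sup>2) \<le> (LINT x|tm. B\<^sup>2 * (V x)\<^sup>2)"
      by (rule integral_mono_AE[OF i i0 ae])
    then show "L2 (\<lambda>x. V x * fn (J a) x) \<and> nsq (\<lambda>x. V x * fn (J a) x) \<le> B\<^sup>2 * (LINT x|tm. (V x)\<^sup>2)"
      using i unfolding f_def by (simp add: L2_def)
  qed
qed

lemma potential_mbdd:
  fixes V :: "real^'d::finite \<Rightarrow> real"
  assumes rho: "(CARD('d) = 1 \<and> \<rho> = 2) \<or> (CARD('d) = 2 \<and> \<rho> > 2)
                \<or> (CARD('d) \<ge> 3 \<and> \<rho> = real CARD('d))"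
    and V: "Lp \<rho> V"
  shows "\<exists>C. mbdd V C"
  using rho
proof (elim disjE conjE)
  assume "CARD('d) = 1" "\<rho> = 2"
  then show ?thesis using sobolev_mult_1 V by blast
qed (use sobolev_mult[OF _ _ V] in auto)

section \<open>Trigonometric multipliers preserve \<open>H\<^sup>1\<close>\<close>

text \<open>A bound on finite partial sums is the form in which both applications deliver it:
  frequency shifts in \<open>shift_J_preimage\<close> and the summable gradient in
  \<open>H1_imp_J_preimage\<close>.\<close>

lemma exists_J_preimage:
  fixes c :: "'d::finite hs"
  assumes "\<And>F. finite F \<Longrightarrow> (\<Sum>k\<in>F. (om k)\<^sup>2 * (cmod (hc c k))\<^sup>2) \<le> B"
  shows "\<exists>b. c = J b"
proof -
  have h: "hc (Abs_hs (\<lambda>k. om k *\<^sub>R hc c k)) = (\<lambda>k. om k *\<^sub>R hc c k)"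
    by (rule hsI[of _ B]) (use assms in \<open>auto simp: hc_minus_index power_mult_distrib\<close>)
  have "c = J (Abs_hs (\<lambda>k. om k *\<^sub>R hc c k))"
    by (rule hs_eqI) (simp add: hc_J h less_imp_neq[OF om_pos, symmetric])
  then show ?thesis by blast
qed

text \<open>Peetre's inequality: a frequency shift by l changes the H1 weight by at most a factor
  depending on l.\<close>

lemma om_le_shift: "(om k)\<^sup>2 \<le> 2 * (om l)\<^sup>2 * (om (k - l))\<^sup>2"
proof -
  have sq: "(u + w)\<^sup>2 \<le> 2 * u\<^sup>2 + 2 * w\<^sup>2" for u w :: real
    using zero_le_power2[of "u - w"] by (simp add: power2_sum power2_diff)
  then have "(real_of_int (k $ i))\<^sup>2 \<le> 2 * (real_of_int (l $ i))\<^sup>2 + 2 * (real_of_int ((k - l) $ i))\<^sup>2" for i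
    using sq[of "real_of_int (l $ i)" "real_of_int ((k - l) $ i)"] by simp
  then have "ksq k \<le> (\<Sum>i\<in>UNIV. 2 * (real_of_int (l $ i))\<^sup>2 + 2 * (real_of_int ((k - l) $ i))\<^sup>2)"
    unfolding ksq_def by (intro sum_mono)
  also have "\<dots> = 2 * ksq l + 2 * ksq (k - l)" unfolding ksq_def by (simp add: sum.distrib sum_distrib_left)
  finally have "1 + ksq k \<le> 2 * (1 + ksq l) * (1 + ksq (k - l))"
    using mult_nonneg_nonneg[OF ksq_nonneg[of l] ksq_nonneg[of "k - l"]] by (simp add: algebra_simps)
  then show ?thesis by (simp add: om_sq)
qed

lemma shifted_J_sum:
  fixes a :: "'d::finite hs"
  assumes "finite F"
  shows "(\<Sum>k\<in>F. (om k)\<^sup>2 * (cmod (hc (J a) (k - l)))\<^sup>2) \<le> 2 * (om l)\<^sup>2 * (norm a)\<^sup>2"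
proof -
  have "(om k)\<^sup>2 * (cmod (hc (J a) (k - l)))\<^sup>2 \<le> 2 * (om l)\<^sup>2 * (cmod (hc a (k - l)))\<^sup>2" for k
  proof -
    have J: "(om m)\<^sup>2 * (cmod (hc (J a) m))\<^sup>2 = (cmod (hc a m))\<^sup>2" for m
      using om_pos[of m] by (simp add: hc_J power_mult_distrib field_simps)
    have "(om k)\<^sup>2 * (cmod (hc (J a) (k - l)))\<^sup>2 \<le> 2 * (om l)\<^sup>2 * (om (k - l))\<^sup>2 * (cmod (hc (J a) (k - l)))\<^sup>2"
      by (intro mult_right_mono om_le_shift) simp
    then show ?thesis unfolding J[symmetric] by (simp only: mult.assoc)
  qed
  then have "(\<Sum>k\<in>F. (om k)\<^sup>2 * (cmod (hc (J a) (k - l)))\<^sup>2) \<le> (\<Sum>k\<in>F. 2 * (om l)\<^sup>2 * (cmod (hc a (k - l)))\<^sup>2)"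
    by (intro sum_mono)
  also have "\<dots> = 2 * (om l)\<^sup>2 * (\<Sum>k\<in>F. (cmod (hc a (k - l)))\<^sup>2)" by (simp only: sum_distrib_left)
  also have "(\<Sum>k\<in>F. (cmod (hc a (k - l)))\<^sup>2) = (\<Sum>k\<in>(\<lambda>k. k - l) ` F. (cmod (hc a k))\<^sup>2)"
    by (subst sum.reindex) (auto simp: inj_on_def)
  also have "2 * (om l)\<^sup>2 * \<dots> \<le> 2 * (om l)\<^sup>2 * (norm a)\<^sup>2"
    using assms by (intro mult_left_mono sum_le_norm_hs) auto
  finally show ?thesis by simp
qed

text \<open>A sine or cosine multiplier acts on coefficients by combining the shifts by l and -l,
  and each shift preserves H1.\<close>

lemma shift_J_preimage:
  fixes a c :: "'d::finite hs"
  assumes c: "\<And>k. hc c k = \<alpha> * hc (J a) (k - l) + \<beta> * hc (J a) (k + l)" and "cmod \<alpha> \<le> 1" "cmod \<beta> \<le> 1"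
  shows "\<exists>b. c = J b"
proof (rule exists_J_preimage)
  fix F :: "(int^'d) set" assume F: "finite F"
  let ?x = "\<lambda>k. cmod (hc (J a) (k - l))" and ?y = "\<lambda>k. cmod (hc (J a) (k - (- l)))"
  have "(cmod (hc c k))\<^sup>2 \<le> 2 * (?x k)\<^sup>2 + 2 * (?y k)\<^sup>2" for k
  proof -
    have "cmod (hc c k) \<le> cmod \<alpha> * ?x k + cmod \<beta> * ?y k"
      unfolding c using norm_triangle_ineq[of "\<alpha> * hc (J a) (k - l)" "\<beta> * hc (J a) (k + l)"] by (simp add: norm_mult)
    also have "\<dots> \<le> 1 * ?x k + 1 * ?y k" using assms by (intro add_mono mult_right_mono) auto
    finally have "(cmod (hc c k))\<^sup>2 \<le> (?x k + ?y k)\<^sup>2" by (intro power_mono) auto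
    also have "\<dots> \<le> 2 * (?x k)\<^sup>2 + 2 * (?y k)\<^sup>2"
      using zero_le_power2[of "?x k - ?y k"] unfolding power2_sum power2_diff by linarith
    finally show ?thesis .
  qed
  then have "(\<Sum>k\<in>F. (om k)\<^sup>2 * (cmod (hc c k))\<^sup>2) \<le> (\<Sum>k\<in>F. (om k)\<^sup>2 * (2 * (?x k)\<^sup>2 + 2 * (?y k)\<^sup>2))"
    by (intro sum_mono mult_left_mono) auto
  also have "\<dots> = 2 * (\<Sum>k\<in>F. (om k)\<^sup>2 * (?x k)\<^sup>2) + 2 * (\<Sum>k\<in>F. (om k)\<^sup>2 * (?y k)\<^sup>2)"
    by (simp only: distrib_left sum.distrib sum_distrib_left mult.left_commute)
  also have "\<dots> \<le> 2 * (2 * (om l)\<^sup>2 * (norm a)\<^sup>2) + 2 * (2 * (om (- l))\<^sup>2 * (norm a)\<^sup>2)"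
    by (intro add_mono mult_left_mono shifted_J_sum F) auto
  finally show "(\<Sum>k\<in>F. (om k)\<^sup>2 * (cmod (hc c k))\<^sup>2)
      \<le> 2 * (2 * (om l)\<^sup>2 * (norm a)\<^sup>2) + 2 * (2 * (om (- l))\<^sup>2 * (norm a)\<^sup>2)" .
qed

lemma fc_mult_two_modes:
  fixes \<phi> f :: "real^'d::finite \<Rightarrow> real"
  assumes f: "integrable tm f" and \<phi>: "\<And>x. complex_of_real (\<phi> x) = \<alpha> * ek l x + \<beta> * ek (- l) x"
  shows "fc (\<lambda>x. \<phi> x * f x) k = \<alpha> * fc f (k - l) + \<beta> * fc f (k + l)"
proof -
  have e: "ek l x * ek (- k) x = ek (- (k - l)) x" "ek (- l) x * ek (- k) x = ek (- (k + l)) x" for x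
    by (simp_all add: ek_add[symmetric] algebra_simps)
  have "complex_of_real (\<phi> x * f x) * ek (- k) x
      = \<alpha> * (f x * ek (- (k - l)) x) + \<beta> * (f x * ek (- (k + l)) x)" for x
    unfolding e[symmetric] of_real_mult \<phi> by (simp only: algebra_simps)
  then have "(LINT x|tm. complex_of_real (\<phi> x * f x) * ek (- k) x)
     = (LINT x|tm. \<alpha> * (f x * ek (- (k - l)) x) + \<beta> * (f x * ek (- (k + l)) x))" by simp
  also have "\<dots> = \<alpha> * (LINT x|tm. f x * ek (- (k - l)) x) + \<beta> * (LINT x|tm. f x * ek (- (k + l)) x)"
    by (subst Bochner_Integration.integral_add) (intro integrable_mult_right integrable_ek f, intro integrable_mult_right integrable_ek f, simp)
  finally show ?thesis unfolding fc_eq by (simp only: algebra_simps)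
qed

lemma M_add:
  assumes "\<phi> \<in> borel_measurable tm" "\<And>x. \<bar>\<phi> x\<bar> \<le> B" "\<psi> \<in> borel_measurable tm" "\<And>x. \<bar>\<psi> x\<bar> \<le> C"
  shows "M (\<lambda>x. \<phi> x + \<psi> x) a = M \<phi> a + M \<psi> a"
  unfolding M_def distrib_right by (intro FC_add L2_M[OF assms(1,2)] L2_M[OF assms(3,4)])

lemma M_scale:
  assumes "\<phi> \<in> borel_measurable tm" "\<And>x. \<bar>\<phi> x\<bar> \<le> B"
  shows "M (\<lambda>x. c * \<phi> x) a = c *\<^sub>R M \<phi> a"
  unfolding M_def mult.assoc by (intro FC_scale L2_M[OF assms])

text \<open>Needed for the square trick: in \<open>reach_minus_square\<close> the multiplied
  position serves as a velocity that displaces the position, so it has to lie in H1.\<close>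

lemma tp_M_J: "trigpoly \<phi> \<Longrightarrow> \<exists>b. M \<phi> (J a) = J b"
proof (induction rule: trigpoly.induct)
  case (tp_cos l)
  have c: "hc (M (\<lambda>x. cos (kdot l x)) (J a)) k = (1/2) * hc (J a) (k - l) + (1/2) * hc (J a) (k + l)" for k
  proof -
    have "L2 (\<lambda>x. cos (kdot l x) * fn (J a) x)"
      by (rule L2_M[OF tp_tm[OF trigpoly.tp_cos] abs_cos_le_one])
    then show ?thesis unfolding M_def
      using fc_mult_two_modes[OF L2_integrable[OF L2_fn] cos_kdot, of l "J a" k] by (simp add: hc_FC)
  qed
  show ?case by (rule shift_J_preimage[OF c]) auto
next
  case (tp_sin l)
  have c: "hc (M (\<lambda>x. sin (kdot l x)) (J a)) k = (-\<i>/2) * hc (J a) (k - l) + (\<i>/2) * hc (J a) (k + l)" for k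
  proof -
    have "L2 (\<lambda>x. sin (kdot l x) * fn (J a) x)"
      by (rule L2_M[OF tp_tm[OF trigpoly.tp_sin] abs_sin_le_one])
    then show ?thesis unfolding M_def
      using fc_mult_two_modes[OF L2_integrable[OF L2_fn] sin_kdot, of l "J a" k] by (simp add: hc_FC)
  qed
  show ?case by (rule shift_J_preimage[OF c]) (auto simp: norm_divide)
next
  case (tp_add f g)
  from tp_bounded[OF tp_add.hyps(1)] obtain B where B: "\<forall>x. \<bar>f x\<bar> \<le> B" ..
  from tp_bounded[OF tp_add.hyps(2)] obtain C where C: "\<forall>x. \<bar>g x\<bar> \<le> C" ..
  note BC = B[rule_format] C[rule_format]
  from tp_add.IH(1) obtain b where "M f (J a) = J b" ..
  moreover from tp_add.IH(2) obtain c where "M g (J a) = J c" ..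
  ultimately have "M (\<lambda>x. f x + g x) (J a) = J (b + c)"
    using M_add[OF tp_tm[OF tp_add.hyps(1)] BC(1) tp_tm[OF tp_add.hyps(2)] BC(2)] by (simp add: J_add)
  then show ?case by blast
next
  case (tp_scale f r)
  from tp_bounded[OF tp_scale.hyps] obtain B where B: "\<forall>x. \<bar>f x\<bar> \<le> B" ..
  from tp_scale.IH obtain b where "M f (J a) = J b" ..
  then have "M (\<lambda>x. r * f x) (J a) = J (r *\<^sub>R b)"
    using M_scale[OF tp_tm[OF tp_scale.hyps] B[rule_format]] by (simp add: J_scale)
  then show ?case by blast
qed

section \<open>The free wave group\<close>

definition Ct :: "real \<Rightarrow> 'd::finite hs \<Rightarrow> 'd hs" where "Ct t = dg (\<lambda>x. cos (x * t))"
definition St :: "real \<Rightarrow> 'd::finite hs \<Rightarrow> 'd hs" where "St t = dg (\<lambda>x. sin (x * t))"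

lemma bd_cos: "bd (\<lambda>x. cos (x * t)) 1" and bd_sin: "bd (\<lambda>x. sin (x * t)) 1"
  by (auto simp: bd_def)

lemma hc_Ct: "hc (Ct t a) k = cos (om k * t) *\<^sub>R hc a k" by (simp add: Ct_def hc_dg[OF bd_cos])
lemma hc_St: "hc (St t a) k = sin (om k * t) *\<^sub>R hc a k" by (simp add: St_def hc_dg[OF bd_sin])
lemma norm_Ct: "norm (Ct t a) \<le> norm a" using norm_dg[OF bd_cos, of t a] by (simp add: Ct_def)
lemma norm_St: "norm (St t a) \<le> norm a" using norm_dg[OF bd_sin, of t a] by (simp add: St_def)

definition U :: "real \<Rightarrow> 'd::finite hs \<times> 'd hs \<Rightarrow> 'd hs \<times> 'd hs" where
  "U t z = (Ct t (fst z) + St t (snd z), Ct t (snd z) - St t (fst z))"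

lemma U_add: "U s (U t z) = U (s + t) z"
proof -
  have "fst (U s (U t z)) = fst (U (s + t) z)"
    by (rule hs_eqI) (simp add: U_def hc_Ct hc_St distrib_left cos_add sin_add scaleR_conv_of_real algebra_simps)
  moreover have "snd (U s (U t z)) = snd (U (s + t) z)"
    by (rule hs_eqI) (simp add: U_def hc_Ct hc_St distrib_left cos_add sin_add scaleR_conv_of_real algebra_simps)
  ultimately show ?thesis by (simp add: prod_eq_iff)
qed

lemma U_0 [simp]: "U 0 z = z"
proof -
  have "fst (U 0 z) = fst z" "snd (U 0 z) = snd z"
    by (rule hs_eqI, simp add: U_def hc_Ct hc_St)+
  then show ?thesis by (simp add: prod_eq_iff)
qed

lemma U_inverse [simp]: "U (- t) (U t z) = z" "U t (U (- t) z) = z"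
  by (simp_all add: U_add)

lemma linear_Ct: "linear (Ct t)" and linear_St: "linear (St t)"
  unfolding Ct_def St_def using bounded_linear_dg bd_cos bd_sin bounded_linear.linear by blast+

lemma linear_U: "linear (U t)"
  by (rule linearI)
     (simp_all add: U_def linear_add[OF linear_Ct] linear_add[OF linear_St] linear_cmul[OF linear_Ct] linear_cmul[OF linear_St] algebra_simps)

lemmas U_plus = linear_add[OF linear_U] and U_diff = linear_diff[OF linear_U]
  and U_scale = linear_cmul[OF linear_U]

lemma norm_U [simp]: "norm (U t z) = norm (z :: 'd::finite hs \<times> 'd hs)"
proof -
  have e: "(norm y)\<^sup>2 = (\<Sum>\<^sub>\<infinity>k. (cmod (hc (fst y) k))\<^sup>2 + (cmod (hc (snd y) k))\<^sup>2)" for y :: "'d hs \<times> 'd hs"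
  proof -
    have "(norm y)\<^sup>2 = (norm (fst y))\<^sup>2 + (norm (snd y))\<^sup>2" by (simp add: norm_prod_def)
    also have "\<dots> = (\<Sum>\<^sub>\<infinity>k. (cmod (hc (fst y) k))\<^sup>2 + (cmod (hc (snd y) k))\<^sup>2)"
      unfolding norm_hs_sq by (rule infsum_add[symmetric]) (rule hc_summable)+
    finally show ?thesis .
  qed
  have rot: "(cmod (c *\<^sub>R p + s *\<^sub>R q))\<^sup>2 + (cmod (c *\<^sub>R q - s *\<^sub>R p))\<^sup>2 = (s\<^sup>2 + c\<^sup>2) * ((cmod p)\<^sup>2 + (cmod q)\<^sup>2)" for c s p q
    unfolding cmod_power2 by (simp add: power2_eq_square algebra_simps)
  have "(norm (U t z))\<^sup>2 = (norm z)\<^sup>2"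
    unfolding e by (simp add: U_def hc_Ct hc_St rot)
  then show ?thesis by simp
qed

lemma bounded_linear_U: "bounded_linear (U t)"
  by (rule bounded_linear_intro[of _ 1]) (auto simp: U_plus U_scale)

text \<open>The continuity is strong, for a fixed state, and not uniform over the unit ball, because
  the frequencies are unbounded.\<close>

lemma U_continuous_0: "((\<lambda>t. U t z) \<longlongrightarrow> z) (at 0)"
proof -
  have c: "((\<lambda>t. Ct t a) \<longlongrightarrow> a) (at 0)" for a :: "'a hs"
  proof -
    have "((\<lambda>t. dg (\<lambda>x. cos (x * t) - 1) a) \<longlongrightarrow> 0) (at 0)"
      by (rule dg_tendsto_0[where B=2]) (auto simp: bd_def intro!: tendsto_eq_intros intro: order_trans[OF abs_triangle_ineq4])
    moreover have "dg (\<lambda>x. cos (x * t) - 1) a = Ct t a - a" for t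
      using dg_minus[OF bd_cos bd_const[of 1], of t a] by (simp add: Ct_def dg_const)
    ultimately show ?thesis by (simp add: Lim_null[of _ a])
  qed
  have s: "((\<lambda>t. St t a) \<longlongrightarrow> 0) (at 0)" for a :: "'a hs"
    unfolding St_def by (rule dg_tendsto_0[where B=1]) (auto simp: bd_def intro!: tendsto_eq_intros)
  have "((\<lambda>t. U t z) \<longlongrightarrow> (fst z + 0, snd z - 0)) (at 0)"
    unfolding U_def by (intro tendsto_intros c s)
  then show ?thesis by simp
qed

text \<open>Strong continuity at 0 and the isometry property together give continuity in time and
  state at once.\<close>

lemma U_joint_continuous:
  fixes y :: "real \<Rightarrow> 'd::finite hs \<times> 'd hs"
  assumes "continuous_on S y" "continuous_on S r"
  shows "continuous_on S (\<lambda>t. U (r t) (y t))"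
  unfolding continuous_on_def
proof
  fix s assume s: "s \<in> S"
  have y: "(y \<longlongrightarrow> y s) (at s within S)" and r: "(r \<longlongrightarrow> r s) (at s within S)"
    using assms s by (auto simp: continuous_on_def)
  have u: "isCont (\<lambda>t. U t z) 0" for z :: "'d hs \<times> 'd hs" using U_continuous_0[of z] by (simp add: isCont_def)
  have "((\<lambda>t. r t - r s) \<longlongrightarrow> 0) (at s within S)" using r by (simp add: LIM_zero_iff)
  from isCont_tendsto_compose[OF u this]
  have 1: "((\<lambda>t. U (r t - r s) (U (r s) (y s))) \<longlongrightarrow> U (r s) (y s)) (at s within S)" by simp
  have "((\<lambda>t. norm (y t - y s)) \<longlongrightarrow> 0) (at s within S)" using y by (simp add: tendsto_norm_zero_iff LIM_zero_iff)
  then have "((\<lambda>t. U (r t) (y t - y s)) \<longlongrightarrow> 0) (at s within S)"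
    by (subst tendsto_norm_zero_iff[symmetric]) simp
  from tendsto_add[OF this 1] show "((\<lambda>t. U (r t) (y t)) \<longlongrightarrow> U (r s) (y s)) (at s within S)"
    by (simp add: U_add U_diff)
qed

section \<open>Duhamel's formula in the interaction picture\<close>

text \<open>For a solution W of the wave equation, Y(t) = U(-t) W(t) has derivative
  \<open>G Q t (Y t)\<close>. The unbounded generator has disappeared and the right-hand side is
  bounded in the state.\<close>

definition G :: "(real^'d::finite \<Rightarrow> real) \<Rightarrow> real \<Rightarrow> 'd hs \<times> 'd hs \<Rightarrow> 'd hs \<times> 'd hs" where
  "G Q s y = U (- s) (0, K Q (fst (U s y)))"

lemma norm_G: assumes "mbdd Q C" shows "norm (G Q s y) \<le> C * norm (fst (U s y))"
  using norm_K[OF assms, of "fst (U s y)"] by (simp add: G_def norm_Pair)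

lemma mbdd_nonneg:
  fixes Q :: "real^'d::finite \<Rightarrow> real"
  assumes "mbdd Q C" shows "C \<ge> 0"
proof -
  let ?f = "\<lambda>x::real^'d. 1::real"
  have L: "L2 ?f" by (rule L2_const)
  have "complex_of_real (nsq ?f) = vol TYPE('d)"
    using integral_ek[of "0 :: int^'d"] by (simp add: scaleR_conv_of_real del: of_real_power of_real_mult)
  then have "nsq ?f \<noteq> 0" using vol_pos[where 'd='d] by (simp only: of_real_eq_iff)
  then have "FC ?f \<noteq> 0" using norm_FC[OF L] by auto
  moreover have "0 \<le> C * norm (FC ?f)" using norm_K[OF assms, of "FC ?f"] norm_ge_zero order_trans by blast
  ultimately show ?thesis by (simp add: zero_le_mult_iff)
qed

lemma G_diff: "mbdd Q C \<Longrightarrow> G Q s y - G Q s z = G Q s (y - z)"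
proof -
  assume a: "mbdd Q C"
  have "K Q (p - q) = K Q p - K Q q" for p q
    using linear_diff[OF bounded_linear.linear[OF bounded_linear_K[OF a]]] .
  moreover have "fst (U s (y - z)) = fst (U s y) - fst (U s z)" by (simp add: U_diff)
  ultimately show ?thesis by (simp add: G_def U_diff[symmetric])
qed

lemma norm_fst_le': "norm (fst z) \<le> norm z" by (rule norm_fst_le[of "fst z" "snd z", simplified])

lemma norm_G_le: "mbdd Q C \<Longrightarrow> norm (G Q s y) \<le> C * norm y"
  using norm_G[of Q C s y] mult_left_mono[OF norm_fst_le'[of "U s y"] mbdd_nonneg[of Q C]] by simp

lemma continuous_K: "mbdd Q C \<Longrightarrow> continuous_on S f \<Longrightarrow> continuous_on S (\<lambda>t. K Q (f t))"
  by (rule bounded_linear.continuous_on[OF bounded_linear_K])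

lemma continuous_G:
  assumes "mbdd Q C" "continuous_on S y" shows "continuous_on S (\<lambda>s. G Q s (y s))"
  unfolding G_def
  by (intro U_joint_continuous continuous_on_Pair continuous_K[OF assms(1)] continuous_on_fst assms continuous_intros)

text \<open>Picard's contraction argument, with ratio 1/2 coming from
  \<open>\<tau> * C \<le> 1/2\<close>.\<close>

lemma duhamel_exists:
  fixes Q :: "real^'d::finite \<Rightarrow> real"
  assumes Q: "mbdd Q C" and \<tau>: "\<tau> \<ge> 0" "\<tau> * C \<le> 1/2"
  shows "\<exists>Y. continuous_on {0..\<tau>} Y \<and> (\<forall>t\<in>{0..\<tau>}. ((\<lambda>s. G Q s (Y s)) has_integral (Y t - z0)) {0..t})"
proof -
  note C = mbdd_nonneg[OF Q]
  \<comment> \<open>Clamping time to the interval lets the integral map act on bounded continuous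
    functions on the whole line.\<close>
  define c where "c t = max 0 (min \<tau> t)" for t
  have c: "c t \<in> {0..\<tau>}" "t \<in> {0..\<tau>} \<Longrightarrow> c t = t" for t using \<tau> by (auto simp: c_def)
  have cc: "continuous_on S c" for S unfolding c_def by (intro continuous_intros)
  define F where "F Y t = z0 + integral {0..c t} (\<lambda>s. G Q s (apply_bcontfun Y s))" for Y :: "real \<Rightarrow>\<^sub>C ('d hs \<times> 'd hs)" and t
  have gc: "continuous_on S (\<lambda>s. G Q s (apply_bcontfun Y s))" for S and Y :: "real \<Rightarrow>\<^sub>C ('d hs \<times> 'd hs)"
    by (intro continuous_G[OF Q]) simp
  have ib: "norm (integral {0..c t} (\<lambda>s. G Q s (y s))) \<le> C * B * \<tau>"
    if "continuous_on {0..\<tau>} (\<lambda>s. G Q s (y s))" "\<And>s. norm (y s) \<le> B" for y B t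
  proof -
    have B: "B \<ge> 0" using that(2)[of 0] norm_ge_zero order_trans by blast
    have "norm (integral {0..c t} (\<lambda>s. G Q s (y s))) \<le> C * B * (c t - 0)"
    proof (rule integral_bound)
      show "continuous_on {0..c t} (\<lambda>s. G Q s (y s))" using c[of t] by (intro continuous_on_subset[OF that(1)]) auto
      show "norm (G Q s (y s)) \<le> C * B" for s
        using order_trans[OF norm_G_le[OF Q] mult_left_mono[OF that(2) C]] .
    qed (use c[of t] in auto)
    also have "\<dots> \<le> C * B * \<tau>" using c[of t] C B by (intro mult_left_mono) auto
    finally show ?thesis .
  qed
  have Fc: "F Y \<in> bcontfun" for Y
  proof (rule bcontfun_normI)
    have "continuous_on {0..\<tau>} (\<lambda>t. integral {0..t} (\<lambda>s. G Q s (apply_bcontfun Y s)))"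
      by (intro indefinite_integral_continuous_1 integrable_continuous_interval gc)
    then have "continuous_on UNIV (\<lambda>t. integral {0..c t} (\<lambda>s. G Q s (apply_bcontfun Y s)))"
      by (rule continuous_on_compose2) (use c cc in auto)
    then show "continuous_on UNIV (F Y)" unfolding F_def by (intro continuous_intros)
    show "norm (F Y t) \<le> norm z0 + C * norm Y * \<tau>" for t
      unfolding F_def using norm_triangle_le ib[OF gc norm_bounded] by (meson add_left_mono norm_triangle_ineq order_trans)
  qed
  have "\<exists>!Y. Bcontfun (F Y) = Y"
  proof (rule banach_fix_type[of "1/2"])
    show "\<forall>X Y. dist (Bcontfun (F X)) (Bcontfun (F Y)) \<le> 1/2 * dist X Y"
    proof (intro allI dist_bound)
      fix X Y :: "real \<Rightarrow>\<^sub>C ('d hs \<times> 'd hs)" and t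
      have "F X t - F Y t = integral {0..c t} (\<lambda>s. G Q s (apply_bcontfun X s)) - integral {0..c t} (\<lambda>s. G Q s (apply_bcontfun Y s))"
        by (simp add: F_def)
      also have "\<dots> = integral {0..c t} (\<lambda>s. G Q s (apply_bcontfun X s) - G Q s (apply_bcontfun Y s))"
        by (rule Henstock_Kurzweil_Integration.integral_diff[symmetric]) (intro integrable_continuous_interval gc)+
      also have "\<dots> = integral {0..c t} (\<lambda>s. G Q s (apply_bcontfun X s - apply_bcontfun Y s))"
        by (simp add: G_diff[OF Q])
      also have "norm \<dots> \<le> C * dist X Y * \<tau>"
      proof (rule ib)
        show "continuous_on {0..\<tau>} (\<lambda>s. G Q s (apply_bcontfun X s - apply_bcontfun Y s))"
          by (intro continuous_G[OF Q] continuous_intros) auto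
        show "norm (apply_bcontfun X s - apply_bcontfun Y s) \<le> dist X Y" for s
          using dist_bounded[of X s Y] by (simp add: dist_norm)
      qed
      also have "\<dots> = \<tau> * C * dist X Y" by simp
      also have "\<dots> \<le> 1/2 * dist X Y" using \<tau> by (intro mult_right_mono) auto
      finally show "dist (apply_bcontfun (Bcontfun (F X)) t) (apply_bcontfun (Bcontfun (F Y)) t) \<le> 1/2 * dist X Y"
        by (simp add: Bcontfun_inverse[OF Fc] dist_norm)
    qed
  qed auto
  then obtain Y where "Bcontfun (F Y) = Y" by blast
  then have YF: "apply_bcontfun Y = F Y" by (metis Bcontfun_inverse[OF Fc])
  show ?thesis
  proof (intro exI[of _ "apply_bcontfun Y"] conjI ballI)
    fix t assume "t \<in> {0..\<tau>}"
    then have "apply_bcontfun Y t = z0 + integral {0..t} (\<lambda>s. G Q s (apply_bcontfun Y s))"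
      by (subst YF) (simp add: F_def c)
    moreover have "((\<lambda>s. G Q s (apply_bcontfun Y s)) has_integral integral {0..t} (\<lambda>s. G Q s (apply_bcontfun Y s))) {0..t}"
      by (intro integrable_integral integrable_continuous_interval gc)
    ultimately show "((\<lambda>s. G Q s (apply_bcontfun Y s)) has_integral apply_bcontfun Y t - z0) {0..t}" by simp
  qed simp
qed

section \<open>Short-time estimates\<close>

text \<open>The sine of \<omega> t divided by \<omega> is at most t in absolute value: one
  derivative is traded for one factor of time.\<close>

lemma St_J_norm: "norm (J (St t a)) \<le> \<bar>t\<bar> * norm a"
proof -
  have b: "bd (\<lambda>x. 1 / x * sin (x * t)) \<bar>t\<bar>"
    unfolding bd_def
  proof (intro allI impI)
    fix x :: real assume x: "x \<ge> 1"
    have "\<bar>sin (x * t)\<bar> \<le> \<bar>x * t\<bar>" by (rule abs_sin_x_le_abs_x)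
    then show "\<bar>1 / x * sin (x * t)\<bar> \<le> \<bar>t\<bar>" using x by (simp add: abs_mult field_simps)
  qed
  show ?thesis unfolding J_def St_def dg_dg[OF bd_inverse bd_sin] by (rule norm_dg[OF b])
qed

lemma cos_minus_one_le: "\<bar>cos u - 1\<bar> \<le> \<bar>u\<bar>" for u :: real
proof -
  have "cos u = 1 - 2 * (sin (u / 2))\<^sup>2" using cos_double_sin[of "u / 2"] by simp
  then have "\<bar>cos u - 1\<bar> = 2 * \<bar>sin (u / 2)\<bar> * \<bar>sin (u / 2)\<bar>" by (simp add: power2_eq_square abs_mult)
  also have "\<dots> \<le> 2 * \<bar>sin (u / 2)\<bar> * 1" by (intro mult_left_mono) auto
  also have "\<dots> \<le> 2 * \<bar>u / 2\<bar>" using abs_sin_x_le_abs_x[of "u / 2"] by simp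
  finally show ?thesis by simp
qed

lemma Ct_J_norm: "norm (J (Ct t a) - J a) \<le> \<bar>t\<bar> * norm a"
proof -
  have b: "bd (\<lambda>x. 1 / x * cos (x * t) - 1 / x) \<bar>t\<bar>"
    unfolding bd_def
  proof (intro allI impI)
    fix x :: real assume x: "x \<ge> 1"
    have "\<bar>cos (x * t) - 1\<bar> \<le> \<bar>x * t\<bar>" by (rule cos_minus_one_le)
    moreover have "1 / x * cos (x * t) - 1 / x = (cos (x * t) - 1) / x" by (simp add: diff_divide_distrib)
    ultimately show "\<bar>1 / x * cos (x * t) - 1 / x\<bar> \<le> \<bar>t\<bar>" using x by (simp add: abs_mult field_simps)
  qed
  have "J (Ct t a) - J a = dg (\<lambda>x. 1 / x * cos (x * t) - 1 / x) a"
    unfolding J_def Ct_def dg_dg[OF bd_inverse bd_cos] dg_minus[OF bd_mult[OF bd_inverse bd_cos] bd_inverse] ..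
  then show ?thesis using norm_dg[OF b, of a] by simp
qed

text \<open>The potential sees only the position. The largest position norm along the trajectory is
  attained and controlled by A plus half of itself. Since A bounds only the position of the free
  evolution, the estimates survive velocities of order 1/\<tau>. The last bound gains another
  \<tau>, because the force reaches the position only through the sine part of the group.\<close>

lemma duhamel_bound:
  fixes Y :: "real \<Rightarrow> 'd::finite hs \<times> 'd hs"
  assumes Q: "mbdd Q C" and \<tau>: "\<tau> \<ge> 0" "\<tau> * C \<le> 1/2"
    and Yc: "continuous_on {0..\<tau>} Y"
    and Y: "\<And>t. t \<in> {0..\<tau>} \<Longrightarrow> ((\<lambda>s. G Q s (Y s)) has_integral (Y t - z0)) {0..t}"
    and A: "\<And>s. s \<in> {0..\<tau>} \<Longrightarrow> norm (fst (U s z0)) \<le> A"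
    and t: "t \<in> {0..\<tau>}"
  shows duhamel_bound_fst: "norm (fst (U t (Y t))) \<le> 2 * A"
    and duhamel_bound_diff: "norm (U t (Y t) - U t z0) \<le> 2 * A * (\<tau> * C)"
    and duhamel_bound_J: "norm (J (fst (U t (Y t)) - fst (U t z0))) \<le> 2 * A * (\<tau> * C) * \<tau>"
proof -
  note C = mbdd_nonneg[OF Q]
  have A0: "A \<ge> 0" using A[of 0] \<tau> norm_ge_zero order_trans by (metis atLeastAtMost_iff order_refl)
  let ?n = "\<lambda>s. norm (fst (U s (Y s)))"
  have "continuous_on {0..\<tau>} ?n"
    by (intro continuous_intros U_joint_continuous Yc)
  then obtain s0 where s0: "s0 \<in> {0..\<tau>}" "\<And>s. s \<in> {0..\<tau>} \<Longrightarrow> ?n s \<le> ?n s0"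
    using continuous_attains_sup[of "{0..\<tau>}" ?n] \<tau> by auto
  have d: "norm (Y r - z0) \<le> ?n s0 * (\<tau> * C)" if r: "r \<in> {0..\<tau>}" for r
  proof -
    have "norm (Y r - z0) \<le> (C * ?n s0) * measure lborel {0..r}"
    proof (rule has_integral_bound_real[OF _ finite.emptyI Y[OF r]])
      fix s assume "s \<in> {0..r} - {}"
      then have "s \<in> {0..\<tau>}" using r by auto
      then show "norm (G Q s (Y s)) \<le> C * ?n s0"
        using order_trans[OF norm_G[OF Q] mult_left_mono[OF s0(2) C]] by blast
    qed (use C in simp)
    also have "\<dots> \<le> (C * ?n s0) * \<tau>" using r C by (intro mult_left_mono) auto
    finally show ?thesis by (simp add: mult_ac)
  qed
  have dU: "norm (U r (Y r) - U r z0) \<le> ?n s0 * (\<tau> * C)" if r: "r \<in> {0..\<tau>}" for r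
    using d[OF r] by (simp add: U_diff[symmetric])
  have m: "?n s0 \<le> 2 * A"
  proof -
    have "?n s0 \<le> norm (fst (U s0 z0)) + norm (fst (U s0 (Y s0) - U s0 z0))"
      using norm_triangle_ineq[of "fst (U s0 z0)" "fst (U s0 (Y s0) - U s0 z0)"] by simp
    also have "\<dots> \<le> A + ?n s0 * (\<tau> * C)"
      by (intro add_mono A s0(1) order_trans[OF norm_fst_le' dU[OF s0(1)]])
    also have "?n s0 * (\<tau> * C) \<le> ?n s0 * (1/2)" using \<tau> by (intro mult_left_mono) auto
    finally show ?thesis by simp
  qed
  show "norm (fst (U t (Y t))) \<le> 2 * A" using s0(2)[OF t] m by linarith
  have tc: "0 \<le> \<tau> * C" using \<tau> C by simp
  show "norm (U t (Y t) - U t z0) \<le> 2 * A * (\<tau> * C)"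
    using order_trans[OF dU[OF t] mult_right_mono[OF m tc]] .
  have bl: "bounded_linear (\<lambda>z. J (fst (U t z)))"
    by (intro bounded_linear_compose[OF bounded_linear_J] bounded_linear_compose[OF bounded_linear_fst] bounded_linear_U)
  have "norm (J (fst (U t (Y t - z0)))) \<le> (\<tau> * (C * (2 * A))) * measure lborel {0..t}"
  proof (rule has_integral_bound_real[OF _ finite.emptyI has_integral_linear[OF Y[OF t] bl]])
    fix s assume "s \<in> {0..t} - {}"
    then have s: "s \<in> {0..\<tau>}" "\<bar>t - s\<bar> \<le> \<tau>" using t by auto
    have "fst (U t (G Q s (Y s))) = St (t - s) (K Q (fst (U s (Y s))))"
      unfolding G_def U_add by (simp add: U_def linear_0[OF linear_Ct])
    then have "norm (J (fst (U t (G Q s (Y s))))) \<le> \<bar>t - s\<bar> * norm (K Q (fst (U s (Y s))))"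
      using St_J_norm by metis
    also have "\<dots> \<le> \<tau> * (C * (2 * A))"
      using s C A0 order_trans[OF norm_K[OF Q] mult_left_mono[OF order_trans[OF s0(2)[OF s(1)] m] C]] \<tau>
      by (intro mult_mono) auto
    finally show "norm (((\<lambda>z. J (fst (U t z))) \<circ> (\<lambda>s. G Q s (Y s))) s) \<le> \<tau> * (C * (2 * A))" by simp
  qed (use C A0 \<tau> in simp)
  also have "\<dots> \<le> (\<tau> * (C * (2 * A))) * \<tau>" using t C A0 \<tau> by (intro mult_left_mono) auto
  finally show "norm (J (fst (U t (Y t)) - fst (U t z0))) \<le> 2 * A * (\<tau> * C) * \<tau>"
    by (simp add: U_diff mult_ac)
qed

section \<open>Trajectories and reachability\<close>

text \<open>Y lives in the interaction picture: the state of the system at time t is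
  \<open>U t (Y t)\<close>.\<close>

definition traj :: "(real^'d::finite \<Rightarrow> real) \<Rightarrow> real \<Rightarrow> (real \<Rightarrow> 'd ctrl) \<Rightarrow> 'd hs \<times> 'd hs
    \<Rightarrow> (real \<Rightarrow> 'd hs \<times> 'd hs) \<Rightarrow> bool" where
  "traj V T u z0 Y \<longleftrightarrow> continuous_on {0..T} Y \<and>
     (\<forall>t\<in>{0..T}. ((\<lambda>s. G (pot V (u s)) s (Y s)) has_integral (Y t - z0)) {0..t})"

lemma traj_0: assumes "traj V T u z0 Y" "T \<ge> 0" shows "Y 0 = z0"
proof -
  have "((\<lambda>s. G (pot V (u s)) s (Y s)) has_integral (Y 0 - z0)) {0..0}"
    using assms unfolding traj_def by (elim conjE ballE[of _ _ 0]) auto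
  then have "((\<lambda>s. G (pot V (u s)) s (Y s)) has_integral (Y 0 - z0)) {0}" by simp
  from has_integral_unique[OF this has_integral_refl(2)] show ?thesis by simp
qed

definition uconcat :: "real \<Rightarrow> (real \<Rightarrow> 'a) \<Rightarrow> (real \<Rightarrow> 'a) \<Rightarrow> real \<Rightarrow> 'a" where
  "uconcat T u1 u2 s = (if s < T then u1 s else u2 (s - T))"

text \<open>The second piece runs on a clock that starts at \<open>T1\<close>. Conjugation by
  \<open>U (- T1)\<close> converts its interaction picture to the common clock, since
  \<open>G\<close> depends on time only through U.\<close>

lemma traj_concat:
  assumes 1: "traj V T1 u1 z0 Y1" and 2: "traj V T2 u2 (U T1 (Y1 T1)) Y2" and T: "T1 \<ge> 0" "T2 \<ge> 0"
  defines "Y \<equiv> \<lambda>t. if t \<le> T1 then Y1 t else U (- T1) (Y2 (t - T1))"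
  shows "traj V (T1 + T2) (uconcat T1 u1 u2) z0 Y"
  unfolding traj_def
proof (intro conjI ballI)
  have Y20: "U (- T1) (Y2 0) = Y1 T1" using traj_0[OF 2 T(2)] by simp
  have c1: "continuous_on {0..T1} Y1" and c2: "continuous_on {0..T2} Y2"
    using 1 2 by (auto simp: traj_def)
  have c2': "continuous_on {T1..T1+T2} (\<lambda>t. U (- T1) (Y2 (t - T1)))"
    by (intro U_joint_continuous continuous_on_compose2[OF c2] continuous_intros) auto
  have "continuous_on ({0..T1} \<union> {T1..T1+T2}) Y"
    unfolding Y_def by (intro continuous_on_If continuous_on_subset[OF c1] continuous_on_subset[OF c2']) (use Y20 in auto)
  moreover have "{0..T1} \<union> {T1..T1+T2} = {0..T1+T2}" using T by auto
  ultimately show "continuous_on {0..T1+T2} Y" by simp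
  let ?u = "uconcat T1 u1 u2"
  \<comment> \<open>At \<open>s = T1\<close> the control already belongs to the second piece while Y
    is still the first one; this single point does not affect the integral.\<close>
  have i1: "((\<lambda>s. G (pot V (?u s)) s (Y s)) has_integral (Y1 t - z0)) {0..t}" if "t \<in> {0..T1}" for t
    by (rule has_integral_spike_finite[of "{T1}" _ _ "\<lambda>s. G (pot V (u1 s)) s (Y1 s)"])
       (use 1 that in \<open>auto simp: traj_def Y_def uconcat_def\<close>)
  fix t assume t: "t \<in> {0..T1+T2}"
  show "((\<lambda>s. G (pot V (?u s)) s (Y s)) has_integral (Y t - z0)) {0..t}"
  proof (cases "t \<le> T1")
    case True
    then show ?thesis using i1[of t] t by (simp add: Y_def)
  next
    case False
    define r where "r = t - T1"
    have r: "r \<in> {0..T2}" "t = T1 + r" using False t by (auto simp: r_def)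
    have "((\<lambda>s. G (pot V (u2 s)) s (Y2 s)) has_integral (Y2 r - U T1 (Y1 T1))) {0..r}"
      using 2 r by (auto simp: traj_def)
    from has_integral_linear[OF this bounded_linear_U[of "- T1"]]
    have "((\<lambda>s. U (- T1) (G (pot V (u2 s)) s (Y2 s))) has_integral (U (- T1) (Y2 r) - Y1 T1)) {0..r}"
      by (simp add: o_def U_diff)
    from has_integral_shift_real_ivl[OF this, of "- T1"]
    have "((\<lambda>s. U (- T1) (G (pot V (u2 (s - T1))) (s - T1) (Y2 (s - T1)))) has_integral (U (- T1) (Y2 r) - Y1 T1)) {T1..T1+r}"
      by (simp add: add.commute)
    then have i2: "((\<lambda>s. G (pot V (?u s)) s (Y s)) has_integral (U (- T1) (Y2 r) - Y1 T1)) {T1..T1+r}"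
      by (rule has_integral_spike_finite[of "{T1}", rotated 2])
         (auto simp: uconcat_def Y_def G_def U_add)
    from has_integral_combine[OF _ _ i1[of T1] i2] T r False
    show ?thesis by (simp add: Y_def)
  qed
qed

lemma piecewise_const_concat:
  assumes 1: "piecewise_const T1 u1" and 2: "piecewise_const T2 u2" and T: "T1 \<ge> 0" "T2 \<ge> 0"
  shows "piecewise_const (T1 + T2) (uconcat T1 u1 u2)"
proof -
  obtain S1 where S1: "finite S1" "\<And>t1 t2. t1 \<in> {0..T1} \<Longrightarrow> t2 \<in> {0..T1} \<Longrightarrow> t1 \<le> t2 \<Longrightarrow> {t1..t2} \<inter> S1 = {} \<Longrightarrow> u1 t1 = u1 t2"
    using 1 unfolding piecewise_const_def by blast
  obtain S2 where S2: "finite S2" "\<And>t1 t2. t1 \<in> {0..T2} \<Longrightarrow> t2 \<in> {0..T2} \<Longrightarrow> t1 \<le> t2 \<Longrightarrow> {t1..t2} \<inter> S2 = {} \<Longrightarrow> u2 t1 = u2 t2"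
    using 2 unfolding piecewise_const_def by blast
  let ?S = "S1 \<union> {T1} \<union> (\<lambda>s. s + T1) ` S2"
  have "uconcat T1 u1 u2 t1 = uconcat T1 u1 u2 t2"
    if t: "t1 \<in> {0..T1+T2}" "t2 \<in> {0..T1+T2}" "t1 \<le> t2" "{t1..t2} \<inter> ?S = {}" for t1 t2
  proof -
    consider "t2 < T1" | "T1 < t1" using t by force
    then show ?thesis
    proof cases
      case 1
      then have "u1 t1 = u1 t2" using t by (intro S1(2)) auto
      then show ?thesis using 1 t by (simp add: uconcat_def)
    next
      case 2
      have "{t1 - T1..t2 - T1} \<inter> S2 = {}"
      proof (rule ccontr)
        assume "{t1 - T1..t2 - T1} \<inter> S2 \<noteq> {}"
        then obtain s where "s \<in> S2" "t1 - T1 \<le> s" "s \<le> t2 - T1" by auto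
        then have "s + T1 \<in> {t1..t2} \<inter> ?S" by auto
        then show False using t by blast
      qed
      then have "u2 (t1 - T1) = u2 (t2 - T1)" using t 2 by (intro S2(2)) auto
      then show ?thesis using 2 t by (simp add: uconcat_def)
    qed
  qed
  then show ?thesis unfolding piecewise_const_def
    by (intro exI[of _ ?S] conjI ballI impI) (use S1(1) S2(1) in auto)
qed

text \<open>One control works for all initial states, and the end map is Lipschitz. Both are needed
  to run a program from a state that is known only approximately.\<close>

definition prog :: "(real^'d::finite \<Rightarrow> real) \<Rightarrow> real \<Rightarrow> ('d hs \<times> 'd hs \<Rightarrow> 'd hs \<times> 'd hs) \<Rightarrow> bool" where
  "prog V T g \<longleftrightarrow> T \<ge> 0 \<and> (\<exists>u. piecewise_const T u \<and> (\<forall>z. \<exists>Y. traj V T u z Y \<and> U T (Y T) = g z))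
     \<and> (\<exists>L. \<forall>z z'. dist (g z) (g z') \<le> L * dist z z')"

lemma prog_id: "prog V 0 (\<lambda>z. z)"
  unfolding prog_def
proof (intro conjI)
  show "\<exists>u. piecewise_const 0 u \<and> (\<forall>z. \<exists>Y. traj V 0 u z Y \<and> U 0 (Y 0) = z)"
  proof (rule exI[of _ "\<lambda>_. undefined"], intro conjI allI)
    fix z :: "'a hs \<times> 'a hs"
    show "\<exists>Y. traj V 0 (\<lambda>_. undefined) z Y \<and> U 0 (Y 0) = z"
      by (rule exI[of _ "\<lambda>_. z"]) (simp add: traj_def has_integral_refl(2))
  qed (auto simp: piecewise_const_def)
  show "\<exists>L. \<forall>z z'. dist z z' \<le> L * dist z z'" by (rule exI[of _ 1]) simp
qed simp

lemma prog_comp: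
  assumes "prog V T1 g1" "prog V T2 g2"
  shows "prog V (T1 + T2) (\<lambda>z. g2 (g1 z))"
proof -
  obtain u1 L1 where 1: "T1 \<ge> 0" "piecewise_const T1 u1" "\<And>z. \<exists>Y. traj V T1 u1 z Y \<and> U T1 (Y T1) = g1 z"
     "\<And>z z'. dist (g1 z) (g1 z') \<le> L1 * dist z z'" using assms(1) unfolding prog_def by blast
  obtain u2 L2 where 2: "T2 \<ge> 0" "piecewise_const T2 u2" "\<And>z. \<exists>Y. traj V T2 u2 z Y \<and> U T2 (Y T2) = g2 z"
     "\<And>z z'. dist (g2 z) (g2 z') \<le> L2 * dist z z'" using assms(2) unfolding prog_def by blast
  have L: "dist (g2 (g1 z)) (g2 (g1 z')) \<le> (\<bar>L2\<bar> * L1) * dist z z'" for z z'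
  proof -
    have "dist (g2 (g1 z)) (g2 (g1 z')) \<le> \<bar>L2\<bar> * dist (g1 z) (g1 z')"
      using 2(4)[of "g1 z" "g1 z'"] mult_right_mono[OF abs_ge_self[of L2] zero_le_dist[of "g1 z" "g1 z'"]] by linarith
    also have "\<dots> \<le> \<bar>L2\<bar> * (L1 * dist z z')" by (intro mult_left_mono 1) auto
    finally show ?thesis by (simp add: mult.assoc)
  qed
  have "\<exists>Y. traj V (T1 + T2) (uconcat T1 u1 u2) z Y \<and> U (T1 + T2) (Y (T1 + T2)) = g2 (g1 z)" for z
  proof -
    obtain Y1 where Y1: "traj V T1 u1 z Y1" "U T1 (Y1 T1) = g1 z" using 1(3) by blast
    obtain Y2 where Y2: "traj V T2 u2 (g1 z) Y2" "U T2 (Y2 T2) = g2 (g1 z)" using 2(3) by blast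
    let ?Y = "\<lambda>t. if t \<le> T1 then Y1 t else U (- T1) (Y2 (t - T1))"
    have "traj V (T1 + T2) (uconcat T1 u1 u2) z ?Y"
      using traj_concat[OF Y1(1) _ 1(1) 2(1), of u2 Y2] Y1 Y2 by simp
    \<comment> \<open>If the second duration is 0, the end time falls into the first branch of
      \<open>?Y\<close>, and the two branches must be compared.\<close>
    moreover have "?Y (T1 + T2) = U (- T1) (Y2 T2)"
    proof (cases "T2 = 0")
      case True
      then show ?thesis using traj_0[OF Y2(1)] Y1(2)[symmetric] by simp
    qed (use 2(1) in simp)
    then have "U (T1 + T2) (?Y (T1 + T2)) = g2 (g1 z)" using Y2(2) by (simp add: U_add)
    ultimately show ?thesis by blast
  qed
  then show ?thesis unfolding prog_def using 1 2 L piecewise_const_concat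
    by (intro conjI exI[of _ "uconcat T1 u1 u2"]) (auto intro!: exI[of _ "\<bar>L2\<bar> * L1"])
qed

definition duhamel_sol :: "(real^'d::finite \<Rightarrow> real) \<Rightarrow> real \<Rightarrow> 'd hs \<times> 'd hs \<Rightarrow> (real \<Rightarrow> 'd hs \<times> 'd hs)" where
  "duhamel_sol Q \<tau> z = (SOME Y. continuous_on {0..\<tau>} Y \<and> (\<forall>t\<in>{0..\<tau>}. ((\<lambda>s. G Q s (Y s)) has_integral (Y t - z)) {0..t}))"

lemma duhamel_sol:
  assumes "mbdd Q C" "\<tau> \<ge> 0" "\<tau> * C \<le> 1/2"
  shows duhamel_sol_continuous: "continuous_on {0..\<tau>} (duhamel_sol Q \<tau> z)"
    and duhamel_sol_integral: "\<And>t. t \<in> {0..\<tau>} \<Longrightarrow> ((\<lambda>s. G Q s (duhamel_sol Q \<tau> z s)) has_integral (duhamel_sol Q \<tau> z t - z)) {0..t}"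
  using someI_ex[OF duhamel_exists[OF assms, of z]] unfolding duhamel_sol_def by blast+

definition flow :: "(real^'d::finite \<Rightarrow> real) \<Rightarrow> real \<Rightarrow> 'd hs \<times> 'd hs \<Rightarrow> 'd hs \<times> 'd hs" where
  "flow Q \<tau> z = U \<tau> (duhamel_sol Q \<tau> z \<tau>)"

text \<open>The difference of two solutions solves the same equation from the difference of the
  initial states, and \<open>\<tau> * C \<le> 1/2\<close> turns the perturbation bound into the
  Lipschitz constant 2.\<close>

lemma prog_flow:
  fixes V :: "real^'d::finite \<Rightarrow> real"
  assumes Q: "mbdd (pot V c) C" and \<tau>: "\<tau> \<ge> 0" "\<tau> * C \<le> 1/2"
  shows "prog V \<tau> (flow (pot V c) \<tau>)"
  unfolding prog_def
proof (intro conjI \<tau>(1))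
  show "\<exists>u. piecewise_const \<tau> u \<and> (\<forall>z. \<exists>Y. traj V \<tau> u z Y \<and> U \<tau> (Y \<tau>) = flow (pot V c) \<tau> z)"
    using duhamel_sol[OF assms] by (intro exI[of _ "\<lambda>_. c"] conjI allI exI[of _ "duhamel_sol (pot V c) \<tau> _"])
      (auto simp: piecewise_const_def traj_def flow_def)
  have "dist (flow (pot V c) \<tau> z) (flow (pot V c) \<tau> z') \<le> 2 * dist z z'" for z z'
  proof -
    let ?Y = "\<lambda>s. duhamel_sol (pot V c) \<tau> z s - duhamel_sol (pot V c) \<tau> z' s"
    have t: "\<tau> \<in> {0..\<tau>}" using \<tau> by simp
    have i: "((\<lambda>s. G (pot V c) s (?Y s)) has_integral (?Y t - (z - z'))) {0..t}" if "t \<in> {0..\<tau>}" for t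
      using has_integral_diff[OF duhamel_sol_integral[OF assms that, of z] duhamel_sol_integral[OF assms that, of z']]
      by (simp add: G_diff[OF Q] algebra_simps)
    have "norm (U \<tau> (?Y \<tau>) - U \<tau> (z - z')) \<le> 2 * norm (z - z') * (\<tau> * C)"
      by (rule duhamel_bound_diff[OF assms _ i _ t])
         (use norm_fst_le'[of "U _ (z - z')"] in \<open>auto intro: continuous_on_diff duhamel_sol_continuous[OF assms]\<close>)
    also have "\<dots> \<le> 2 * norm (z - z') * (1/2)" using \<tau> by (intro mult_left_mono) auto
    finally have "norm (U \<tau> (?Y \<tau>) - U \<tau> (z - z')) \<le> norm (z - z')" by simp
    then have "norm (U \<tau> (?Y \<tau>)) \<le> norm (U \<tau> (z - z')) + norm (z - z')"
      using norm_triangle_ineq2[of "U \<tau> (?Y \<tau>)" "U \<tau> (z - z')"] by linarith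
    then show ?thesis unfolding flow_def dist_norm U_diff[symmetric] by simp
  qed
  then show "\<exists>L. \<forall>z z'. dist (flow (pot V c) \<tau> z) (flow (pot V c) \<tau> z') \<le> L * dist z z'" by blast
qed

text \<open>The slack in the time bound makes the relation with S = 0 closed under limits whose
  durations tend to 0 (\<open>reach_limit\<close>), so that such limits cost no time.\<close>

definition reach :: "(real^'d::finite \<Rightarrow> real) \<Rightarrow> real \<Rightarrow> 'd hs \<times> 'd hs \<Rightarrow> 'd hs \<times> 'd hs \<Rightarrow> bool" where
  "reach V S z z' \<longleftrightarrow> (\<forall>\<epsilon>>0. \<exists>T g. T \<le> S + \<epsilon> \<and> prog V T g \<and> dist (g z) z' < \<epsilon>)"

lemma reach_flow:
  assumes "mbdd (pot V c) C" "\<tau> \<ge> 0" "\<tau> * C \<le> 1/2"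
  shows "reach V \<tau> z (flow (pot V c) \<tau> z)"
  unfolding reach_def
  by (intro allI impI exI[of _ \<tau>] exI[of _ "flow (pot V c) \<tau>"]) (use prog_flow[OF assms] in auto)

lemma reach_refl: "reach V 0 z z"
  unfolding reach_def by (intro allI impI exI[of _ 0] exI[of _ "\<lambda>z. z"]) (use prog_id in auto)

text \<open>The second program is fixed first; its Lipschitz constant then dictates how precisely
  the first one has to hit the intermediate state.\<close>

lemma reach_trans:
  assumes 1: "reach V S1 z1 z2" and 2: "reach V S2 z2 z3"
  shows "reach V (S1 + S2) z1 z3"
  unfolding reach_def
proof (intro allI impI)
  fix \<epsilon> :: real assume \<epsilon>: "\<epsilon> > 0"
  obtain T2 g2 where 2: "T2 \<le> S2 + \<epsilon> / 2" "prog V T2 g2" "dist (g2 z2) z3 < \<epsilon> / 2"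
    using 2 \<epsilon> unfolding reach_def by (meson half_gt_zero)
  obtain L where L: "\<And>z z'. dist (g2 z) (g2 z') \<le> L * dist z z'" using 2(2) unfolding prog_def by blast
  define \<delta> where "\<delta> = min (\<epsilon> / 2) (\<epsilon> / (2 * (\<bar>L\<bar> + 1)))"
  have \<delta>: "\<delta> > 0" "\<delta> \<le> \<epsilon> / 2" "(\<bar>L\<bar> + 1) * \<delta> \<le> \<epsilon> / 2"
  proof -
    have "(\<bar>L\<bar> + 1) * \<delta> \<le> (\<bar>L\<bar> + 1) * (\<epsilon> / (2 * (\<bar>L\<bar> + 1)))" unfolding \<delta>_def by (intro mult_left_mono) auto
    also have "\<dots> = \<epsilon> / 2" by (simp add: field_simps add_nonneg_eq_0_iff)
    finally show "(\<bar>L\<bar> + 1) * \<delta> \<le> \<epsilon> / 2" .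
    show "\<delta> \<le> \<epsilon> / 2" unfolding \<delta>_def by (rule min.cobounded1)
    show "\<delta> > 0" using \<epsilon> by (auto simp: \<delta>_def intro!: divide_pos_pos add_nonneg_pos)
  qed
  obtain T1 g1 where 1: "T1 \<le> S1 + \<delta>" "prog V T1 g1" "dist (g1 z1) z2 < \<delta>"
    using 1 \<delta>(1) unfolding reach_def by meson
  have "dist (g2 (g1 z1)) z3 \<le> dist (g2 (g1 z1)) (g2 z2) + dist (g2 z2) z3" by (rule dist_triangle)
  also have "dist (g2 (g1 z1)) (g2 z2) \<le> (\<bar>L\<bar> + 1) * dist (g1 z1) z2"
    by (rule order_trans[OF L mult_right_mono]) auto
  also have "\<dots> \<le> (\<bar>L\<bar> + 1) * \<delta>" using 1(3) by (intro mult_left_mono) auto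
  finally have "dist (g2 (g1 z1)) z3 < \<epsilon>" using \<delta>(3) 2(3) by linarith
  then show "\<exists>T g. T \<le> S1 + S2 + \<epsilon> \<and> prog V T g \<and> dist (g z1) z3 < \<epsilon>"
    using prog_comp[OF 1(2) 2(2)] 1(1) 2(1) \<delta>(2)
    by (intro exI[of _ "T1 + T2"] exI[of _ "\<lambda>z. g2 (g1 z)"]) auto
qed

lemma reach_closure:
  assumes "\<And>\<epsilon>. \<epsilon> > 0 \<Longrightarrow> \<exists>S z''. S \<le> \<epsilon> \<and> reach V S z z'' \<and> dist z'' z' < \<epsilon>"
  shows "reach V 0 z z'"
  unfolding reach_def
proof (intro allI impI)
  fix \<epsilon> :: real assume \<epsilon>: "\<epsilon> > 0"
  obtain S z'' where z: "S \<le> \<epsilon> / 2" "reach V S z z''" "dist z'' z' < \<epsilon> / 2"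
    using assms[of "\<epsilon> / 2"] \<epsilon> by auto
  obtain T g where g: "T \<le> S + \<epsilon> / 2" "prog V T g" "dist (g z) z'' < \<epsilon> / 2"
    using z(2) \<epsilon> unfolding reach_def by (meson half_gt_zero)
  have "dist (g z) z' < \<epsilon>" using dist_triangle[of "g z" z' z''] g(3) z(3) by linarith
  then show "\<exists>T g. T \<le> 0 + \<epsilon> \<and> prog V T g \<and> dist (g z) z' < \<epsilon>"
    using g z by (intro exI[of _ T] exI[of _ g]) auto
qed

lemma reach_limit:
  assumes "\<forall>\<^sub>F \<tau> in at_right 0. \<exists>S. S \<le> e \<tau> \<and> reach V S z (h \<tau>)" "(h \<longlongrightarrow> z') (at_right 0)" "(e \<longlongrightarrow> 0) (at_right (0::real))"
  shows "reach V 0 z z'"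
proof (rule reach_closure)
  fix \<epsilon> :: real assume \<epsilon>: "\<epsilon> > 0"
  have "\<forall>\<^sub>F \<tau> in at_right 0. (\<exists>S. S \<le> e \<tau> \<and> reach V S z (h \<tau>)) \<and> dist (h \<tau>) z' < \<epsilon> \<and> e \<tau> < \<epsilon>"
    using assms(1) tendstoD[OF assms(2) \<epsilon>] order_tendstoD(2)[OF assms(3) \<epsilon>] by eventually_elim auto
  from eventually_happens'[OF trivial_limit_at_right_real this]
  obtain \<tau> where "\<exists>S. S \<le> e \<tau> \<and> reach V S z (h \<tau>)" "dist (h \<tau>) z' < \<epsilon>" "e \<tau> < \<epsilon>" by blast
  then show "\<exists>S z''. S \<le> \<epsilon> \<and> reach V S z z'' \<and> dist z'' z' < \<epsilon>"
    by (meson less_imp_le order_trans)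
qed

section \<open>Impulses\<close>

definition ctrl_fun :: "'d::finite ctrl \<Rightarrow> real^'d \<Rightarrow> real" where
  "ctrl_fun c x = fst c + (\<Sum>j\<in>UNIV. fst (snd c) j * sin (x $ j) + snd (snd c) j * cos (x $ j))"

definition ctrl_scale :: "real \<Rightarrow> 'd::finite ctrl \<Rightarrow> 'd ctrl" where
  "ctrl_scale r c = (r * fst c, \<lambda>j. r * fst (snd c) j, \<lambda>j. r * snd (snd c) j)"

lemma ctrl_fun_ctrl_scale: "ctrl_fun (ctrl_scale r c) x = r * ctrl_fun c x"
  unfolding ctrl_fun_def ctrl_scale_def fst_conv snd_conv by (simp add: distrib_left sum_distrib_left mult.assoc)

lemma pot_ctrl_fun: "pot V c = (\<lambda>x. V x + ctrl_fun c x)"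
  by (simp add: pot_def ctrl_fun_def fun_eq_iff)

lemma tp_sum: "finite A \<Longrightarrow> (\<And>j. j \<in> A \<Longrightarrow> trigpoly (f j)) \<Longrightarrow> trigpoly (\<lambda>x. \<Sum>j\<in>A. f j x)"
proof (induction A rule: finite_induct)
  case empty
  then show ?case using tp_const[of 0] by simp
next
  case (insert a A)
  then show ?case using tp_add[of "f a" "\<lambda>x. \<Sum>j\<in>A. f j x"] by simp
qed

lemma trigpoly_ctrl_fun: "trigpoly (ctrl_fun c)"
proof -
  have "trigpoly (\<lambda>x. fst c + (\<Sum>j\<in>UNIV. fst (snd c) j * sin (kdot (axis j 1) x) + snd (snd c) j * cos (kdot (axis j 1) x)))"
    by (intro tp_add tp_const tp_sum tp_scale tp_sin tp_cos) auto
  then show ?thesis unfolding ctrl_fun_def[abs_def] kdot_axis .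
qed

text \<open>This is the exponential of \<phi> B: the operator \<phi> B has square zero, so the
  series stops after the linear term.\<close>

definition impulse :: "(real^'d::finite \<Rightarrow> real) \<Rightarrow> 'd hs \<times> 'd hs \<Rightarrow> 'd hs \<times> 'd hs" where
  "impulse \<phi> z = (fst z, snd z + M \<phi> (J (fst z)))"

lemma tp_M_add: "trigpoly \<phi> \<Longrightarrow> trigpoly \<psi> \<Longrightarrow> M (\<lambda>x. \<phi> x + \<psi> x) a = M \<phi> a + M \<psi> a"
proof -
  assume a: "trigpoly \<phi>" "trigpoly \<psi>"
  from tp_bounded[OF a(1)] obtain B where B: "\<forall>x. \<bar>\<phi> x\<bar> \<le> B" ..
  from tp_bounded[OF a(2)] obtain C where C: "\<forall>x. \<bar>\<psi> x\<bar> \<le> C" ..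
  show ?thesis by (rule M_add[OF tp_tm[OF a(1)] B[rule_format] tp_tm[OF a(2)] C[rule_format]])
qed

lemma tp_M_scale: "trigpoly \<phi> \<Longrightarrow> M (\<lambda>x. r * \<phi> x) a = r *\<^sub>R M \<phi> a"
proof -
  assume a: "trigpoly \<phi>"
  from tp_bounded[OF a] obtain B where B: "\<forall>x. \<bar>\<phi> x\<bar> \<le> B" ..
  show ?thesis by (rule M_scale[OF tp_tm[OF a] B[rule_format]])
qed

lemma bounded_linear_M: 
  fixes \<phi> :: "real^'d::finite \<Rightarrow> real"
  assumes \<phi>: "\<phi> \<in> borel_measurable tm" "\<And>x. \<bar>\<phi> x\<bar> \<le> B"
  shows "bounded_linear (M \<phi>)"
proof (rule bounded_linear_intro[of _ B])
  note L = L2_M[OF \<phi>]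
  fix a b :: "'d hs" and r :: real
  have "AE x in tm. \<phi> x * fn (a + b) x = \<phi> x * fn a x + \<phi> x * fn b x"
    using fn_add[of a b] by eventually_elim (simp add: distrib_left)
  from FC_cong_AE[OF this L L2_add[OF L L]] show "M \<phi> (a + b) = M \<phi> a + M \<phi> b"
    unfolding M_def by (simp add: FC_add L)
  have "AE x in tm. \<phi> x * fn (r *\<^sub>R a) x = r * (\<phi> x * fn a x)"
    using fn_scale[of r a] by eventually_elim simp
  from FC_cong_AE[OF this L L2_scale[OF L]] show "M \<phi> (r *\<^sub>R a) = r *\<^sub>R M \<phi> a"
    unfolding M_def by (simp add: FC_scale L)
  show "norm (M \<phi> a) \<le> norm a * B" using norm_M[OF \<phi>, of a] by (simp add: mult.commute)
qed

lemma tp_bounded_linear_M: "trigpoly \<phi> \<Longrightarrow> bounded_linear (M \<phi>)"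
proof -
  assume a: "trigpoly \<phi>"
  from tp_bounded[OF a] obtain B where B: "\<forall>x. \<bar>\<phi> x\<bar> \<le> B" ..
  show ?thesis by (rule bounded_linear_M[OF tp_tm[OF a] B[rule_format]])
qed

lemma tp_M_M: "trigpoly \<phi> \<Longrightarrow> trigpoly \<psi> \<Longrightarrow> M \<phi> (M \<psi> a) = M (\<lambda>x. \<phi> x * \<psi> x) a"
proof -
  assume a: "trigpoly \<phi>" "trigpoly \<psi>"
  from tp_bounded[OF a(1)] obtain B where B: "\<forall>x. \<bar>\<phi> x\<bar> \<le> B" ..
  from tp_bounded[OF a(2)] obtain C where C: "\<forall>x. \<bar>\<psi> x\<bar> \<le> C" ..
  from tp_bounded[OF tp_mult[OF a]] obtain D where D: "\<forall>x. \<bar>\<phi> x * \<psi> x\<bar> \<le> D" ..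
  note L1 = L2_M[OF tp_tm[OF a(1)] B[rule_format]] and L2 = L2_M[OF tp_tm[OF a(2)] C[rule_format]]
    and L3 = L2_M[OF tp_tm[OF tp_mult[OF a]] D[rule_format]]
  have ae: "AE x in tm. \<phi> x * fn (M \<psi> a) x = \<phi> x * \<psi> x * fn a x"
    using fn_FC[OF L2, of a] unfolding M_def by eventually_elim simp
  show ?thesis unfolding M_def[of \<phi>] M_def[of "\<lambda>x. \<phi> x * \<psi> x"]
    by (rule FC_cong_AE[OF ae L1 L3])
qed

lemma M_const: "M (\<lambda>x. c) a = c *\<^sub>R a"
  unfolding M_def using FC_scale[OF L2_fn, of c a] by simp

text \<open>An impulse leaves the position unchanged, so successive impulses commute and add up
  exactly.\<close>

lemma impulse_compose: "trigpoly \<phi> \<Longrightarrow> trigpoly \<psi> \<Longrightarrow> impulse \<psi> (impulse \<phi> z) = impulse (\<lambda>x. \<phi> x + \<psi> x) z"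
  by (simp add: impulse_def tp_M_add)

text \<open>A uniqueness argument: the difference of the two candidate solutions starts at 0, so
  \<open>duhamel_bound\<close> applies with A = 0.\<close>

lemma flow_scale:
  assumes Q: "mbdd Q C" and \<tau>: "\<tau> \<ge> 0" "\<tau> * C \<le> 1/2"
  shows "flow Q \<tau> (r *\<^sub>R z) = r *\<^sub>R flow Q \<tau> z"
proof -
  let ?Y = "\<lambda>s. duhamel_sol Q \<tau> (r *\<^sub>R z) s - r *\<^sub>R duhamel_sol Q \<tau> z s"
  have t: "\<tau> \<in> {0..\<tau>}" using \<tau> by simp
  have Gs: "G Q s (r *\<^sub>R y) = r *\<^sub>R G Q s y" for s y
    using K_scale[OF Q] U_scale[of "- s" r "(0, K Q (fst (U s y)))"] by (simp add: G_def U_scale)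
  have i: "((\<lambda>s. G Q s (?Y s)) has_integral (?Y t - 0)) {0..t}" if "t \<in> {0..\<tau>}" for t
    using has_integral_diff[OF duhamel_sol_integral[OF assms that, of "r *\<^sub>R z"]
        has_integral_cmul[OF duhamel_sol_integral[OF assms that, of z], of r]]
    by (simp add: G_diff[OF Q, symmetric] Gs algebra_simps)
  have "norm (U \<tau> (?Y \<tau>) - U \<tau> 0) \<le> 2 * 0 * (\<tau> * C)"
    by (rule duhamel_bound_diff[OF assms _ i _ t])
       (auto simp: linear_0[OF linear_U] intro!: continuous_intros duhamel_sol_continuous[OF assms])
  then have "?Y \<tau> = 0" by (simp add: linear_0[OF linear_U])
  then show ?thesis by (simp add: flow_def U_scale)
qed

section \<open>Asymptotics of the free step\<close>

lemma cos_minus_one_le_sq: "\<bar>cos u - 1\<bar> \<le> u\<^sup>2" for u :: real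
proof -
  have "cos u = 1 - 2 * (sin (u / 2))\<^sup>2" using cos_double_sin[of "u / 2"] by simp
  then have "\<bar>cos u - 1\<bar> = 2 * (sin (u / 2))\<^sup>2" by simp
  also have "(sin (u / 2))\<^sup>2 \<le> (u / 2)\<^sup>2"
    using abs_sin_x_le_abs_x[of "u / 2"] abs_le_square_iff by blast
  finally have "\<bar>cos u - 1\<bar> \<le> 2 * (u / 2)\<^sup>2" by simp
  also have "\<dots> = u\<^sup>2 / 2" by (simp add: power_divide)
  also have "\<dots> \<le> u\<^sup>2" by simp
  finally show ?thesis .
qed

lemma sin_minus_id_le: "\<bar>sin u - u\<bar> \<le> \<bar>u\<bar> * u\<^sup>2" for u :: real
proof -
  have aux: "\<bar>sin u - u\<bar> \<le> u * u\<^sup>2" if u: "u > 0" for u :: real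
  proof -
    have "\<exists>z>0. z < u \<and> (sin u - u) - (sin 0 - 0) = (u - 0) * (cos z - 1)"
      by (rule MVT2[OF u]) (auto intro!: derivative_eq_intros)
    then obtain \<xi> where \<xi>: "0 < \<xi>" "\<xi> < u" "sin u - u = u * (cos \<xi> - 1)" by auto
    then have "\<bar>sin u - u\<bar> = u * \<bar>cos \<xi> - 1\<bar>" using u by (simp add: abs_mult)
    also have "\<dots> \<le> u * \<xi>\<^sup>2" using u by (intro mult_left_mono cos_minus_one_le_sq) auto
    also have "\<dots> \<le> u * u\<^sup>2" using \<xi> u by (intro mult_left_mono power_mono) auto
    finally show ?thesis .
  qed
  consider "u > 0" | "u = 0" | "u < 0" by linarith
  then show ?thesis
  proof cases
    case 3
    then show ?thesis using aux[of "- u"] by simp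
  qed (use aux[of u] in auto)
qed

lemma sinc_le: "\<bar>sin u / u - 1\<bar> \<le> u\<^sup>2" if "u \<noteq> 0" for u :: real
proof -
  have "sin u / u - 1 = (sin u - u) / u" using that by (simp add: diff_divide_distrib)
  then show ?thesis using sin_minus_id_le[of u] that by (simp add: abs_divide field_simps)
qed

lemma sinc_bounded: "\<bar>sin u / u - 1\<bar> \<le> 2" for u :: real
proof -
  have "\<bar>sin u / u\<bar> \<le> 1" using abs_sin_x_le_abs_x[of u] by (simp add: abs_divide divide_le_eq)
  then show ?thesis by linarith
qed

lemma square_le_abs: "\<bar>u\<bar> \<le> 1 \<Longrightarrow> u\<^sup>2 \<le> \<bar>u\<bar>" for u :: real
  using mult_left_le[of "\<bar>u\<bar>" "\<bar>u\<bar>"] by (simp add: power2_eq_square abs_mult_self_eq)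

text \<open>Smallness of h near 0 settles each fixed frequency as \<tau> -> 0, and boundedness of h
  controls all frequencies together.\<close>

lemma dg_freq_null:
  fixes a :: "'d::finite hs"
  assumes B: "\<And>u. \<bar>h u\<bar> \<le> B" and h: "\<And>u. u \<noteq> 0 \<Longrightarrow> \<bar>h u\<bar> \<le> 2 * \<bar>u\<bar>"
  shows "((\<lambda>\<tau>. dg (\<lambda>x. h (x * \<tau>)) a) \<longlongrightarrow> 0) (at_right (0::real))"
proof (rule dg_tendsto_0)
  show "bd (\<lambda>x. h (x * \<tau>)) B" for \<tau> using B by (simp add: bd_def)
  fix x :: real assume x: "x \<ge> 1"
  have f: "((\<lambda>\<tau>. x * \<tau>) \<longlongrightarrow> 0) (at_right (0::real))" by (intro tendsto_eq_intros) auto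
  show "((\<lambda>\<tau>. h (x * \<tau>)) \<longlongrightarrow> 0) (at_right 0)"
  proof (rule Lim_null_comparison)
    show "\<forall>\<^sub>F \<tau> in at_right 0. norm (h (x * \<tau>)) \<le> 2 * \<bar>x * \<tau>\<bar>"
      using eventually_at_right_less[of "0::real"]
    proof eventually_elim
      case (elim \<tau>)
      then show ?case using h[of "x * \<tau>"] x by simp
    qed
    show "((\<lambda>\<tau>. 2 * \<bar>x * \<tau>\<bar>) \<longlongrightarrow> 0) (at_right 0)"
      using tendsto_mult[OF tendsto_const tendsto_rabs[OF f], of 2] by simp
  qed
qed

text \<open>Remainders of the free step, evaluated at frequency times duration. Because division by
  0 gives 0, \<open>sinc1 0\<close> is -1; the linear bounds therefore exclude u = 0, a value that
  does not occur for positive durations.\<close>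

definition sinc1 :: "real \<Rightarrow> real" where "sinc1 u = sin u / u - 1"
definition cos1_div :: "real \<Rightarrow> real" where "cos1_div u = (cos u - 1) / u"
definition sinc1_div :: "real \<Rightarrow> real" where "sinc1_div u = (sin u / u - 1) / u"
definition cos1 :: "real \<Rightarrow> real" where "cos1 u = cos u - 1"

lemma sinc1_bounds: "\<bar>sinc1 u\<bar> \<le> 2" "u \<noteq> 0 \<Longrightarrow> \<bar>sinc1 u\<bar> \<le> 2 * \<bar>u\<bar>"
proof -
  show "\<bar>sinc1 u\<bar> \<le> 2" unfolding sinc1_def by (rule sinc_bounded)
  assume "u \<noteq> 0"
  then show "\<bar>sinc1 u\<bar> \<le> 2 * \<bar>u\<bar>"
    using sinc_le[of u] sinc_bounded[of u] square_le_abs[of u] unfolding sinc1_def by linarith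
qed

lemma cos1_div_bounds: "\<bar>cos1_div u\<bar> \<le> 1" "u \<noteq> 0 \<Longrightarrow> \<bar>cos1_div u\<bar> \<le> 2 * \<bar>u\<bar>"
proof -
  show "\<bar>cos1_div u\<bar> \<le> 1" unfolding cos1_div_def using cos_minus_one_le[of u] by (simp add: abs_divide divide_le_eq)
  assume "u \<noteq> 0"
  then have "\<bar>cos1_div u\<bar> \<le> \<bar>u\<bar>" unfolding cos1_div_def using cos_minus_one_le_sq[of u]
    by (simp add: abs_divide divide_le_eq power2_eq_square abs_mult_self_eq)
  then show "\<bar>cos1_div u\<bar> \<le> 2 * \<bar>u\<bar>" by linarith
qed

lemma sinc1_div_bounds: "\<bar>sinc1_div u\<bar> \<le> 2" "u \<noteq> 0 \<Longrightarrow> \<bar>sinc1_div u\<bar> \<le> 2 * \<bar>u\<bar>"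
proof -
  have l: "\<bar>sinc1_div u\<bar> \<le> \<bar>u\<bar>" if "u \<noteq> 0" unfolding sinc1_div_def using sinc_le[OF that] that
    by (simp add: abs_divide divide_le_eq power2_eq_square abs_mult_self_eq)
  then show "u \<noteq> 0 \<Longrightarrow> \<bar>sinc1_div u\<bar> \<le> 2 * \<bar>u\<bar>" by linarith
  show "\<bar>sinc1_div u\<bar> \<le> 2"
  proof (cases "\<bar>u\<bar> \<le> 1")
    case True
    then show ?thesis using l by (cases "u = 0") (auto simp: sinc1_div_def)
  next
    case False
    then have "\<bar>sinc1_div u\<bar> \<le> 2 / \<bar>u\<bar>" unfolding sinc1_div_def abs_divide using sinc_bounded[of u] by (intro divide_right_mono) auto
    also have "\<dots> \<le> 2" using False by (simp add: divide_le_eq)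
    finally show ?thesis .
  qed
qed

lemma cos1_bounds: "\<bar>cos1 u\<bar> \<le> 2" "u \<noteq> 0 \<Longrightarrow> \<bar>cos1 u\<bar> \<le> 2 * \<bar>u\<bar>"
proof -
  show "\<bar>cos1 u\<bar> \<le> 2" unfolding cos1_def using abs_cos_le_one[of u] by linarith
  show "\<bar>cos1 u\<bar> \<le> 2 * \<bar>u\<bar>" unfolding cos1_def using cos_minus_one_le[of u] by linarith
qed

lemma sin_bounds: "\<bar>sin u\<bar> \<le> (1::real)" "u \<noteq> 0 \<Longrightarrow> \<bar>sin u\<bar> \<le> 2 * \<bar>u\<bar>"
  using abs_sin_x_le_abs_x[of u] by auto

lemma hc_dg_quotients:
  "hc (dg (\<lambda>x. sinc1 (x * \<tau>)) a) k = sinc1 (om k * \<tau>) *\<^sub>R hc a k"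
  "hc (dg (\<lambda>x. cos1_div (x * \<tau>)) a) k = cos1_div (om k * \<tau>) *\<^sub>R hc a k"
  "hc (dg (\<lambda>x. sinc1_div (x * \<tau>)) a) k = sinc1_div (om k * \<tau>) *\<^sub>R hc a k"
  "hc (dg (\<lambda>x. cos1 (x * \<tau>)) a) k = cos1 (om k * \<tau>) *\<^sub>R hc a k"
  by (rule hc_dg, simp add: bd_def, intro allI impI, rule sinc1_bounds(1) cos1_div_bounds(1) sinc1_div_bounds(1) cos1_bounds(1))+

text \<open>Exact formulas, checked mode by mode. For instance the sine part applied to
  \<open>(\<kappa> / \<tau>) J y\<close> multiplies the coefficients of y by \<kappa> sin u / u with
  u = \<open>om k * \<tau>\<close>, that is by \<kappa> + \<kappa> \<open>sinc1 u\<close>.\<close>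

lemma free_identities:
  fixes a0 v y :: "'d::finite hs" and \<kappa> \<tau> :: real
  assumes \<tau>: "\<tau> > 0"
  defines "z \<equiv> (a0, v + (\<kappa> / \<tau>) *\<^sub>R J y)"
  shows "fst (U \<tau> z) - \<kappa> *\<^sub>R y
      = a0 + (dg (\<lambda>x. cos1 (x * \<tau>)) a0 + dg (\<lambda>x. sin (x * \<tau>)) v + \<kappa> *\<^sub>R dg (\<lambda>x. sinc1 (x * \<tau>)) y)"
    and "(1 / \<tau>) *\<^sub>R (J (fst (U \<tau> z)) - J a0 - \<kappa> *\<^sub>R J y)
      = v + (dg (\<lambda>x. cos1_div (x * \<tau>)) a0 + dg (\<lambda>x. sinc1 (x * \<tau>)) v + \<kappa> *\<^sub>R dg (\<lambda>x. sinc1_div (x * \<tau>)) y)"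
    and "snd (U \<tau> z) - (\<kappa> / \<tau>) *\<^sub>R J y
      = v + (dg (\<lambda>x. cos1 (x * \<tau>)) v - dg (\<lambda>x. sin (x * \<tau>)) a0 + \<kappa> *\<^sub>R dg (\<lambda>x. cos1_div (x * \<tau>)) y)"
proof -
  note coeff = z_def U_def hc_Ct hc_St hc_J hc_dg_quotients St_def[symmetric]
    and unf = sinc1_def cos1_div_def sinc1_div_def cos1_def scaleR_conv_of_real field_simps less_imp_neq[OF om_pos, symmetric]
  show "fst (U \<tau> z) - \<kappa> *\<^sub>R y
      = a0 + (dg (\<lambda>x. cos1 (x * \<tau>)) a0 + dg (\<lambda>x. sin (x * \<tau>)) v + \<kappa> *\<^sub>R dg (\<lambda>x. sinc1 (x * \<tau>)) y)"
    by (rule hs_eqI, simp add: coeff) (use \<tau> in \<open>simp add: unf\<close>)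
  show "(1 / \<tau>) *\<^sub>R (J (fst (U \<tau> z)) - J a0 - \<kappa> *\<^sub>R J y)
      = v + (dg (\<lambda>x. cos1_div (x * \<tau>)) a0 + dg (\<lambda>x. sinc1 (x * \<tau>)) v + \<kappa> *\<^sub>R dg (\<lambda>x. sinc1_div (x * \<tau>)) y)"
    by (rule hs_eqI, simp add: coeff) (use \<tau> in \<open>simp add: unf\<close>)
  show "snd (U \<tau> z) - (\<kappa> / \<tau>) *\<^sub>R J y
      = v + (dg (\<lambda>x. cos1 (x * \<tau>)) v - dg (\<lambda>x. sin (x * \<tau>)) a0 + \<kappa> *\<^sub>R dg (\<lambda>x. cos1_div (x * \<tau>)) y)"
    by (rule hs_eqI, simp add: coeff) (use \<tau> in \<open>simp add: unf\<close>)
qed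

lemma eventually_small_time:
  "\<forall>\<^sub>F \<tau> in at_right 0. \<tau> > 0 \<and> \<tau> * C \<le> 1/2" for C :: real
proof -
  have "((\<lambda>\<tau>. \<tau> * C) \<longlongrightarrow> 0) (at_right 0)" by (intro tendsto_eq_intros) auto
  then have "\<forall>\<^sub>F \<tau> in at_right 0. \<tau> * C < 1/2" by (rule order_tendstoD) simp
  with eventually_at_right_less[of "0::real"] show ?thesis by eventually_elim auto
qed

lemma tendsto_bounded_scaleR:
  fixes f :: "'a \<Rightarrow> 'b::real_normed_vector"
  assumes "\<forall>\<^sub>F \<tau> in F. \<bar>\<kappa> \<tau>\<bar> \<le> (k::real)" "(f \<longlongrightarrow> 0) F"
  shows "((\<lambda>\<tau>. \<kappa> \<tau> *\<^sub>R f \<tau>) \<longlongrightarrow> 0) F"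
proof (rule Lim_null_comparison)
  show "\<forall>\<^sub>F \<tau> in F. norm (\<kappa> \<tau> *\<^sub>R f \<tau>) \<le> k * norm (f \<tau>)"
    using assms(1) by eventually_elim (simp add: mult_right_mono)
  show "((\<lambda>\<tau>. k * norm (f \<tau>)) \<longlongrightarrow> 0) F"
    using tendsto_mult[OF tendsto_const tendsto_norm_zero[OF assms(2)], of k] by simp
qed

text \<open>The three limits keep what later impulses of order at most 1/\<tau> can amplify: the
  position in H1, the position in L2 up to an error small compared with \<tau>, and the velocity
  without its singular part. The potential enters through E, which is of order \<tau>, and of order
  \<open>\<tau>\<^sup>2\<close> in the L2 norm of the position.\<close>

lemma free_step:
  fixes V :: "real^'d::finite \<Rightarrow> real" and a0 v y :: "'d hs" and \<kappa> :: "real \<Rightarrow> real"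
  assumes Q: "mbdd V C" and \<kappa>: "\<forall>\<^sub>F \<tau> in at_right 0. \<bar>\<kappa> \<tau>\<bar> \<le> k"
  defines "F \<equiv> \<lambda>\<tau>. flow V \<tau> (a0, v + (\<kappa> \<tau> / \<tau>) *\<^sub>R J y)"
  shows free_step_fst: "((\<lambda>\<tau>. fst (F \<tau>) - \<kappa> \<tau> *\<^sub>R y) \<longlongrightarrow> a0) (at_right 0)"
    and free_step_J: "((\<lambda>\<tau>. (1 / \<tau>) *\<^sub>R (J (fst (F \<tau>)) - J a0 - \<kappa> \<tau> *\<^sub>R J y)) \<longlongrightarrow> v) (at_right 0)"
    and free_step_snd: "((\<lambda>\<tau>. snd (F \<tau>) - (\<kappa> \<tau> / \<tau>) *\<^sub>R J y) \<longlongrightarrow> v) (at_right 0)"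
proof -
  define z where "z \<tau> = (a0, v + (\<kappa> \<tau> / \<tau>) *\<^sub>R J y)" for \<tau>
  define E where "E \<tau> = F \<tau> - U \<tau> (z \<tau>)" for \<tau>
  have F: "F \<tau> = U \<tau> (z \<tau>) + E \<tau>" for \<tau> by (simp add: E_def)
  define A where "A = norm a0 + norm v + k * norm y"
  have E: "\<forall>\<^sub>F \<tau> in at_right 0. norm (E \<tau>) \<le> 2 * A * (\<tau> * C) \<and> norm ((1 / \<tau>) *\<^sub>R J (fst (E \<tau>))) \<le> 2 * A * (\<tau> * C)"
    using eventually_small_time[of C] \<kappa>
  proof eventually_elim
    case (elim \<tau>)
    then have \<tau>: "\<tau> \<ge> 0" "\<tau> * C \<le> 1/2" "\<tau> > 0" "\<tau> \<in> {0..\<tau>}" and k: "\<bar>\<kappa> \<tau>\<bar> \<le> k" by auto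
    \<comment> \<open>Within time \<tau> the velocity of order 1/\<tau> moves the position only by a
      bounded amount, since \<open>St s\<close> gains a factor s on H1 data.\<close>
    have A: "norm (fst (U s (z \<tau>))) \<le> A" if s: "s \<in> {0..\<tau>}" for s
    proof -
      have comm: "St s (J y) = J (St s y)" by (rule hs_eqI) (simp add: hc_St hc_J)
      have "fst (U s (z \<tau>)) = Ct s a0 + (St s v + (\<kappa> \<tau> / \<tau>) *\<^sub>R St s (J y))"
        by (simp add: U_def z_def linear_add[OF linear_St] linear_cmul[OF linear_St])
      also have "norm \<dots> \<le> norm (Ct s a0) + (norm (St s v) + norm ((\<kappa> \<tau> / \<tau>) *\<^sub>R St s (J y)))"
        by (intro order_trans[OF norm_triangle_ineq] add_mono order_refl norm_triangle_ineq)
      also have "norm ((\<kappa> \<tau> / \<tau>) *\<^sub>R St s (J y)) \<le> k * norm y"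
      proof -
        have "norm ((\<kappa> \<tau> / \<tau>) *\<^sub>R St s (J y)) = (\<bar>\<kappa> \<tau>\<bar> / \<tau>) * norm (J (St s y))"
          using \<tau> by (simp add: comm)
        also have "\<dots> \<le> (k / \<tau>) * (\<tau> * norm y)"
        proof (intro mult_mono divide_right_mono k)
          show "norm (J (St s y)) \<le> \<tau> * norm y"
            using s order_trans[OF St_J_norm mult_right_mono[of "\<bar>s\<bar>" \<tau> "norm y"]] by auto
        qed (use \<tau> k in auto)
        also have "\<dots> = k * norm y" using \<tau> by simp
        finally show ?thesis .
      qed
      finally show ?thesis unfolding A_def using norm_Ct[of s a0] norm_St[of s v] by linarith
    qed
    note d = duhamel_bound_diff[OF Q \<tau>(1,2) duhamel_sol_continuous[OF Q \<tau>(1,2)] duhamel_sol_integral[OF Q \<tau>(1,2)] A \<tau>(4)]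
      and dJ = duhamel_bound_J[OF Q \<tau>(1,2) duhamel_sol_continuous[OF Q \<tau>(1,2)] duhamel_sol_integral[OF Q \<tau>(1,2)] A \<tau>(4)]
    have "norm (E \<tau>) \<le> 2 * A * (\<tau> * C)" using d by (simp add: E_def F_def flow_def z_def[symmetric])
    moreover have "norm (J (fst (E \<tau>))) \<le> 2 * A * (\<tau> * C) * \<tau>"
      using dJ by (simp add: E_def F_def flow_def z_def[symmetric])
    then have "norm ((1 / \<tau>) *\<^sub>R J (fst (E \<tau>))) \<le> 2 * A * (\<tau> * C)"
      using \<tau> by (simp add: field_simps)
    ultimately show ?case by blast
  qed
  have b0: "((\<lambda>\<tau>. 2 * A * (\<tau> * C)) \<longlongrightarrow> 0) (at_right 0)" by (intro tendsto_eq_intros) auto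
  have E0: "(E \<longlongrightarrow> 0) (at_right 0)" by (rule Lim_null_comparison[OF _ b0]) (use E in eventually_elim, auto)
  have EJ: "((\<lambda>\<tau>. (1 / \<tau>) *\<^sub>R J (fst (E \<tau>))) \<longlongrightarrow> 0) (at_right 0)"
    by (rule Lim_null_comparison[OF _ b0]) (use E in eventually_elim, auto)
  have Ef: "((\<lambda>\<tau>. fst (E \<tau>)) \<longlongrightarrow> 0) (at_right 0)" and Es: "((\<lambda>\<tau>. snd (E \<tau>)) \<longlongrightarrow> 0) (at_right 0)"
    using tendsto_fst[OF E0] tendsto_snd[OF E0] by simp_all
  note pos = eventually_at_right_less[of "0::real"]
  note d1 = dg_freq_null[where h=sinc1, OF sinc1_bounds] and d3 = dg_freq_null[where h=cos1_div, OF cos1_div_bounds]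
    and d4 = dg_freq_null[where h=sinc1_div, OF sinc1_div_bounds] and d5 = dg_freq_null[where h=cos1, OF cos1_bounds]
    and ds = dg_freq_null[where h=sin, OF sin_bounds]
  have "((\<lambda>\<tau>. a0 + (dg (\<lambda>x. cos1 (x * \<tau>)) a0 + dg (\<lambda>x. sin (x * \<tau>)) v + \<kappa> \<tau> *\<^sub>R dg (\<lambda>x. sinc1 (x * \<tau>)) y) + fst (E \<tau>)) \<longlongrightarrow> a0 + (0 + 0 + 0) + 0) (at_right 0)"
    by (intro tendsto_add tendsto_const tendsto_bounded_scaleR[OF \<kappa>] d1 d5 ds Ef)
  moreover have "\<forall>\<^sub>F \<tau> in at_right 0. a0 + (dg (\<lambda>x. cos1 (x * \<tau>)) a0 + dg (\<lambda>x. sin (x * \<tau>)) v + \<kappa> \<tau> *\<^sub>R dg (\<lambda>x. sinc1 (x * \<tau>)) y) + fst (E \<tau>)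
      = fst (F \<tau>) - \<kappa> \<tau> *\<^sub>R y"
    using pos by eventually_elim (simp add: F z_def free_identities(1)[symmetric])
  ultimately show "((\<lambda>\<tau>. fst (F \<tau>) - \<kappa> \<tau> *\<^sub>R y) \<longlongrightarrow> a0) (at_right 0)"
    by (simp add: tendsto_cong)
  have "((\<lambda>\<tau>. v + (dg (\<lambda>x. cos1_div (x * \<tau>)) a0 + dg (\<lambda>x. sinc1 (x * \<tau>)) v + \<kappa> \<tau> *\<^sub>R dg (\<lambda>x. sinc1_div (x * \<tau>)) y) + (1 / \<tau>) *\<^sub>R J (fst (E \<tau>))) \<longlongrightarrow> v + (0 + 0 + 0) + 0) (at_right 0)"
    by (intro tendsto_add tendsto_const tendsto_bounded_scaleR[OF \<kappa>] d1 d3 d4 EJ)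
  moreover have "\<forall>\<^sub>F \<tau> in at_right 0. v + (dg (\<lambda>x. cos1_div (x * \<tau>)) a0 + dg (\<lambda>x. sinc1 (x * \<tau>)) v + \<kappa> \<tau> *\<^sub>R dg (\<lambda>x. sinc1_div (x * \<tau>)) y) + (1 / \<tau>) *\<^sub>R J (fst (E \<tau>))
      = (1 / \<tau>) *\<^sub>R (J (fst (F \<tau>)) - J a0 - \<kappa> \<tau> *\<^sub>R J y)"
    using pos
    by eventually_elim (simp add: F z_def free_identities(2)[symmetric] J_add scaleR_add_right[symmetric] del: scaleR_add_right)
  ultimately show "((\<lambda>\<tau>. (1 / \<tau>) *\<^sub>R (J (fst (F \<tau>)) - J a0 - \<kappa> \<tau> *\<^sub>R J y)) \<longlongrightarrow> v) (at_right 0)"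
    by (simp add: tendsto_cong)
  have "((\<lambda>\<tau>. v + (dg (\<lambda>x. cos1 (x * \<tau>)) v - dg (\<lambda>x. sin (x * \<tau>)) a0 + \<kappa> \<tau> *\<^sub>R dg (\<lambda>x. cos1_div (x * \<tau>)) y) + snd (E \<tau>)) \<longlongrightarrow> v + (0 - 0 + 0) + 0) (at_right 0)"
    by (intro tendsto_add tendsto_diff tendsto_const tendsto_bounded_scaleR[OF \<kappa>] d3 d5 ds Es)
  moreover have "\<forall>\<^sub>F \<tau> in at_right 0. v + (dg (\<lambda>x. cos1 (x * \<tau>)) v - dg (\<lambda>x. sin (x * \<tau>)) a0 + \<kappa> \<tau> *\<^sub>R dg (\<lambda>x. cos1_div (x * \<tau>)) y) + snd (E \<tau>)
      = snd (F \<tau>) - (\<kappa> \<tau> / \<tau>) *\<^sub>R J y"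
    using pos by eventually_elim (simp add: F z_def free_identities(3)[symmetric])
  ultimately show "((\<lambda>\<tau>. snd (F \<tau>) - (\<kappa> \<tau> / \<tau>) *\<^sub>R J y) \<longlongrightarrow> v) (at_right 0)"
    by (simp add: tendsto_cong)
qed

text \<open>During time \<tau> the position moves only by order \<tau> in L2, so the force
  (1/\<tau>) \<phi> w is nearly constant and integrates to \<phi> w. The free rotation tends to the
  identity and the potential contributes order \<tau>.\<close>

lemma impulse_limit:
  fixes V \<phi> :: "real^'d::finite \<Rightarrow> real"
  assumes V: "mbdd V C" and \<phi>: "trigpoly \<phi>" "\<And>x. \<bar>\<phi> x\<bar> \<le> 1/4"
  shows "((\<lambda>\<tau>. flow (\<lambda>x. V x + (1 / \<tau>) * \<phi> x) \<tau> z) \<longlongrightarrow> impulse \<phi> z) (at_right 0)"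
proof (rule tendstoI)
  fix e :: real assume e: "e > 0"
  define a0 where "a0 = fst z"
  define y where "y = M \<phi> (J a0)"
  define A where "A = norm z"
  note C = mbdd_nonneg[OF V]
  have A0: "A \<ge> 0" by (simp add: A_def)
  have iz: "impulse \<phi> z = z + (0, y)" by (simp add: impulse_def y_def a0_def prod_eq_iff)
  have \<phi>m: "\<phi> \<in> borel_measurable tm" by (rule tp_tm[OF \<phi>(1)])
  have ez: "\<forall>\<^sub>F \<tau> in at_right 0. dist (U \<tau> z) z < e / 4"
    using tendstoD[OF U_continuous_0, of "e/4" z] e by (auto simp: eventually_at_filter elim: eventually_mono)
  \<comment> \<open>Strong continuity is applied to the single vector \<open>(0, y)\<close>, which
    is independent of \<tau>.\<close>
  obtain d where d: "d > 0" "\<And>r. r \<noteq> 0 \<Longrightarrow> \<bar>r\<bar> < d \<Longrightarrow> dist (U r (0, y)) (0, y) < e / 4"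
    using tendstoD[OF U_continuous_0, of "e/4" "(0, y)"] e unfolding eventually_at by (auto simp: dist_norm)
  have d': "norm (U r (0, y) - (0, y)) \<le> e / 4" if "\<bar>r\<bar> < d" for r
    using d(2)[OF _ that] e by (cases "r = 0") (auto simp: dist_norm)
  have "((\<lambda>\<tau>. \<tau> * (C * (2 * A) + 3/4 * A)) \<longlongrightarrow> 0) (at_right 0)" by (intro tendsto_eq_intros) auto
  then have es: "\<forall>\<^sub>F \<tau> in at_right 0. \<tau> * (C * (2 * A) + 3/4 * A) < e / 4" by (rule order_tendstoD) (use e in simp)
  have ed: "\<forall>\<^sub>F \<tau> in at_right 0. \<tau> < d" using d(1) by (intro order_tendstoD(2)[OF tendsto_ident_at])
  show "\<forall>\<^sub>F \<tau> in at_right 0. dist (flow (\<lambda>x. V x + (1 / \<tau>) * \<phi> x) \<tau> z) (impulse \<phi> z) < e"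
    using ez es ed eventually_small_time[of "4 * C"] 
  proof eventually_elim
    case (elim \<tau>)
    then have \<tau>: "\<tau> \<ge> 0" "\<tau> > 0" "\<tau> \<in> {0..\<tau>}" "\<tau> < d" by auto
    let ?\<psi> = "\<lambda>x. (1 / \<tau>) * \<phi> x" and ?D = "C + 1 / \<tau> * (1/4)"
    let ?Q = "\<lambda>x. V x + (1 / \<tau>) * \<phi> x"
    have \<psi>: "mbdd ?\<psi> (1 / \<tau> * (1/4))"
    proof (rule mbdd_bounded)
      show "?\<psi> \<in> borel_measurable tm" using \<phi>m by simp
      show "\<bar>1 / \<tau> * \<phi> x\<bar> \<le> 1 / \<tau> * (1/4)" for x using \<phi>(2)[of x] \<tau> by (simp add: abs_mult field_simps)
    qed
    have Q: "mbdd ?Q ?D" by (rule mbdd_add[OF V \<psi>])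
    \<comment> \<open>The large control alone uses up 1/4 of the admissible 1/2, whatever \<tau> is;
      the rest is left to the potential.\<close>
    have \<tau>D: "\<tau> * ?D \<le> 1/2"
    proof -
      have "\<tau> * ?D = \<tau> * C + 1/4" using \<tau> by (simp add: distrib_left)
      then show ?thesis using elim by linarith
    qed
    define Y where "Y = duhamel_sol ?Q \<tau> z"
    have Yc: "continuous_on {0..\<tau>} Y" unfolding Y_def by (rule duhamel_sol_continuous[OF Q \<tau>(1) \<tau>D])
    have Yi: "((\<lambda>s. G ?Q s (Y s)) has_integral (Y t - z)) {0..t}" if "t \<in> {0..\<tau>}" for t
      unfolding Y_def by (rule duhamel_sol_integral[OF Q \<tau>(1) \<tau>D that])
    have Az: "norm (fst (U s z)) \<le> A" for s using norm_fst_le'[of "U s z"] by (simp add: A_def)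
    define a where "a s = fst (U s (Y s))" for s
    have an: "norm (a s) \<le> 2 * A" if "s \<in> {0..\<tau>}" for s
      unfolding a_def by (rule duhamel_bound_fst[OF Q \<tau>(1) \<tau>D Yc Yi Az that])
    have Ja: "norm (J (a s) - J a0) \<le> 3 * A * \<tau>" if s: "s \<in> {0..\<tau>}" for s
    proof -
      have "norm (J (fst (U s (Y s)) - fst (U s z))) \<le> 2 * A * (\<tau> * ?D) * \<tau>"
        by (rule duhamel_bound_J[OF Q \<tau>(1) \<tau>D Yc Yi Az s])
      also have "\<dots> \<le> 2 * A * (1/2) * \<tau>"
        by (intro mult_right_mono mult_left_mono \<tau>D) (use \<tau> A0 in auto)
      finally have 1: "norm (J (a s) - J (fst (U s z))) \<le> A * \<tau>" by (simp add: a_def J_diff)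
      have "J (fst (U s z)) - J a0 = (J (Ct s a0) - J a0) + J (St s (snd z))"
        by (simp add: U_def J_add a0_def)
      also have "norm \<dots> \<le> \<bar>s\<bar> * norm a0 + \<bar>s\<bar> * norm (snd z)"
        by (intro order_trans[OF norm_triangle_ineq] add_mono Ct_J_norm St_J_norm)
      also have "\<dots> \<le> \<tau> * A + \<tau> * A"
        using s norm_fst_le'[of z] norm_snd_le[of "snd z" "fst z"] unfolding a0_def A_def
        by (intro add_mono mult_mono) auto
      finally have 2: "norm (J (fst (U s z)) - J a0) \<le> 2 * A * \<tau>" by (simp add: mult_ac)
      have "norm (J (a s) - J a0) \<le> norm (J (a s) - J (fst (U s z))) + norm (J (fst (U s z)) - J a0)"
        using norm_triangle_ineq[of "J (a s) - J (fst (U s z))" "J (fst (U s z)) - J a0"] by simp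
      with 1 2 show ?thesis by linarith
    qed
    have i1: "((\<lambda>s. U \<tau> (G ?Q s (Y s))) has_integral U \<tau> (Y \<tau> - z)) {0..\<tau>}"
      using has_integral_linear[OF Yi[OF \<tau>(3)] bounded_linear_U[of \<tau>]] by (simp add: o_def)
    \<comment> \<open>The jump is written as the integral of a constant density, so that it can be
      compared with the Duhamel integral under the integral sign.\<close>
    have i2: "((\<lambda>s. (1 / \<tau>) *\<^sub>R (0::'d hs, y)) has_integral (0, y)) {0..\<tau>}"
      using has_integral_const_real[of "(1 / \<tau>) *\<^sub>R (0::'d hs, y)" 0 \<tau>] \<tau> by simp
    have "norm (U \<tau> (Y \<tau> - z) - (0, y)) \<le> (C * (2 * A) + 3/4 * A + e / 4 / \<tau>) * measure lborel {0..\<tau>}"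
    proof (rule has_integral_bound_real[OF _ finite.emptyI has_integral_diff[OF i1 i2]])
      show "0 \<le> C * (2 * A) + 3/4 * A + e / 4 / \<tau>" using C A0 e \<tau> by (intro add_nonneg_nonneg) auto
      fix s assume "s \<in> {0..\<tau>} - {}"
      then have s: "s \<in> {0..\<tau>}" "\<bar>\<tau> - s\<bar> < d" using \<tau> by auto
      have KQ: "K ?Q (a s) = K V (a s) + (1 / \<tau>) *\<^sub>R M \<phi> (J (a s) - J a0) + (1 / \<tau>) *\<^sub>R y"
      proof -
        have 1: "K ?Q (a s) = K V (a s) + K ?\<psi> (a s)" by (rule K_plus[OF V \<psi>])
        have 2: "K ?\<psi> (a s) = (1 / \<tau>) *\<^sub>R M \<phi> (J (a s))" unfolding K_eq_M by (rule tp_M_scale[OF \<phi>(1)])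
        have 3: "M \<phi> (J (a s) - J a0) = M \<phi> (J (a s)) - y" unfolding y_def
          by (rule linear_diff[OF bounded_linear.linear[OF tp_bounded_linear_M[OF \<phi>(1)]]])
        have "K ?\<psi> (a s) = (1 / \<tau>) *\<^sub>R M \<phi> (J (a s) - J a0) + (1 / \<tau>) *\<^sub>R y"
          unfolding 2 3 by (simp add: scaleR_diff_right)
        with 1 show ?thesis by (simp only: add.assoc)
      qed
      have "U \<tau> (G ?Q s (Y s)) = U (\<tau> - s) (0, K ?Q (a s))"
        by (simp add: G_def U_add a_def)
      also have "(0, K ?Q (a s)) = (0, K V (a s) + (1 / \<tau>) *\<^sub>R M \<phi> (J (a s) - J a0)) + (1 / \<tau>) *\<^sub>R (0::'d hs, y)"
        unfolding KQ by simp
      also have "U (\<tau> - s) \<dots> = U (\<tau> - s) (0, K V (a s) + (1 / \<tau>) *\<^sub>R M \<phi> (J (a s) - J a0)) + (1 / \<tau>) *\<^sub>R U (\<tau> - s) (0, y)"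
        unfolding U_plus U_scale ..
      finally have eq: "U \<tau> (G ?Q s (Y s)) - (1 / \<tau>) *\<^sub>R (0, y)
         = U (\<tau> - s) (0, K V (a s) + (1 / \<tau>) *\<^sub>R M \<phi> (J (a s) - J a0)) + (1 / \<tau>) *\<^sub>R (U (\<tau> - s) (0, y) - (0, y))"
        by (simp add: scaleR_diff_right del: scaleR_Pair)
      have "norm (K V (a s) + (1 / \<tau>) *\<^sub>R M \<phi> (J (a s) - J a0)) \<le> C * (2 * A) + 3/4 * A"
      proof (rule order_trans[OF norm_triangle_ineq add_mono])
        show "norm (K V (a s)) \<le> C * (2 * A)" using order_trans[OF norm_K[OF V] mult_left_mono[OF an[OF s(1)] C]] .
        have "norm (M \<phi> (J (a s) - J a0)) \<le> 1/4 * (3 * A * \<tau>)"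
          using order_trans[OF norm_M[OF \<phi>m \<phi>(2)] mult_left_mono[OF Ja[OF s(1)], of "1/4"]] by simp
        then show "norm ((1 / \<tau>) *\<^sub>R M \<phi> (J (a s) - J a0)) \<le> 3/4 * A" using \<tau> by (simp add: field_simps)
      qed
      then have n1: "norm (U (\<tau> - s) (0::'d hs, K V (a s) + (1 / \<tau>) *\<^sub>R M \<phi> (J (a s) - J a0))) \<le> C * (2 * A) + 3/4 * A"
        by (simp add: norm_Pair)
      have n2: "norm ((1 / \<tau>) *\<^sub>R (U (\<tau> - s) (0, y) - (0, y))) \<le> e / 4 / \<tau>"
      proof -
        have "norm ((1 / \<tau>) *\<^sub>R W) = norm W / \<tau>" for W :: "'d hs \<times> 'd hs" using \<tau> by simp
        then show ?thesis using divide_right_mono[OF d'[OF s(2)] \<tau>(1)] by (simp only:)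
      qed
      show "norm (U \<tau> (G ?Q s (Y s)) - (1 / \<tau>) *\<^sub>R (0, y)) \<le> C * (2 * A) + 3/4 * A + e / 4 / \<tau>"
        unfolding eq by (rule order_trans[OF norm_triangle_ineq add_mono[OF n1 n2]])
    qed
    also have "\<dots> = \<tau> * (C * (2 * A) + 3/4 * A) + e / 4" using \<tau> by (simp add: field_simps)
    finally have m: "norm (U \<tau> (Y \<tau> - z) - (0, y)) < e / 2" using elim by linarith
    have "flow ?Q \<tau> z - impulse \<phi> z = (U \<tau> z - z) + (U \<tau> (Y \<tau> - z) - (0, y))"
      unfolding iz flow_def Y_def[symmetric] U_diff by (simp add: algebra_simps)
    then have "norm (flow ?Q \<tau> z - impulse \<phi> z) \<le> norm (U \<tau> z - z) + norm (U \<tau> (Y \<tau> - z) - (0, y))"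
      by (metis norm_triangle_ineq)
    also have "\<dots> < e" using m elim e by (simp add: dist_norm)
    finally show ?case by (simp add: dist_norm)
  qed
qed

section \<open>Reachable impulses\<close>

lemma reach_seq3:
  assumes "reach V 0 z z1" "reach V \<tau> z1 z2" "reach V 0 z2 z3"
  shows "reach V \<tau> z z3"
  using reach_trans[OF reach_trans[OF assms(1,2)] assms(3)] by simp

lemma reach_flow_V:
  assumes "mbdd V C" "\<tau> \<ge> 0" "\<tau> * C \<le> 1/2"
  shows "reach V \<tau> z (flow V \<tau> z)"
proof -
  have "pot V (0, \<lambda>_. 0, \<lambda>_. 0) = V" by (simp add: pot_def fun_eq_iff)
  then show ?thesis using reach_flow[of V "(0, \<lambda>_. 0, \<lambda>_. 0)" C \<tau> z] assms by simp
qed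

text \<open>All real multiples are included, because the square trick applies \<phi> with the large
  factors 1/sqrt \<tau> of both signs.\<close>

definition impulsive :: "(real^'d::finite \<Rightarrow> real) \<Rightarrow> (real^'d \<Rightarrow> real) \<Rightarrow> bool" where
  "impulsive V \<phi> \<longleftrightarrow> trigpoly \<phi> \<and> (\<forall>r z. reach V 0 z (impulse (\<lambda>x. r * \<phi> x) z))"

lemma impulsive_tp: "impulsive V \<phi> \<Longrightarrow> trigpoly \<phi>" by (simp add: impulsive_def)
lemma impulsive_reach: "impulsive V \<phi> \<Longrightarrow> reach V 0 z (impulse (\<lambda>x. r * \<phi> x) z)" unfolding impulsive_def by blast

lemma impulsive_scale: "impulsive V \<phi> \<Longrightarrow> impulsive V (\<lambda>x. c * \<phi> x)"
  unfolding impulsive_def by (auto simp: mult.assoc[symmetric] intro: tp_scale)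

lemma reach_impulse_add:
  assumes "trigpoly \<phi>" "trigpoly \<psi>" "reach V 0 z (impulse \<phi> z)" "reach V 0 (impulse \<phi> z) (impulse \<psi> (impulse \<phi> z))"
  shows "reach V 0 z (impulse (\<lambda>x. \<phi> x + \<psi> x) z)"
  using reach_trans[OF assms(3,4)] impulse_compose[OF assms(1,2), of z] by simp

lemma impulsive_add: assumes "impulsive V \<phi>" "impulsive V \<psi>" shows "impulsive V (\<lambda>x. \<phi> x + \<psi> x)"
proof -
  have "reach V 0 z (impulse (\<lambda>x. r * (\<phi> x + \<psi> x)) z)" for r z
    unfolding distrib_left using assms by (intro reach_impulse_add tp_scale impulsive_tp impulsive_reach)
  then show ?thesis using assms by (simp add: impulsive_def tp_add)
qed

text \<open>Amplitudes up to 1/4 are limits of short flows with control of size 1/\<tau>; a larger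
  impulse is a repetition of equal small ones.\<close>

lemma impulsive_control:
  fixes V :: "real^'d::finite \<Rightarrow> real"
  assumes V: "mbdd V C"
  shows "impulsive V (ctrl_fun c)"
proof -
  have small: "reach V 0 z (impulse (ctrl_fun c) z)" if b: "\<And>x. \<bar>ctrl_fun c x\<bar> \<le> 1/4" for c :: "'d ctrl" and z
  proof (rule reach_limit)
    show "((\<lambda>\<tau>. flow (\<lambda>x. V x + (1 / \<tau>) * ctrl_fun c x) \<tau> z) \<longlongrightarrow> impulse (ctrl_fun c) z) (at_right 0)"
      by (rule impulse_limit[OF V trigpoly_ctrl_fun b])
    show "((\<lambda>\<tau>. \<tau>) \<longlongrightarrow> 0) (at_right (0::real))" by (rule tendsto_ident_at)
    show "\<forall>\<^sub>F \<tau> in at_right 0. \<exists>S\<le>\<tau>. reach V S z (flow (\<lambda>x. V x + (1 / \<tau>) * ctrl_fun c x) \<tau> z)"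
      using eventually_small_time[of "4 * C"]
    proof eventually_elim
      case (elim \<tau>)
      have p: "pot V (ctrl_scale (1 / \<tau>) c) = (\<lambda>x. V x + (1 / \<tau>) * ctrl_fun c x)"
        by (simp add: pot_ctrl_fun ctrl_fun_ctrl_scale)
      have "mbdd (\<lambda>x. (1 / \<tau>) * ctrl_fun c x) (1 / \<tau> * (1/4))"
      proof (rule mbdd_bounded)
        show "(\<lambda>x. (1 / \<tau>) * ctrl_fun c x) \<in> borel_measurable tm" by (intro tp_tm tp_scale trigpoly_ctrl_fun)
        show "\<bar>1 / \<tau> * ctrl_fun c x\<bar> \<le> 1 / \<tau> * (1/4)" for x using b[of x] elim by (simp add: abs_mult field_simps)
      qed
      from mbdd_add[OF V this] have Q: "mbdd (pot V (ctrl_scale (1 / \<tau>) c)) (C + 1 / \<tau> * (1/4))" unfolding p .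
      have "\<tau> * (C + 1 / \<tau> * (1/4)) = \<tau> * C + 1/4" using elim by (simp add: distrib_left)
      then have "reach V \<tau> z (flow (pot V (ctrl_scale (1 / \<tau>) c)) \<tau> z)"
        using elim by (intro reach_flow[OF Q]) auto
      then show ?case unfolding p by blast
    qed
  qed
  have "reach V 0 z (impulse (\<lambda>x. r * ctrl_fun c x) z)" for r z
  proof -
    from tp_bounded[OF trigpoly_ctrl_fun[of "ctrl_scale r c"]] obtain B where B: "\<forall>x. \<bar>ctrl_fun (ctrl_scale r c) x\<bar> \<le> B" ..
    \<comment> \<open>The 4 B brings the n-th part of the impulse below 1/4, and the 1 makes n
      positive.\<close>
    obtain n :: nat where n: "4 * B + 1 \<le> real n" using real_arch_simple by blast
    have B0: "B \<ge> 0" using B by (meson abs_ge_zero order_trans)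
    then have n0: "real n > 0" using n by linarith
    define c' where "c' = ctrl_scale (1 / real n) (ctrl_scale r c)"
    have c': "ctrl_fun c' x = (1 / real n) * (r * ctrl_fun c x)" for x by (simp add: c'_def ctrl_fun_ctrl_scale)
    have "\<bar>ctrl_fun c' x\<bar> \<le> 1/4" for x
    proof -
      have "\<bar>ctrl_fun c' x\<bar> = \<bar>ctrl_fun (ctrl_scale r c) x\<bar> / real n" using n0 by (simp add: c'_def ctrl_fun_ctrl_scale[of "1 / real n"])
      also have "\<dots> \<le> 1/4" using B[rule_format, of x] n n0 B0 by (simp add: divide_le_eq)
      finally show ?thesis .
    qed
    note small = small[OF this]
    have "reach V 0 z (impulse (\<lambda>x. real m * ctrl_fun c' x) z)" for m
    proof (induction m)
      case 0
      have "impulse (\<lambda>x. 0) z = z" by (simp add: impulse_def M_const)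
      then show ?case using reach_refl[of V z] by simp
    next
      case (Suc m)
      have "reach V 0 z (impulse (\<lambda>x. real m * ctrl_fun c' x + ctrl_fun c' x) z)"
        by (intro reach_impulse_add tp_scale trigpoly_ctrl_fun Suc small)
      then show ?case by (simp add: distrib_right add.commute)
    qed
    from this[of n] show ?thesis using n0 by (simp add: c')
  qed
  then show ?thesis by (simp add: impulsive_def trigpoly_ctrl_fun)
qed

lemma impulsive_const:
  fixes V :: "real^'d::finite \<Rightarrow> real"
  assumes "mbdd V C" shows "impulsive V (\<lambda>x. c)"
proof -
  have "ctrl_fun (c, \<lambda>_. 0, \<lambda>_. 0) = (\<lambda>x::real^'d. c)" by (simp add: ctrl_fun_def fun_eq_iff)
  then show ?thesis using impulsive_control[OF assms, of "(c, \<lambda>_. 0, \<lambda>_. 0)"] by simp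
qed

text \<open>\<open>exp(-\<phi>B/\<surd>\<tau>) exp(\<tau>A) exp(\<phi>B/\<surd>\<tau>)\<close> tends to the impulse \<open>-\<phi>\<^sup>2\<close>, since the double commutator of \<open>A\<close> with
  \<open>\<phi> B\<close> is \<open>-2 \<phi>\<^sup>2 B\<close>.\<close>

lemma reach_minus_square:
  fixes V :: "real^'d::finite \<Rightarrow> real"
  assumes V: "mbdd V C" and \<phi>: "impulsive V \<phi>"
  shows "reach V 0 z (impulse (\<lambda>x. - (\<phi> x * \<phi> x)) z)"
proof -
  note tp = impulsive_tp[OF \<phi>]
  define a v where "a = fst z" and "v = snd z"
  obtain y where y: "M \<phi> (J a) = J y" using tp_M_J[OF tp, of a] by blast
  define F where "F \<tau> = flow V \<tau> (a, v + (sqrt \<tau> / \<tau>) *\<^sub>R J y)" for \<tau>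
  have sl: "(sqrt \<longlongrightarrow> 0) (at_right 0)"
    using tendsto_real_sqrt[OF tendsto_ident_at[of "0::real" "{0<..}"]] by simp
  then have "\<forall>\<^sub>F \<tau> in at_right 0. sqrt \<tau> < 1" by (rule order_tendstoD) simp
  with eventually_at_right_less[of "0::real"] have k: "\<forall>\<^sub>F \<tau> in at_right 0. \<bar>sqrt \<tau>\<bar> \<le> 1" by eventually_elim auto
  note fs = free_step_fst[OF V k, of a v y, folded F_def] free_step_J[OF V k, of a v y, folded F_def]
    free_step_snd[OF V k, of a v y, folded F_def]
  define R where "R \<tau> = (1 / \<tau>) *\<^sub>R (J (fst (F \<tau>)) - J a - sqrt \<tau> *\<^sub>R J y)" for \<tau>
  have lin: "linear (M \<phi>)" using tp_bounded_linear_M[OF tp] bounded_linear.linear by blast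
  define h where "h \<tau> = impulse (\<lambda>x. (- (sqrt \<tau> / \<tau>)) * \<phi> x) (F \<tau>)" for \<tau>
  have lim: "(h \<longlongrightarrow> impulse (\<lambda>x. - (\<phi> x * \<phi> x)) z) (at_right 0)"
  proof -
    have "((\<lambda>\<tau>. (fst (F \<tau>) - sqrt \<tau> *\<^sub>R y) + sqrt \<tau> *\<^sub>R y) \<longlongrightarrow> a + 0 *\<^sub>R y) (at_right 0)"
      by (intro tendsto_intros fs sl)
    then have f: "((\<lambda>\<tau>. fst (h \<tau>)) \<longlongrightarrow> a) (at_right 0)" by (simp add: h_def impulse_def)
    \<comment> \<open>The opposite impulse sees the position
      \<open>J a + sqrt \<tau> J y + \<tau> R \<tau>\<close>. The first term cancels the singular
      velocity, the second leaves the impulse of the negative square, and the third is of order sqrt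
      \<tau>.\<close>
    have "((\<lambda>\<tau>. (snd (F \<tau>) - (sqrt \<tau> / \<tau>) *\<^sub>R J y) - M \<phi> (J y) - sqrt \<tau> *\<^sub>R M \<phi> (R \<tau>)) \<longlongrightarrow> v - M \<phi> (J y) - 0 *\<^sub>R M \<phi> v) (at_right 0)"
      by (intro tendsto_intros fs sl bounded_linear.tendsto[OF tp_bounded_linear_M[OF tp]]) (use fs in \<open>simp add: R_def\<close>)
    moreover have "\<forall>\<^sub>F \<tau> in at_right 0. (snd (F \<tau>) - (sqrt \<tau> / \<tau>) *\<^sub>R J y) - M \<phi> (J y) - sqrt \<tau> *\<^sub>R M \<phi> (R \<tau>) = snd (h \<tau>)"
      using eventually_at_right_less[of "0::real"]
    proof eventually_elim
      case (elim \<tau>)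
      have J: "J (fst (F \<tau>)) = J a + sqrt \<tau> *\<^sub>R J y + \<tau> *\<^sub>R R \<tau>" using elim by (simp add: R_def)
      have s: "sqrt \<tau> / \<tau> * sqrt \<tau> = 1" "sqrt \<tau> / \<tau> * \<tau> = sqrt \<tau>" using elim by (auto simp: field_simps)
      have "snd (h \<tau>) = snd (F \<tau>) - (sqrt \<tau> / \<tau>) *\<^sub>R M \<phi> (J (fst (F \<tau>)))"
        by (simp only: h_def impulse_def snd_conv tp_M_scale[OF tp] scaleR_minus_left diff_conv_add_uminus)
      also have "M \<phi> (J (fst (F \<tau>))) = J y + sqrt \<tau> *\<^sub>R M \<phi> (J y) + \<tau> *\<^sub>R M \<phi> (R \<tau>)"
        unfolding J linear_add[OF lin] linear_cmul[OF lin] y ..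
      finally show ?case by (simp only: scaleR_add_right scaleR_scaleR s scaleR_one) (simp add: algebra_simps)
    qed
    ultimately have s: "((\<lambda>\<tau>. snd (h \<tau>)) \<longlongrightarrow> v - M \<phi> (J y)) (at_right 0)"
      by (simp add: tendsto_cong)
    have "M (\<lambda>x. - (\<phi> x * \<phi> x)) (J a) = - M \<phi> (J y)"
      using tp_M_scale[OF tp_mult[OF tp tp], of "-1" "J a"] tp_M_M[OF tp tp, of "J a"] y by simp
    then have "impulse (\<lambda>x. - (\<phi> x * \<phi> x)) z = (a, v - M \<phi> (J y))" by (simp add: impulse_def a_def v_def)
    with tendsto_Pair[OF f s] show ?thesis by simp
  qed
  have ev: "\<forall>\<^sub>F \<tau> in at_right 0. \<exists>S\<le>\<tau>. reach V S z (h \<tau>)"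
    using eventually_small_time[of C]
  proof eventually_elim
    case (elim \<tau>)
    have 1: "reach V 0 z (a, v + (sqrt \<tau> / \<tau>) *\<^sub>R J y)"
      using impulsive_reach[OF \<phi>, of z "sqrt \<tau> / \<tau>"] tp_M_scale[OF tp, of "sqrt \<tau> / \<tau>" "J a"] y by (simp add: impulse_def a_def v_def)
    have 2: "reach V \<tau> (a, v + (sqrt \<tau> / \<tau>) *\<^sub>R J y) (F \<tau>)"
      unfolding F_def using elim by (intro reach_flow_V[OF V]) auto
    have 3: "reach V 0 (F \<tau>) (h \<tau>)" unfolding h_def by (rule impulsive_reach[OF \<phi>])
    show ?case using reach_seq3[OF 1 2 3] by blast
  qed
  show ?thesis by (rule reach_limit[OF ev lim tendsto_ident_at])
qed

text \<open>With s = r/2, the sum of r and -s times the squares of \<phi> - \<psi>, \<phi>' and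
  \<psi>' equals r \<phi> \<psi>, because the complementary squares turn all pure squares into
  constants. Only negative squares are reachable, so r must be nonnegative; a negative r is handled
  by replacing \<phi> with -\<phi>.\<close>

lemma impulsive_product:
  fixes V :: "real^'d::finite \<Rightarrow> real"
  assumes V: "mbdd V C" and impulsive: "impulsive V \<phi>" "impulsive V \<phi>'" "impulsive V \<psi>" "impulsive V \<psi>'"
    and id: "\<And>x. (\<phi> x)\<^sup>2 + (\<phi>' x)\<^sup>2 = 1" "\<And>x. (\<psi> x)\<^sup>2 + (\<psi>' x)\<^sup>2 = 1"
  shows "impulsive V (\<lambda>x. \<phi> x * \<psi> x)"
proof -
  have sq: "reach V 0 z (impulse (\<lambda>x. - (r * (\<theta> x * \<theta> x))) z)" if "impulsive V \<theta>" "r \<ge> 0" for \<theta> r z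
  proof -
    have "(sqrt r * t) * (sqrt r * t) = r * (t * t)" for t
    proof -
      have "(sqrt r * t) * (sqrt r * t) = (sqrt r * sqrt r) * (t * t)" by (simp only: mult_ac)
      then show ?thesis using that(2) by simp
    qed
    then show ?thesis using reach_minus_square[OF V impulsive_scale[OF that(1), of "sqrt r"], of z] by (simp only:)
  qed
  have main: "reach V 0 z (impulse (\<lambda>x. r * (\<phi> x * \<psi> x)) z)"
    if r: "r \<ge> 0" and \<phi>: "impulsive V \<phi>" and i: "\<And>x. (\<phi> x)\<^sup>2 + (\<phi>' x)\<^sup>2 = 1" for r z \<phi>
  proof -
    define s where "s = r / 2"
    have s: "s \<ge> 0" using r by (simp add: s_def)
    have d: "impulsive V (\<lambda>x. \<phi> x + (-1) * \<psi> x)" by (intro impulsive_add impulsive_scale \<phi> impulsive)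
    let ?p1 = "\<lambda>x. - (s * ((\<phi> x + (-1) * \<psi> x) * (\<phi> x + (-1) * \<psi> x)))"
      and ?p2 = "\<lambda>x. - (s * (\<phi>' x * \<phi>' x))" and ?p3 = "\<lambda>x. - (s * (\<psi>' x * \<psi>' x))" and ?p4 = "\<lambda>x. r * 1"
    have tps: "trigpoly (\<lambda>x. - (s * (\<theta> x * \<theta> x)))" if "impulsive V \<theta>" for \<theta>
      using tp_scale[OF tp_mult[OF impulsive_tp[OF that] impulsive_tp[OF that]], of "- s"] by simp
    have "reach V 0 z (impulse (\<lambda>x. ((?p1 x + ?p2 x) + ?p3 x) + ?p4 x) z)"
      by (intro reach_impulse_add tp_add tps[OF d] tps[OF impulsive(2)] tps[OF impulsive(4)] tp_const
          sq[OF d s] sq[OF impulsive(2) s] sq[OF impulsive(4) s] impulsive_reach[OF impulsive_const[OF V]])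
    moreover have "((?p1 x + ?p2 x) + ?p3 x) + ?p4 x = r * (\<phi> x * \<psi> x)" for x
    proof -
      have "((?p1 x + ?p2 x) + ?p3 x) + ?p4 x = r - s * ((\<phi> x)\<^sup>2 + (\<phi>' x)\<^sup>2) - s * ((\<psi> x)\<^sup>2 + (\<psi>' x)\<^sup>2) + 2 * s * (\<phi> x * \<psi> x)"
        by (simp add: power2_eq_square algebra_simps)
      then show ?thesis unfolding i id by (simp add: s_def)
    qed
    ultimately show ?thesis by simp
  qed
  have "reach V 0 z (impulse (\<lambda>x. r * (\<phi> x * \<psi> x)) z)" for r z
  proof (cases "r \<ge> 0")
    case True
    then show ?thesis by (rule main[OF _ impulsive(1) id(1)])
  next
    case False
    have "reach V 0 z (impulse (\<lambda>x. (- r) * (((-1) * \<phi> x) * \<psi> x)) z)"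
      by (rule main[OF _ impulsive_scale[OF impulsive(1)]]) (use False id(1) in auto)
    then show ?thesis by simp
  qed
  then show ?thesis using tp_mult[OF impulsive_tp[OF impulsive(1)] impulsive_tp[OF impulsive(3)]] by (simp add: impulsive_def)
qed

text \<open>By the addition formulas the frequencies whose cosine and sine are impulsive form a
  subgroup of the integer lattice. It contains the coordinate vectors, hence everything. Cosine and
  sine of one frequency are each other's complementary square.\<close>

lemma impulsive_trigpoly:
  fixes V :: "real^'d::finite \<Rightarrow> real"
  assumes V: "mbdd V C" and "trigpoly \<phi>"
  shows "impulsive V \<phi>"
proof -
  define good where "good l \<longleftrightarrow> impulsive V (\<lambda>x. cos (kdot l x)) \<and> impulsive V (\<lambda>x. sin (kdot l x))" for l :: "int^'d"
  have axis: "good (axis j 1)" for j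
  proof -
    have "ctrl_fun (0, \<lambda>_. 0, \<lambda>i. if i = j then 1 else 0) = (\<lambda>x::real^'d. cos (kdot (axis j 1) x))"
      by (simp add: ctrl_fun_def fun_eq_iff kdot_axis if_distrib[of "\<lambda>y. y * _"] cong: if_cong)
    moreover have "ctrl_fun (0, \<lambda>i. if i = j then 1 else 0, \<lambda>_. 0) = (\<lambda>x::real^'d. sin (kdot (axis j 1) x))"
      by (simp add: ctrl_fun_def fun_eq_iff kdot_axis if_distrib[of "\<lambda>y. y * _"] cong: if_cong)
    ultimately show ?thesis unfolding good_def using impulsive_control[OF V] by metis
  qed
  have zero: "good 0" unfolding good_def using impulsive_const[OF V] by simp
  have neg: "good (- l)" if "good l" for l
    using that impulsive_scale[of V "\<lambda>x. sin (kdot l x)" "-1"] unfolding good_def kdot_minus by simp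
  have add: "good (k + l)" if "good k" "good l" for k l
  proof -
    have k: "impulsive V (\<lambda>x. cos (kdot k x))" "impulsive V (\<lambda>x. sin (kdot k x))"
      and l: "impulsive V (\<lambda>x. cos (kdot l x))" "impulsive V (\<lambda>x. sin (kdot l x))" using that by (auto simp: good_def)
    have cc: "impulsive V (\<lambda>x. cos (kdot k x) * cos (kdot l x))"
      by (rule impulsive_product[OF V k l]) auto
    have ss: "impulsive V (\<lambda>x. sin (kdot k x) * sin (kdot l x))"
      by (rule impulsive_product[OF V k(2,1) l(2,1)]) auto
    have sc: "impulsive V (\<lambda>x. sin (kdot k x) * cos (kdot l x))"
      by (rule impulsive_product[OF V k(2,1) l]) auto
    have cs: "impulsive V (\<lambda>x. cos (kdot k x) * sin (kdot l x))"
      by (rule impulsive_product[OF V k l(2,1)]) auto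
    show ?thesis unfolding good_def kdot_add cos_add sin_add
      using impulsive_add[OF cc impulsive_scale[OF ss, of "-1"]] impulsive_add[OF sc cs] by simp
  qed
  have nat_axis: "good (axis j (int n))" for j n
  proof (induction n)
    case 0
    have "axis j (0::int) = 0" by (simp add: vec_eq_iff axis_def)
    then show ?case using zero by (simp only: of_nat_0)
  next
    case (Suc n)
    have "axis j (int (Suc n)) = axis j (int n) + axis j 1" by (simp add: vec_eq_iff axis_def)
    then show ?case using add[OF Suc axis] by simp
  qed
  have int_axis: "good (axis j m)" for j m
  proof (cases "m \<ge> 0")
    case True
    then show ?thesis using nat_axis[of j "nat m"] by simp
  next
    case False
    have "axis j m = - axis j (int (nat (- m)))" using False by (simp add: vec_eq_iff axis_def)
    then show ?thesis using neg[OF nat_axis[of j "nat (- m)"]] by simp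
  qed
  have "good (\<Sum>j\<in>A. axis j (l $ j))" if "finite A" for A l
    using that by (induction A rule: finite_induct) (auto intro: zero add int_axis)
  moreover have "(\<Sum>j\<in>UNIV. axis j (l $ j)) = l" for l :: "int^'d"
    by (simp add: vec_eq_iff axis_def)
  ultimately have all: "good l" for l by (metis finite)
  show ?thesis using assms(2)
  proof (induction rule: trigpoly.induct)
    case (tp_cos l)
    then show ?case using all[of l] by (simp add: good_def)
  next
    case (tp_sin l)
    then show ?case using all[of l] by (simp add: good_def)
  qed (auto intro: impulsive_add impulsive_scale)
qed

section \<open>Steering velocity and position\<close>

text \<open>The ideal impulse is the quotient f / w of the velocity jump by the position. It need
  not lie in L2, but its square is integrable against the square of w, and there trigonometric
  polynomials are dense.\<close>

lemma reach_velocity: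
  fixes V :: "real^'d::finite \<Rightarrow> real"
  assumes V: "mbdd V C" and nz: "AE x in tm. fn (J a) x \<noteq> 0"
  shows "reach V 0 (a, b) (a, b')"
proof (rule reach_closure)
  fix \<epsilon> :: real assume \<epsilon>: "\<epsilon> > 0"
  define f where "f = fn (b' - b)"
  define w where "w = fn (J a)"
  have L: "L2 f" "L2 w" by (auto simp: f_def w_def)
  note [measurable] = L2_meas[OF L(1)] L2_meas[OF L(2)]
  have i: "integrable tm (\<lambda>x. (f x / w x)\<^sup>2 * (w x)\<^sup>2)"
  proof -
    have "integrable tm (\<lambda>x. (f x / w x)\<^sup>2 * (w x)\<^sup>2) = integrable tm (\<lambda>x. (f x)\<^sup>2)"
      by (rule integrable_cong_AE) (use nz in \<open>auto simp: w_def[symmetric] power_divide\<close>)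
    then show ?thesis using L2_sq_integrable[OF L(1)] by simp
  qed
  have "vol TYPE('d) * \<epsilon>\<^sup>2 > 0" using \<epsilon> by simp
  from weighted_trig_density[OF _ L2_sq_integrable[OF L(2)] _ i this]
  obtain \<phi> where \<phi>: "trigpoly \<phi>" "(LINT x|tm. (f x / w x - \<phi> x)\<^sup>2 * (w x)\<^sup>2) < vol TYPE('d) * \<epsilon>\<^sup>2" by auto
  note [measurable] = tp_tm[OF \<phi>(1)]
  from tp_bounded[OF \<phi>(1)] obtain B where B: "\<forall>x. \<bar>\<phi> x\<bar> \<le> B" ..
  have Lm: "L2 (\<lambda>x. \<phi> x * w x)" unfolding w_def by (rule L2_M[OF tp_tm[OF \<phi>(1)] B[rule_format]])
  have "nsq (\<lambda>x. f x - \<phi> x * w x) = (LINT x|tm. (f x / w x - \<phi> x)\<^sup>2 * (w x)\<^sup>2)"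
  proof (rule integral_cong_AE)
    show "AE x in tm. (f x - \<phi> x * w x)\<^sup>2 = (f x / w x - \<phi> x)\<^sup>2 * (w x)\<^sup>2"
      using nz unfolding w_def[symmetric]
      by eventually_elim (simp add: power_mult_distrib[symmetric] left_diff_distrib)
  qed auto
  moreover have "FC (\<lambda>x. f x - \<phi> x * w x) = (b' - b) - M \<phi> (J a)"
    by (simp add: FC_diff[OF L(1) Lm]) (simp add: f_def w_def M_def)
  ultimately have "vol TYPE('d) * (norm ((b' - b) - M \<phi> (J a)))\<^sup>2 < vol TYPE('d) * \<epsilon>\<^sup>2"
    using norm_FC[OF L2_diff[OF L(1) Lm]] \<phi>(2) by simp
  then have "(norm ((b' - b) - M \<phi> (J a)))\<^sup>2 < \<epsilon>\<^sup>2"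
    using mult_less_cancel_left_pos[OF vol_pos[where 'd='d]] by blast
  then have n: "norm ((b' - b) - M \<phi> (J a)) < \<epsilon>" by (rule power2_less_imp_less) (use \<epsilon> in simp)
  have "reach V 0 (a, b) (impulse \<phi> (a, b))" using impulsive_reach[OF impulsive_trigpoly[OF V \<phi>(1)], of "(a, b)" 1] by simp
  moreover have "dist (impulse \<phi> (a, b)) (a, b') < \<epsilon>"
    using n norm_minus_commute[of "b' - b" "M \<phi> (J a)"] by (simp add: impulse_def dist_Pair_Pair dist_norm algebra_simps)
  ultimately show "\<exists>S z''. S \<le> \<epsilon> \<and> reach V S (a, b) z'' \<and> dist z'' (a, b') < \<epsilon>"
    using \<epsilon> by (intro exI[of _ 0] exI[of _ "impulse \<phi> (a, b)"]) auto
qed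

lemma reach_scaling:
  fixes V :: "real^'d::finite \<Rightarrow> real"
  assumes V: "mbdd V C" and l: "l \<noteq> 0"
  shows "reach V 0 (a, v) (l *\<^sub>R a, (1 / l) *\<^sub>R v)"
proof -
  \<comment> \<open>The first impulse moves the position from a to (1 + \<kappa>) a = l a. The
    identity \<kappa> + \<beta> (1 + \<kappa>) = 0 lets the second impulse cancel the velocity of
    order 1/\<tau>, and what remains is v + \<beta> v = v / l.\<close>
  define \<kappa> \<beta> where "\<kappa> = l - 1" and "\<beta> = 1 / l - 1"
  have kb: "\<kappa> + \<beta> * (1 + \<kappa>) = 0" "1 + \<beta> = 1 / l" "1 + \<kappa> = l"
    using l by (auto simp: \<kappa>_def \<beta>_def field_simps)
  note one = impulsive_reach[OF impulsive_const[OF V, of 1]]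
  define F where "F \<tau> = flow V \<tau> (a, v + (\<kappa> / \<tau>) *\<^sub>R J a)" for \<tau>
  have k: "\<forall>\<^sub>F \<tau> in at_right (0::real). \<bar>\<kappa>\<bar> \<le> \<bar>\<kappa>\<bar>" by simp
  note fs = free_step_fst[OF V k, of a v a, folded F_def] free_step_J[OF V k, of a v a, folded F_def]
    free_step_snd[OF V k, of a v a, folded F_def]
  define R where "R \<tau> = (1 / \<tau>) *\<^sub>R (J (fst (F \<tau>)) - J a - \<kappa> *\<^sub>R J a)" for \<tau>
  define h where "h \<tau> = impulse (\<lambda>x. (\<beta> / \<tau>) * 1) (F \<tau>)" for \<tau>
  have lim: "(h \<longlongrightarrow> (l *\<^sub>R a, (1 / l) *\<^sub>R v)) (at_right 0)"
  proof -
    have "((\<lambda>\<tau>. (fst (F \<tau>) - \<kappa> *\<^sub>R a) + \<kappa> *\<^sub>R a) \<longlongrightarrow> a + \<kappa> *\<^sub>R a) (at_right 0)"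
      by (intro tendsto_intros fs)
    moreover have "a + \<kappa> *\<^sub>R a = l *\<^sub>R a" unfolding kb(3)[symmetric] by (simp add: scaleR_add_left)
    ultimately have f: "((\<lambda>\<tau>. fst (h \<tau>)) \<longlongrightarrow> l *\<^sub>R a) (at_right 0)" by (simp add: h_def impulse_def)
    have "((\<lambda>\<tau>. (snd (F \<tau>) - (\<kappa> / \<tau>) *\<^sub>R J a) + \<beta> *\<^sub>R R \<tau>) \<longlongrightarrow> v + \<beta> *\<^sub>R v) (at_right 0)"
      unfolding R_def by (intro tendsto_intros fs)
    moreover have "v + \<beta> *\<^sub>R v = (1 / l) *\<^sub>R v" unfolding kb(2)[symmetric] by (simp add: scaleR_add_left)
    moreover have "\<forall>\<^sub>F \<tau> in at_right 0. (snd (F \<tau>) - (\<kappa> / \<tau>) *\<^sub>R J a) + \<beta> *\<^sub>R R \<tau> = snd (h \<tau>)"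
      using eventually_at_right_less[of "0::real"]
    proof eventually_elim
      case (elim \<tau>)
      have J: "J (fst (F \<tau>)) = (1 + \<kappa>) *\<^sub>R J a + \<tau> *\<^sub>R R \<tau>" using elim by (simp add: R_def scaleR_add_left)
      have "snd (h \<tau>) = snd (F \<tau>) + (\<beta> / \<tau>) *\<^sub>R J (fst (F \<tau>))"
        by (simp add: h_def impulse_def M_const)
      also have "(\<beta> / \<tau>) *\<^sub>R J (fst (F \<tau>)) = (\<beta> * (1 + \<kappa>) / \<tau>) *\<^sub>R J a + \<beta> *\<^sub>R R \<tau>"
        unfolding J using elim by (simp add: scaleR_add_right)
      also have "\<beta> * (1 + \<kappa>) = - \<kappa>" using kb(1) by simp
      finally show ?case by simp
    qed
    ultimately have "((\<lambda>\<tau>. snd (h \<tau>)) \<longlongrightarrow> (1 / l) *\<^sub>R v) (at_right 0)" by (simp add: tendsto_cong)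
    with tendsto_Pair[OF f this] show ?thesis by simp
  qed
  have ev: "\<forall>\<^sub>F \<tau> in at_right 0. \<exists>S\<le>\<tau>. reach V S (a, v) (h \<tau>)"
    using eventually_small_time[of C]
  proof eventually_elim
    case (elim \<tau>)
    have 1: "reach V 0 (a, v) (a, v + (\<kappa> / \<tau>) *\<^sub>R J a)"
      using one[of "(a, v)" "\<kappa> / \<tau>"] by (simp add: impulse_def M_const)
    have 2: "reach V \<tau> (a, v + (\<kappa> / \<tau>) *\<^sub>R J a) (F \<tau>)"
      unfolding F_def using elim by (intro reach_flow_V[OF V]) auto
    have 3: "reach V 0 (F \<tau>) (h \<tau>)" unfolding h_def by (rule one)
    show ?case using reach_seq3[OF 1 2 3] by blast
  qed
  show ?thesis by (rule reach_limit[OF ev lim tendsto_ident_at])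
qed

text \<open>Conjugating the free flow over time \<open>\<theta> l\<^sup>2\<close> by the scaling of ratio \<open>l \<rightarrow> 0\<close> suppresses the
  Laplacian and leaves the displacement by \<open>\<theta>\<close> times the velocity.\<close>

lemma reach_shear:
  fixes V :: "real^'d::finite \<Rightarrow> real"
  assumes V: "mbdd V C" and \<theta>: "\<theta> > 0"
  shows "reach V 0 (a, J p) (a + \<theta> *\<^sub>R p, J p)"
proof -
  define F where "F \<tau> = flow V \<tau> (a, 0 + (\<theta> / \<tau>) *\<^sub>R J p)" for \<tau>
  have k: "\<forall>\<^sub>F \<tau> in at_right (0::real). \<bar>\<theta>\<bar> \<le> \<bar>\<theta>\<bar>" by simp
  note fs = free_step_fst[OF V k, of a 0 p, folded F_def] free_step_snd[OF V k, of a 0 p, folded F_def]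
  define h where "h \<tau> = (fst (F \<tau>), (\<tau> / \<theta>) *\<^sub>R snd (F \<tau>))" for \<tau>
  have lim: "(h \<longlongrightarrow> (a + \<theta> *\<^sub>R p, J p)) (at_right 0)"
  proof -
    have "((\<lambda>\<tau>. (fst (F \<tau>) - \<theta> *\<^sub>R p) + \<theta> *\<^sub>R p) \<longlongrightarrow> a + \<theta> *\<^sub>R p) (at_right 0)"
      by (intro tendsto_intros fs)
    then have f: "((\<lambda>\<tau>. fst (h \<tau>)) \<longlongrightarrow> a + \<theta> *\<^sub>R p) (at_right 0)" by (simp add: h_def)
    \<comment> \<open>The factor \<tau>/\<theta> makes the bounded part of the velocity negligible
      and normalises the singular part to \<open>J p\<close>.\<close>
    have "((\<lambda>\<tau>. (\<tau> / \<theta>) *\<^sub>R (snd (F \<tau>) - (\<theta> / \<tau>) *\<^sub>R J p) + J p) \<longlongrightarrow> (0 / \<theta>) *\<^sub>R 0 + J p) (at_right 0)"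
      by (intro tendsto_intros fs) (use \<theta> in auto)
    moreover have "\<forall>\<^sub>F \<tau> in at_right 0. (\<tau> / \<theta>) *\<^sub>R (snd (F \<tau>) - (\<theta> / \<tau>) *\<^sub>R J p) + J p = snd (h \<tau>)"
      using eventually_at_right_less[of "0::real"]
      by eventually_elim (use \<theta> in \<open>simp add: h_def scaleR_diff_right\<close>)
    ultimately have "((\<lambda>\<tau>. snd (h \<tau>)) \<longlongrightarrow> J p) (at_right 0)" by (simp add: tendsto_cong)
    with tendsto_Pair[OF f this] show ?thesis by simp
  qed
  have ev: "\<forall>\<^sub>F \<tau> in at_right 0. \<exists>S\<le>\<tau>. reach V S (a, J p) (h \<tau>)"
    using eventually_small_time[of C]
  proof eventually_elim
    case (elim \<tau>)
    \<comment> \<open>Since 1 / l = l \<theta> / \<tau>, the scaled state is l times the initial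
      state of F. By homogeneity of the flow the factor l passes through, and the inverse scaling
      turns l F into h.\<close>
    define l where "l = sqrt (\<tau> / \<theta>)"
    have l: "l \<noteq> 0" "l * l = \<tau> / \<theta>" using elim \<theta> by (auto simp: l_def)
    have l2: "1 / l = l * (\<theta> / \<tau>)"
    proof -
      have "l * (\<theta> / \<tau>) * l = 1" using l(2) elim \<theta> by (simp add: field_simps)
      then show ?thesis using l(1) \<theta> by (simp add: field_simps)
    qed
    have 1: "reach V 0 (a, J p) (l *\<^sub>R (a, 0 + (\<theta> / \<tau>) *\<^sub>R J p))"
      using reach_scaling[OF V l(1), of a "J p"] by (simp add: l2)
    have "reach V \<tau> (l *\<^sub>R (a, 0 + (\<theta> / \<tau>) *\<^sub>R J p)) (flow V \<tau> (l *\<^sub>R (a, 0 + (\<theta> / \<tau>) *\<^sub>R J p)))"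
      using elim by (intro reach_flow_V[OF V]) auto
    moreover have "flow V \<tau> (l *\<^sub>R (a, 0 + (\<theta> / \<tau>) *\<^sub>R J p)) = l *\<^sub>R F \<tau>"
      unfolding F_def using elim by (intro flow_scale[OF V]) auto
    ultimately have 2: "reach V \<tau> (l *\<^sub>R (a, 0 + (\<theta> / \<tau>) *\<^sub>R J p)) (l *\<^sub>R F \<tau>)"
      by (simp only:)
    have "reach V 0 (l *\<^sub>R F \<tau>) ((1 / l) *\<^sub>R l *\<^sub>R fst (F \<tau>), (1 / (1 / l)) *\<^sub>R l *\<^sub>R snd (F \<tau>))"
      using reach_scaling[OF V, of "1 / l" "l *\<^sub>R fst (F \<tau>)" "l *\<^sub>R snd (F \<tau>)"] l(1) by (simp add: scaleR_prod_def)
    then have 3: "reach V 0 (l *\<^sub>R F \<tau>) (h \<tau>)" using l by (simp add: h_def)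
    show ?case using reach_seq3[OF 1 2 3] by blast
  qed
  show ?thesis by (rule reach_limit[OF ev lim tendsto_ident_at])
qed

text \<open>The sets on which -f / g takes the value \<theta> are disjoint for distinct \<theta>. A
  finite measure charges at most countably many of them, whereas the interval is
  uncountable.\<close>

lemma exists_nonvanishing_combination:
  fixes f g :: "real^'d::finite \<Rightarrow> real"
  assumes [measurable]: "f \<in> borel_measurable tm" "g \<in> borel_measurable tm"
    and nz: "AE x in tm. f x \<noteq> 0 \<or> g x \<noteq> 0" and d: "\<delta> > 0"
  shows "\<exists>\<theta>. 0 < \<theta> \<and> \<theta> < \<delta> \<and> (AE x in tm. f x + \<theta> * g x \<noteq> 0)"
proof -
  \<comment> \<open>Where g vanishes, f does not, so the combination is nonzero there for every
    \<theta>; any default value will do, and \<theta> > 0 avoids the value 0.\<close>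
  define h where "h x = (if g x = 0 then 0 else - f x / g x)" for x
  have h[measurable]: "h \<in> borel_measurable tm" unfolding h_def by measurable
  interpret D: finite_measure "distr tm borel h"
    by (rule finite_measure.finite_measure_distr[OF finite_measure_tm h])
  have "uncountable {0<..<\<delta>}" using d by (simp add: uncountable_open_interval)
  then obtain \<theta> where \<theta>: "\<theta> \<in> {0<..<\<delta>}" "measure (distr tm borel h) {\<theta>} = 0"
    using D.countable_support countable_subset by (metis (mono_tags, lifting) mem_Collect_eq subsetI)
  have "{x \<in> space tm. h x = \<theta>} \<in> null_sets tm"
  proof
    have "emeasure (distr tm borel h) {\<theta>} = 0" using \<theta>(2) by (simp add: D.emeasure_eq_measure)
    moreover have "h -` {\<theta>} \<inter> space tm = {x \<in> space tm. h x = \<theta>}" by auto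
    ultimately show "emeasure tm {x \<in> space tm. h x = \<theta>} = 0" by (subst (asm) emeasure_distr) auto
    show "{x \<in> space tm. h x = \<theta>} \<in> sets tm" by measurable
  qed
  then have "AE x in tm. \<not> (x \<in> {x \<in> space tm. h x = \<theta>})" by (rule AE_not_in)
  then have "AE x in tm. f x + \<theta> * g x \<noteq> 0"
    using nz AE_space
  proof eventually_elim
    case (elim x)
    then have "h x \<noteq> \<theta>" by blast
    then show ?case using elim by (auto simp: h_def field_simps split: if_splits)
  qed
  then show ?thesis using \<theta>(1) by auto
qed

lemma J_FC_const: "J (FC (\<lambda>x::real^'d::finite. 1)) = FC (\<lambda>x. 1)"
proof (rule hs_eqI)
  fix k :: "int^'d"
  have f: "fc (\<lambda>x::real^'d. 1) k = (if k = 0 then 1 else 0)"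
    using integral_ek[of "- k"] by (simp add: fc_eq)
  have "om (0 :: int^'d) = 1" by (simp add: om_def ksq_def)
  then show "hc (J (FC (\<lambda>x::real^'d. 1))) k = hc (FC (\<lambda>x. 1)) k"
    by (simp add: hc_J hc_FC[OF L2_const] f)
qed

lemma reach_from_nonvanishing:
  fixes V :: "real^'d::finite \<Rightarrow> real"
  assumes V: "mbdd V C" and nz: "AE x in tm. fn (J a) x \<noteq> 0"
  shows "reach V 0 (a, b) (a', b')"
proof (rule reach_closure)
  fix \<epsilon> :: real assume \<epsilon>: "\<epsilon> > 0"
  let ?e = "FC (\<lambda>x::real^'d. 1)"
  have e1: "norm ?e + 1 > 0" by (simp add: add_nonneg_pos)
  obtain \<theta> where \<theta>: "0 < \<theta>" "\<theta> < \<epsilon> / (norm ?e + 1)" "AE x in tm. fn (J a') x + \<theta> * 1 \<noteq> 0"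
    using exists_nonvanishing_combination[of "fn (J a')" "\<lambda>x. 1" "\<epsilon> / (norm ?e + 1)"] \<epsilon> e1 by auto
  \<comment> \<open>\<open>J\<close> fixes constants (\<open>J_FC_const\<close>), so this shift of
    the code adds the constant \<theta> to the target position.\<close>
  define a2 where "a2 = a' + \<theta> *\<^sub>R ?e"
  have "AE x in tm. fn (J a2) x = fn (J a') x + \<theta> * 1"
    using fn_add[of "J a'" "\<theta> *\<^sub>R ?e"] fn_scale[of \<theta> ?e] fn_FC[OF L2_const[of 1, where 'a='d]]
    by eventually_elim (simp add: a2_def J_add J_scale J_FC_const)
  with \<theta>(3) have nz2: "AE x in tm. fn (J a2) x \<noteq> 0" by eventually_elim simp
  have 1: "reach V 0 (a, b) (a, J (a2 - a))" by (rule reach_velocity[OF V nz])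
  have 2: "reach V 0 (a, J (a2 - a)) (a2, J (a2 - a))" using reach_shear[OF V, of 1 a "a2 - a"] by simp
  have 3: "reach V 0 (a2, J (a2 - a)) (a2, b')" by (rule reach_velocity[OF V nz2])
  have "\<theta> * norm ?e \<le> \<theta> * (norm ?e + 1)" using \<theta>(1) by simp
  also have "\<dots> < \<epsilon>" using \<theta>(2) e1 by (simp only: pos_less_divide_eq)
  finally have "dist (a2, b') (a', b') < \<epsilon>" using \<theta>(1) by (simp add: dist_Pair_Pair dist_norm a2_def)
  then show "\<exists>S z''. S \<le> \<epsilon> \<and> reach V S (a, b) z'' \<and> dist z'' (a', b') < \<epsilon>"
    using reach_seq3[OF 1 2 3] \<epsilon> by (intro exI[of _ 0] exI[of _ "(a2, b')"]) auto
qed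

section \<open>Back to functions on the torus\<close>

lemma H1_imp_J_preimage:
  assumes "H1 w" shows "\<exists>a. FC w = J a"
proof (rule exists_J_preimage)
  have L: "L2 w" and s: "(\<lambda>k. ksq k * (cmod (fc w k))\<^sup>2) summable_on UNIV" using assms by (auto simp: H1_def)
  fix F :: "(int^'a) set" assume F: "finite F"
  have "(\<Sum>k\<in>F. (om k)\<^sup>2 * (cmod (hc (FC w) k))\<^sup>2) = (\<Sum>k\<in>F. (cmod (fc w k))\<^sup>2) + (\<Sum>k\<in>F. ksq k * (cmod (fc w k))\<^sup>2)"
    by (simp add: hc_FC[OF L] om_sq distrib_right sum.distrib)
  also have "\<dots> \<le> (\<Sum>\<^sub>\<infinity>k. (cmod (fc w k))\<^sup>2) + (\<Sum>\<^sub>\<infinity>k. ksq k * (cmod (fc w k))\<^sup>2)"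
    by (intro add_mono finite_sum_le_infsum s parseval(1)[OF L] F) (auto simp: ksq_nonneg)
  finally show "(\<Sum>k\<in>F. (om k)\<^sup>2 * (cmod (hc (FC w) k))\<^sup>2) \<le> (\<Sum>\<^sub>\<infinity>k. (cmod (fc w k))\<^sup>2) + (\<Sum>\<^sub>\<infinity>k. ksq k * (cmod (fc w k))\<^sup>2)" .
qed

text \<open>The weight \<open>(om k)\<^sup>2 = 1 + ksq k\<close> splits each mode into its L2 part
  and its gradient part.\<close>

lemma
  fixes w :: "real^'d::finite \<Rightarrow> real"
  assumes L: "L2 w" and a: "FC w = J a"
  shows H1_of_J: "H1 w" and H1_norm_of_J: "grad_sq w + nsq w = vol TYPE('d) * (norm a)\<^sup>2"
proof -
  have fc: "fc w k = hc (J a) k" for k using hc_FC[OF L] a by metis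
  have eq: "ksq k * (cmod (fc w k))\<^sup>2 + (cmod (fc w k))\<^sup>2 = (cmod (hc a k))\<^sup>2" for k
  proof -
    have "ksq k * (cmod (fc w k))\<^sup>2 + (cmod (fc w k))\<^sup>2 = (om k)\<^sup>2 * (cmod (fc w k))\<^sup>2"
      by (simp add: om_sq distrib_right)
    also have "\<dots> = (cmod (hc a k))\<^sup>2"
      using om_pos[of k] by (simp add: fc hc_J power_mult_distrib field_simps)
    finally show ?thesis .
  qed
  have s: "(\<lambda>k. ksq k * (cmod (fc w k))\<^sup>2) summable_on UNIV"
  proof (rule summable_on_comparison_test[OF hc_summable[of a]])
    show "ksq k * (cmod (fc w k))\<^sup>2 \<le> (cmod (hc a k))\<^sup>2" for k unfolding eq[symmetric] by simp
  qed (simp add: ksq_nonneg)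
  then show "H1 w" using L by (simp add: H1_def)
  have "(\<Sum>\<^sub>\<infinity>k. ksq k * (cmod (fc w k))\<^sup>2) + (\<Sum>\<^sub>\<infinity>k. (cmod (fc w k))\<^sup>2) = (norm a)\<^sup>2"
    unfolding norm_hs_sq eq[symmetric] by (rule infsum_add[symmetric, OF s parseval(1)[OF L]])
  then show "grad_sq w + nsq w = vol TYPE('d) * (norm a)\<^sup>2"
    unfolding grad_sq_def parseval(2)[OF L] by (simp only: distrib_left[symmetric])
qed

lemma hl_norm_of_J:
  fixes w v :: "real^'d::finite \<Rightarrow> real"
  assumes "L2 w" "FC w = J a" "L2 v"
  shows "hl_norm (w, v) = sqrt (vol TYPE('d)) * norm (a, FC v)"
proof -
  have "hl_norm (w, v) = sqrt (vol TYPE('d) * (norm a)\<^sup>2 + vol TYPE('d) * (norm (FC v))\<^sup>2)"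
    unfolding hl_norm_def fst_conv snd_conv H1_norm_of_J[OF assms(1,2)] norm_FC[OF assms(3)] ..
  also have "\<dots> = sqrt (vol TYPE('d)) * norm (a, FC v)"
    by (simp only: norm_Pair real_sqrt_mult[symmetric] distrib_left)
  finally show ?thesis .
qed

lemma hl_dist_of_J:
  fixes w v w' v' :: "real^'d::finite \<Rightarrow> real"
  assumes "L2 w" "FC w = J a" "L2 v" "L2 w'" "FC w' = J a'" "L2 v'"
  shows "hl_dist (w, v) (w', v') = sqrt (vol TYPE('d)) * dist (a, FC v) (a', FC v')"
proof -
  have "hl_dist (w, v) (w', v') = hl_norm (\<lambda>x. w x - w' x, \<lambda>x. v x - v' x)" by (simp add: hl_dist_def)
  also have "\<dots> = sqrt (vol TYPE('d)) * norm (a - a', FC (\<lambda>x. v x - v' x))"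
    by (rule hl_norm_of_J) (simp_all add: assms L2_diff FC_diff J_diff)
  finally show ?thesis by (simp add: assms FC_diff dist_norm)
qed

text \<open>Translates codes back into states, up to null sets; by \<open>hl_dist_dec\<close> it is
  an isometry up to the constant normalising the Fourier coefficients.\<close>

definition dec :: "'d::finite hs \<times> 'd hs \<Rightarrow> 'd state" where
  "dec z = (fn (J (fst z)), fn (snd z))"

lemma hl_dist_dec: "hl_dist (dec z) (dec z') = sqrt (vol TYPE('d)) * dist z z'" for z :: "'d::finite hs \<times> 'd hs"
  unfolding dec_def by (subst hl_dist_of_J[of _ "fst z" _ _ "fst z'"]) auto

lemma pot_mbdd:
  assumes "mbdd V C" shows "\<exists>D. mbdd (pot V c) D"
proof -
  from tp_bounded[OF trigpoly_ctrl_fun[of c]] obtain B where B: "\<forall>x. \<bar>ctrl_fun c x\<bar> \<le> B" ..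
  show ?thesis unfolding pot_ctrl_fun
    using mbdd_add[OF assms mbdd_bounded[OF tp_tm[OF trigpoly_ctrl_fun] B[rule_format]]] by blast
qed

text \<open>Applying \<open>U t\<close> to the integral equation of the interaction picture turns
  \<open>G\<close> at time s into the sine and cosine kernels at t - s; reading off the k-th
  coefficient is bounded linear and commutes with the integral.\<close>

lemma traj_mild_sol:
  fixes V :: "real^'d::finite \<Rightarrow> real"
  assumes V: "mbdd V C" and Y: "traj V T u z0 Y"
    and w0: "\<And>k. fc w0 k = hc (J (fst z0)) k" and v0: "\<And>k. fc v0 k = hc (snd z0) k"
  shows "mild_sol V T u (w0, v0) (\<lambda>t. dec (U t (Y t)))"
  unfolding mild_sol_def
proof (intro conjI ballI allI)
  fix t assume t: "t \<in> {0..T}"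
  show "H1 (fst (dec (U t (Y t))))" unfolding dec_def fst_conv by (rule H1_of_J) auto
  show "L2 (snd (dec (U t (Y t))))" by (simp add: dec_def)
  have c: "continuous_on {0..T} (\<lambda>s. U s (Y s))"
    using Y by (intro U_joint_continuous continuous_intros) (simp add: traj_def)
  then have "((\<lambda>s. dist (U s (Y s)) (U t (Y t))) \<longlongrightarrow> 0) (at t within {0..T})"
    using t unfolding continuous_on_def tendsto_dist_iff[symmetric] by (rule bspec)
  then show "((\<lambda>s. hl_dist (dec (U s (Y s))) (dec (U t (Y t)))) \<longlongrightarrow> 0) (at t within {0..T})"
    unfolding hl_dist_dec by (rule tendsto_mult_right_zero)
  fix k :: "int^'d"
  have int: "((\<lambda>s. G (pot V (u s)) s (Y s)) has_integral (Y t - z0)) {0..t}" using Y t by (simp add: traj_def)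
  have Kc: "hc (K (pot V c) b) k = fc (\<lambda>x. pot V c x * fn (J b) x) k" for c b
    using pot_mbdd[OF V, of c] by (auto simp: K_def hc_FC mbdd_L2)
  have GU: "U t (G (pot V (u s)) s (Y s)) = (St (t - s) (K (pot V (u s)) (fst (U s (Y s)))), Ct (t - s) (K (pot V (u s)) (fst (U s (Y s)))))" for s
    unfolding G_def U_add by (simp add: U_def linear_0[OF linear_Ct] linear_0[OF linear_St])
  have b1: "bounded_linear (\<lambda>z. hc (J (fst (U t z))) k)"
    by (intro bounded_linear_compose[OF bounded_linear_hc] bounded_linear_compose[OF bounded_linear_J]
        bounded_linear_compose[OF bounded_linear_fst] bounded_linear_U)
  have b2: "bounded_linear (\<lambda>z. hc (snd (U t z)) k)"
    by (intro bounded_linear_compose[OF bounded_linear_hc] bounded_linear_compose[OF bounded_linear_snd] bounded_linear_U)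
  have om0: "om k \<noteq> 0" using om_pos[of k] by simp
  have I1: "integral {0..t} (\<lambda>s. complex_of_real (sin (om k * (t - s)) / om k) * fc (\<lambda>x. pot V (u s) x * fst (dec (U s (Y s))) x) k)
      = hc (J (fst (U t (Y t - z0)))) k"
  proof (rule integral_unique)
    have "((\<lambda>s. hc (J (fst (U t (G (pot V (u s)) s (Y s))))) k) has_integral hc (J (fst (U t (Y t - z0)))) k) {0..t}"
      using has_integral_linear[OF int b1] by (simp add: o_def)
    then show "((\<lambda>s. complex_of_real (sin (om k * (t - s)) / om k) * fc (\<lambda>x. pot V (u s) x * fst (dec (U s (Y s))) x) k)
        has_integral hc (J (fst (U t (Y t - z0)))) k) {0..t}"
      by (simp add: GU hc_J hc_St Kc dec_def scaleR_conv_of_real field_simps om0)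
  qed
  show "fc (fst (dec (U t (Y t)))) k =
      complex_of_real (cos (om k * t)) * fc (fst (w0, v0)) k
      + complex_of_real (sin (om k * t) / om k) * fc (snd (w0, v0)) k
      + integral {0..t} (\<lambda>s. complex_of_real (sin (om k * (t - s)) / om k) *
            fc (\<lambda>x. pot V (u s) x * fst (dec (U s (Y s))) x) k)"
    unfolding I1
    by (simp add: dec_def U_diff J_diff w0 v0 U_def[of t z0] hc_J hc_Ct hc_St scaleR_conv_of_real field_simps om0)
  have "integral {0..t} (\<lambda>s. complex_of_real (cos (om k * (t - s))) * fc (\<lambda>x. pot V (u s) x * fst (dec (U s (Y s))) x) k)
      = hc (snd (U t (Y t - z0))) k"
  proof (rule integral_unique)
    have "((\<lambda>s. hc (snd (U t (G (pot V (u s)) s (Y s)))) k) has_integral hc (snd (U t (Y t - z0))) k) {0..t}"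
      using has_integral_linear[OF int b2] by (simp add: o_def)
    then show "((\<lambda>s. complex_of_real (cos (om k * (t - s))) * fc (\<lambda>x. pot V (u s) x * fst (dec (U s (Y s))) x) k)
        has_integral hc (snd (U t (Y t - z0))) k) {0..t}"
      by (simp add: GU hc_Ct Kc dec_def scaleR_conv_of_real)
  qed
  then show "fc (snd (dec (U t (Y t)))) k =
      complex_of_real (- om k * sin (om k * t)) * fc (fst (w0, v0)) k
      + complex_of_real (cos (om k * t)) * fc (snd (w0, v0)) k
      + integral {0..t} (\<lambda>s. complex_of_real (cos (om k * (t - s))) *
            fc (\<lambda>x. pot V (u s) x * fst (dec (U s (Y s))) x) k)"
    by (simp add: dec_def U_diff w0 v0 U_def[of t z0] hc_J hc_Ct hc_St scaleR_conv_of_real field_simps om0)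
qed

lemma reach_approx_reachable:
  fixes V :: "real^'d::finite \<Rightarrow> real"
  assumes V: "mbdd V C" and r: "reach V 0 (a, FC v0) (a', FC (snd Wf))"
    and 0: "L2 w0" "FC w0 = J a" "L2 v0" and f: "L2 (fst Wf)" "FC (fst Wf) = J a'" "L2 (snd Wf)"
  shows "approx_reachable V 0 (w0, v0) Wf"
  unfolding approx_reachable_def
proof (intro allI impI)
  fix \<epsilon> :: real assume \<epsilon>: "\<epsilon> > 0"
  let ?s = "sqrt (vol TYPE('d))"
  have s: "?s > 0" by simp
  \<comment> \<open>The two bounds in the minimum serve different purposes: \<epsilon> limits the
    time, and \<epsilon> / \<open>?s\<close> compensates for the factor between the two
    distances.\<close>
  obtain T g where g: "T \<le> 0 + min \<epsilon> (\<epsilon> / ?s)" "prog V T g" "dist (g (a, FC v0)) (a', FC (snd Wf)) < min \<epsilon> (\<epsilon> / ?s)"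
    using r \<epsilon> s unfolding reach_def by (metis divide_pos_pos min_less_iff_conj)
  obtain u Y where u: "T \<ge> 0" "piecewise_const T u" "traj V T u (a, FC v0) Y" "U T (Y T) = g (a, FC v0)"
    using g(2) unfolding prog_def by blast
  have "mild_sol V T u (w0, v0) (\<lambda>t. dec (U t (Y t)))"
    by (rule traj_mild_sol[OF V u(3)]) (simp_all add: hc_FC[OF 0(1)] hc_FC[OF 0(3)] 0(2)[symmetric])
  moreover have "hl_dist (dec (U T (Y T))) Wf < \<epsilon>"
  proof -
    have "hl_dist (dec (g (a, FC v0))) (fst Wf, snd Wf) = ?s * dist (g (a, FC v0)) (a', FC (snd Wf))"
      unfolding dec_def by (subst hl_dist_of_J[of _ "fst (g (a, FC v0))" _ _ a']) (auto simp: f)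
    also have "\<dots> < ?s * (\<epsilon> / ?s)" using g(3) s by (intro mult_strict_left_mono) auto
    also have "\<dots> = \<epsilon>" using s by simp
    finally show ?thesis using u(4) by simp
  qed
  ultimately show "\<exists>T1\<in>{0..0 + \<epsilon>}. \<exists>u. piecewise_const T1 u \<and> (\<exists>W. mild_sol V T1 u (w0, v0) W \<and> hl_dist (W T1) Wf < \<epsilon>)"
    using u(1,2) g(1) by (intro bexI[of _ T] exI[of _ u] conjI exI[of _ "\<lambda>t. dec (U t (Y t))"]) auto
qed

theorem mainTheorem3:
  fixes V :: "real^'d::finite \<Rightarrow> real" and \<rho> :: real
    and w0 v0 :: "real^'d \<Rightarrow> real"
  assumes rho: "(CARD('d) = 1 \<and> \<rho> = 2) \<or> (CARD('d) = 2 \<and> \<rho> > 2)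
                \<or> (CARD('d) \<ge> 3 \<and> \<rho> = real CARD('d))"
    and V: "Lp \<rho> V"
    and init: "(H1 w0 \<and> L2 v0 \<and> {x\<in>cube. w0 x = 0} \<in> null_sets lebesgue)
             \<or> (H1 w0 \<and> H1 v0 \<and> {x\<in>cube. w0 x = 0 \<and> v0 x = 0} \<in> null_sets lebesgue)"
  shows "Tmin V (w0, v0) = 0"
proof -
  obtain C where C: "mbdd V C" using potential_mbdd[OF rho V] by blast
  have w0: "H1 w0" "L2 w0" and v0: "L2 v0" using init by (auto simp: H1_def)
  obtain a where a: "FC w0 = J a" using H1_imp_J_preimage[OF w0(1)] by blast
  have wa: "AE x in tm. fn (J a) x = w0 x" using fn_FC[OF w0(2)] a by simp
  have ae: "AE x in tm. \<not> P x" if "{x\<in>cube. P x} \<in> null_sets lebesgue" for P :: "real^'d \<Rightarrow> bool"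
  proof -
    have "AE x in lebesgue. x \<in> cube \<longrightarrow> \<not> P x" using AE_not_in[OF that] by eventually_elim auto
    then show ?thesis by (subst AE_restrict_space_iff) auto
  qed
  have reach: "reach V 0 (a, FC v0) z" for z
    using init
  proof (elim disjE conjE)
    assume "{x\<in>cube. w0 x = 0} \<in> null_sets lebesgue"
    from ae[OF this] wa have "AE x in tm. fn (J a) x \<noteq> 0" by eventually_elim simp
    from reach_from_nonvanishing[OF C this, of "FC v0" "fst z" "snd z"] show ?thesis by simp
  next
    assume v: "H1 v0" and n: "{x\<in>cube. w0 x = 0 \<and> v0 x = 0} \<in> null_sets lebesgue"
    obtain p where p: "FC v0 = J p" using H1_imp_J_preimage[OF v] by blast
    have vp: "AE x in tm. fn (J p) x = v0 x" using fn_FC[OF v0] p by simp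
    have "AE x in tm. fn (J a) x \<noteq> 0 \<or> fn (J p) x \<noteq> 0" using ae[OF n] wa vp by eventually_elim auto
    from exists_nonvanishing_combination[OF fn_meas fn_meas this, of 1]
    obtain \<theta> where \<theta>: "\<theta> > 0" "AE x in tm. fn (J a) x + \<theta> * fn (J p) x \<noteq> 0" by auto
    \<comment> \<open>The sheared position encodes w0 + \<theta> v0, because the initial velocity,
      being in H1, has a code of the form \<open>J p\<close>.\<close>
    have "AE x in tm. fn (J (a + \<theta> *\<^sub>R p)) x \<noteq> 0"
      using \<theta>(2) fn_add[of "J a" "\<theta> *\<^sub>R J p"] fn_scale[of \<theta> "J p"]
      by eventually_elim (simp add: J_add J_scale)
    from reach_from_nonvanishing[OF C this, of "J p" "fst z" "snd z"]
    have "reach V 0 (a + \<theta> *\<^sub>R p, J p) z" by simp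
    from reach_trans[OF reach_shear[OF C \<theta>(1)] this] show ?thesis by (simp add: p)
  qed
  have "approx_controllable V 0 (w0, v0)"
    unfolding approx_controllable_def
  proof (intro allI impI)
    fix Wf :: "'d state" assume Wf: "H1 (fst Wf) \<and> L2 (snd Wf)"
    then obtain a' where a': "FC (fst Wf) = J a'" using H1_imp_J_preimage by blast
    show "approx_reachable V 0 (w0, v0) Wf"
      by (rule reach_approx_reachable[OF C reach w0(2) a v0 _ a']) (use Wf in \<open>auto simp: H1_def\<close>)
  qed
  then have "0 \<in> {T. 0 \<le> T \<and> approx_controllable V T (w0, v0)}" by simp
  then have "Tmin V (w0, v0) \<le> ereal 0" unfolding Tmin_def by (intro Inf_lower imageI)
  moreover have "0 \<le> Tmin V (w0, v0)" unfolding Tmin_def by (rule Inf_greatest) auto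
  ultimately show ?thesis by (simp add: antisym zero_ereal_def[symmetric])
qed

end
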